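(* Let $\beta\in\{1,2,4\}$, $N\ge 1$, and let $X$ be a random $N\times N$ matrix with real ($\beta=1$), complex ($\beta=2$) or quaternion ($\beta=4$) entries, whose rows $\mathbf x_1,\dots,\mathbf x_N$ are independent. Below, $\alpha$ is any real number for which the stated expectation is finite. (i) (Gaussian weight) If for each $l$ the row $\mathbf x_l$ has density $(2\pi\sigma_l^2)^{-\beta N/2}e^{-|\mathbf x|^2/2\sigma_l^2}$ on $\mathbb R^{\beta N}$, with $\sigma_l>0$, then $$\Big\langle|\det X|^{2\alpha}\Big\rangle=\prod_{l=1}^N(2\sigma_l^2)^\alpha\,(\beta(N-l+1)/2)_\alpha,\qquad |\det X|^2\mathop{=}\limits^{\rm d}\prod_{l=1}^N\sigma_l^2\,\chi^2_{\beta l}.$$ (ii) (Beta type I weight) If for each $l$ the row $\mathbf x_l$ has density $\pi^{-\beta N/2}(\beta\nu_l/2)_{\beta N/2}(1-|\mathbf x|^2)^{\beta\nu_l/2-1}$ on the unit ball of $\mathbb R^{\beta N}$, with $\nu_l>0$, then $$\Big\langle|\det X|^{2\alpha}\Big\rangle=\prod_{l=1}^N\frac{(\beta(N-l+1)/2)_\alpha}{(\beta(N+\nu_l)/2)_\alpha},\qquad |\det X|^2\mathop{=}\limits^{\rm d}\prod_{l=1}^N{\rm Beta}[\beta(N-l+1)/2,\ \beta(\nu_l+l-1)/2].$$ (iii) (Beta type II weight) If for each $l$ the row $\mathbf x_l$ has density $\pi^{-\beta N/2}(\omega_l/2)_{\beta N/2}(1+|\mathbf x|^2)^{-(\beta N+\omega_l)/2}$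 on $\mathbb R^{\beta N}$, with $\omega_l>0$, then $$\Big\langle|\det X|^{2\alpha}\Big\rangle=\prod_{l=1}^N(\beta(N-l+1)/2)_\alpha\,(\beta\omega_l/2)_{-\alpha},\qquad |\det X|^2\mathop{=}\limits^{\rm d}\prod_{l=1}^N{\rm BetaP}[\beta(N-l+1)/2,\ \beta\omega_l/2].$$
   Context: $\langle\cdot\rangle$ denotes expectation, and $(c)_s=\Gamma(c+s)/\Gamma(c)$ for real $s$. A row $\mathbf x=(x_1,\dots,x_N)$ with real, complex or quaternion entries is identified with a vector in $\mathbb R^{\beta N}$ (each entry has $\beta$ real components), $|x_i|^2$ is the sum of the squares of the real components of $x_i$, and $|\mathbf x|^2=\sum_i|x_i|^2$; densities are with respect to Lebesgue measure on $\mathbb R^{\beta N}$. $|\det X|^2:=\det X^\dagger X$. In the quaternion case $X$ is represented as a $2N\times 2N$ complex matrix whose entries are the $2\times2$ blocks $\begin{bmatrix} z&w\\-\bar w&\bar z\end{bmatrix}$, and $\det X^\dagger X$ is the quaternion determinant, i.e. the positive square root of the ordinary determinant of the $2N\times2N$ complex matrix $X^\dagger X$ (equivalently, the product of the $N$ doubly degenerate eigenvalues of $X^\dagger X$, each counted once). A product of distributions on the right of $\mathop{=}\limits^{\rm d}$ denotes the distribution of a product of independent random variables with those distributions. $\chi^2_j$ is the chi-squared distribution with $j$ degrees of freedom; ${\rm Beta}[a,b]$ is the beta distribution on $(0,1)$ with density proportional to $y^{a-1}(1-y)^{b-1}$; ${\rm BetaP}[a,b]$ is the beta prime distribution on $(0,\infty)$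 with density proportional to $y^{a-1}/(1+y)^{a+b}$.
   Formalization: In (iii) the row density is taken with βω_l in place of ω_l, the conclusions being unchanged; as printed, (iii) fails for β=2,4 (for N=1, β=2 the printed density gives BetaP[1, ω/2], not BetaP[1, ω]), while for β=1 nothing changes. *)

theory Defs
  imports "HOL-Probability.Probability" "Jordan_Normal_Form.Schur_Decomposition"
begin

definition rpoch :: "real \<Rightarrow> real \<Rightarrow> real" where
  "rpoch c s = Gamma (c + s) / Gamma c"

(* A row of N entries is its list of real components: the value at (j, k) is component
   k < b of entry j < N.  This space is R^(b N) with Lebesgue measure. *)

definition row_space :: "nat \<Rightarrow> nat \<Rightarrow> (nat \<times> nat \<Rightarrow> real) measure" where
  "row_space b N = Pi\<^sub>M ({..<N} \<times> {..<b}) (\<lambda>_. lborel)"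

definition row_norm_sq :: "nat \<Rightarrow> nat \<Rightarrow> (nat \<times> nat \<Rightarrow> real) \<Rightarrow> real" where
  "row_norm_sq b N v = (\<Sum>j<N. \<Sum>k<b. (v (j, k))\<^sup>2)"

(* The rows are x 1, ..., x N; matrix indices start at 0. *)

definition real_matrix :: "nat \<Rightarrow> (nat \<Rightarrow> nat \<times> nat \<Rightarrow> real) \<Rightarrow> real mat" where
  "real_matrix N x = Matrix.mat N N (\<lambda>(i, j). x (Suc i) (j, 0))"

definition complex_matrix :: "nat \<Rightarrow> (nat \<Rightarrow> nat \<times> nat \<Rightarrow> real) \<Rightarrow> complex mat" where
  "complex_matrix N x =
     Matrix.mat N N (\<lambda>(i, j). Complex (x (Suc i) (j, 0)) (x (Suc i) (j, 1)))"

(* The entries of the 2 by 2 block [z, w; - cnj w, cnj z] of a quaternion. *)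

definition quat_block :: "complex \<Rightarrow> complex \<Rightarrow> nat \<Rightarrow> nat \<Rightarrow> complex" where
  "quat_block z w p q =
     (if p = 0 then (if q = 0 then z else w) else (if q = 0 then - cnj w else cnj z))"

definition quat_matrix :: "nat \<Rightarrow> (nat \<Rightarrow> nat \<times> nat \<Rightarrow> real) \<Rightarrow> complex mat" where
  "quat_matrix N x =
     Matrix.mat (2 * N) (2 * N) (\<lambda>(i, j).
       let r = x (Suc (i div 2)); m = j div 2
       in quat_block (Complex (r (m, 0)) (r (m, 1))) (Complex (r (m, 2)) (r (m, 3)))
            (i mod 2) (j mod 2))"

(* The squared modulus of the determinant, det (X^dagger X).  For complex X this is a
   nonnegative real number, hence the real parts; for quaternions it is the square root of
   the complex determinant.  Only b = 1, 2, 4 are meaningful. *)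

definition abs_det_sq :: "nat \<Rightarrow> nat \<Rightarrow> (nat \<Rightarrow> nat \<times> nat \<Rightarrow> real) \<Rightarrow> real" where
  "abs_det_sq b N x =
     (if b = 1 then
        Determinant.det (mat_adjoint (real_matrix N x) * real_matrix N x)
      else if b = 2 then
        Re (Determinant.det (mat_adjoint (complex_matrix N x) * complex_matrix N x))
      else
        sqrt (Re (Determinant.det (mat_adjoint (quat_matrix N x) * quat_matrix N x))))"

definition gauss_row_density :: "nat \<Rightarrow> nat \<Rightarrow> real \<Rightarrow> (nat \<times> nat \<Rightarrow> real) \<Rightarrow> real" where
  "gauss_row_density b N s v =
     (2 * pi * s\<^sup>2) powr (- (real b * real N / 2)) * exp (- row_norm_sq b N v / (2 * s\<^sup>2))"

definition beta1_row_density :: "nat \<Rightarrow> nat \<Rightarrow> real \<Rightarrow> (nat \<times> nat \<Rightarrow> real) \<Rightarrow> real" where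
  "beta1_row_density b N n v =
     (if row_norm_sq b N v < 1
      then pi powr (- (real b * real N / 2)) * rpoch (real b * n / 2) (real b * real N / 2)
             * (1 - row_norm_sq b N v) powr (real b * n / 2 - 1)
      else 0)"

(* Unlike n in the type I density, c is not multiplied by b. *)

definition beta2_row_density :: "nat \<Rightarrow> nat \<Rightarrow> real \<Rightarrow> (nat \<times> nat \<Rightarrow> real) \<Rightarrow> real" where
  "beta2_row_density b N c v =
     pi powr (- (real b * real N / 2)) * rpoch (c / 2) (real b * real N / 2)
       * (1 + row_norm_sq b N v) powr (- ((real b * real N + c) / 2))"

definition chi_squared :: "nat \<Rightarrow> real measure" where
  "chi_squared j =
     distr (Pi\<^sub>M {..<j} (\<lambda>_. density lborel (\<lambda>t. ennreal (std_normal_density t)))) borel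
       (\<lambda>z. \<Sum>i<j. (z i)\<^sup>2)"

definition beta_law :: "real \<Rightarrow> real \<Rightarrow> real measure" where
  "beta_law a b = density lborel
     (\<lambda>y. ennreal (if 0 < y \<and> y < 1
                   then y powr (a - 1) * (1 - y) powr (b - 1) / Beta a b else 0))"

definition beta_prime_law :: "real \<Rightarrow> real \<Rightarrow> real measure" where
  "beta_prime_law a b = density lborel
     (\<lambda>y. ennreal (if 0 < y
                   then y powr (a - 1) / (1 + y) powr (a + b) / Beta a b else 0))"

(* The law of a product of independent random variables with laws D l, l in L. *)

definition product_law :: "nat set \<Rightarrow> (nat \<Rightarrow> real measure) \<Rightarrow> real measure" where
  "product_law L D = distr (Pi\<^sub>M L D) borel (\<lambda>y. \<Prod>l\<in>L. y l)"

end

theory Submission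
  imports Defs
begin

text \<open>A unitary rotation depending on the last row turns that row into a multiple of the last basis
  vector; as the other rows have radial laws, their laws do not change. Hence \<open>|det X|\<^sup>2\<close> is \<open>|x\<^sub>N|\<^sup>2\<close>
  times an independent \<open>|det X'|\<^sup>2\<close>, where the rows of \<open>X'\<close> are the first \<open>N - 1\<close> entries of the other
  rows, again with radial laws. Iterating, \<open>|det X|\<^sup>2\<close> is distributed as a product of independent
  squared norms of the first \<open>l\<close> entries of the \<open>l\<close>-th row; the order of the rows being immaterial,
  \<open>l\<close> may be replaced by \<open>N - l + 1\<close>. The marginals and the laws of the squared norms are Gamma and
  Beta integrals.\<close>

section \<open>Linear maps preserving Lebesgue measure\<close>

text \<open>The rotation is chosen separately for each value of the last row, which Fubini holds
  fixed in the inner integral. That integral then depends on this row through its norm only, so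
  measurability of the rotation in the row never becomes a question. The quaternion determinant is
  defined through a complex matrix of twice the size; hence all three fields are treated as complex
  matrices, and |det X|^2 is a root of the squared modulus of an ordinary determinant. Lebesgue
  measure, however, lives on real components. The two sides meet in the Householder reflection,
  which is one complex matrix and also a product of real reflections. For Beta rows the parameters
  belong to individual rows, so passing from dimension l to N - l + 1 is a genuine statement on the
  law and not a renaming of factors. The Gamma quotients of the moment formulas keep real values at
  exponents where the expectation diverges; moments are therefore computed in [0, \<infinity>],
  where divergence is visible.\<close>

definition preserves_lebesgue :: "'i set \<Rightarrow> (('i \<Rightarrow> real) \<Rightarrow> 'i \<Rightarrow> real) \<Rightarrow> bool" where
  "preserves_lebesgue I T \<longleftrightarrow>
     T \<in> measurable (Pi\<^sub>M I (\<lambda>_. lborel)) (Pi\<^sub>M I (\<lambda>_. lborel)) \<and>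
     distr (Pi\<^sub>M I (\<lambda>_. lborel)) (Pi\<^sub>M I (\<lambda>_. lborel)) T = Pi\<^sub>M I (\<lambda>_. lborel)"

lemma preserves_lebesgue_id: "preserves_lebesgue I (\<lambda>y. y)"
  by (simp add: preserves_lebesgue_def distr_id)

lemma preserves_lebesgue_comp:
  assumes "preserves_lebesgue I S" "preserves_lebesgue I T"
  shows "preserves_lebesgue I (\<lambda>y. S (T y))"
  using assms distr_distr[of S "Pi\<^sub>M I (\<lambda>_. lborel)" "Pi\<^sub>M I (\<lambda>_. lborel)" T "Pi\<^sub>M I (\<lambda>_. lborel)"]
  by (auto simp: preserves_lebesgue_def comp_def intro: measurable_compose)

lemma preserves_lebesgue_cong:
  assumes "preserves_lebesgue I S" "\<And>y. y \<in> extensional I \<Longrightarrow> S y = T y"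
  shows "preserves_lebesgue I T"
proof -
  have *: "S y = T y" if "y \<in> space (Pi\<^sub>M I (\<lambda>_. lborel :: real measure))" for y
    using that assms(2) by (auto simp: space_PiM PiE_def)
  have "T \<in> measurable (Pi\<^sub>M I (\<lambda>_. lborel)) (Pi\<^sub>M I (\<lambda>_. lborel))"
    using assms(1) measurable_cong[of "Pi\<^sub>M I (\<lambda>_. lborel)" S T "Pi\<^sub>M I (\<lambda>_. lborel)", OF *]
    unfolding preserves_lebesgue_def by blast
  moreover have "distr (Pi\<^sub>M I (\<lambda>_. lborel)) (Pi\<^sub>M I (\<lambda>_. lborel)) T = distr (Pi\<^sub>M I (\<lambda>_. lborel)) (Pi\<^sub>M I (\<lambda>_. lborel)) S"
    by (intro distr_cong) (auto simp: *)
  ultimately show ?thesis using assms(1) by (simp add: preserves_lebesgue_def)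
qed

text \<open>Fubini with coordinate \<open>i\<close> innermost: on every line parallel to that axis
  the map is \<open>t\<close> to \<open>e * t\<close> plus a constant, because \<open>g\<close>
  ignores that coordinate, and \<open>\<bar>e\<bar> = 1\<close> keeps lengths. Shears use
  \<open>e = 1\<close>, reflections \<open>e = -1\<close>.\<close>

lemma preserves_lebesgue_coordinate_map:
  fixes g :: "('i \<Rightarrow> real) \<Rightarrow> real"
  assumes I: "finite I" "i \<in> I" and e: "\<bar>e\<bar> = 1"
    and g: "g \<in> borel_measurable (Pi\<^sub>M I (\<lambda>_. lborel))"
    and g_indep: "\<And>y t. g (y(i := t)) = g y"
  shows "preserves_lebesgue I (\<lambda>y. y(i := e * y i + g y))" (is "preserves_lebesgue I ?T")
proof -
  interpret product_sigma_finite "\<lambda>_ :: 'i. lborel :: real measure" ..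
  let ?M = "Pi\<^sub>M I (\<lambda>_ :: 'i. lborel :: real measure)"
  let ?J = "I - {i}"
  have ins: "insert i ?J = I" using I by auto
  note g[measurable]
  have T: "?T \<in> measurable ?M ?M"
  proof (rule measurable_PiM_single')
    show "?T \<in> space ?M \<rightarrow> (\<Pi>\<^sub>E i\<in>I. space lborel)"
      using I by (auto simp: space_PiM PiE_def extensional_def)
    fix j assume j: "j \<in> I"
    have "(\<lambda>y. if j = i then e * y i + g y else y j) \<in> measurable ?M lborel"
      using I j by (cases "j = i") (simp_all, measurable)
    thus "(\<lambda>y. ?T y j) \<in> measurable ?M lborel" by (simp add: fun_upd_def)
  qed
  have "distr ?M ?M ?T = ?M"
  proof (rule measure_eqI)
    fix A assume "A \<in> sets (distr ?M ?M ?T)"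
    hence A[measurable]: "A \<in> sets ?M" by simp
    have "emeasure (distr ?M ?M ?T) A = (\<integral>\<^sup>+y. indicator A y \<partial>distr ?M ?M ?T)"
      by simp
    also have "\<dots> = (\<integral>\<^sup>+y. indicator A (?T y) \<partial>?M)"
      using T by (subst nn_integral_distr) auto
    also have "\<dots> = (\<integral>\<^sup>+y. indicator A (?T y) \<partial>Pi\<^sub>M (insert i ?J) (\<lambda>_. lborel))"
      by (simp only: ins)
    also have "\<dots> = (\<integral>\<^sup>+x. (\<integral>\<^sup>+t. indicator A (?T (x(i := t))) \<partial>lborel) \<partial>Pi\<^sub>M ?J (\<lambda>_. lborel))"
      using I T by (intro product_nn_integral_insert) (auto simp: insert_absorb intro!: measurable_compose[OF T])
    also have "\<dots> = (\<integral>\<^sup>+x. (\<integral>\<^sup>+t. indicator A (x(i := t)) \<partial>lborel) \<partial>Pi\<^sub>M ?J (\<lambda>_. lborel))"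
    proof (rule nn_integral_cong)
      fix x assume x: "x \<in> space (Pi\<^sub>M ?J (\<lambda>_. lborel :: real measure))"
      have m: "(\<lambda>t. indicator A (x(i := t)) :: ennreal) \<in> borel_measurable borel"
        using measurable_component_update[OF x, of i] A I
        by (auto simp: insert_absorb comp_def intro!: measurable_compose[OF _ borel_measurable_indicator])
      have "(\<integral>\<^sup>+t. indicator A (x(i := t)) \<partial>lborel) = \<bar>e\<bar> * (\<integral>\<^sup>+t. indicator A (x(i := g x + e * t)) \<partial>lborel)"
        using m e by (intro nn_integral_real_affine) auto
      thus "(\<integral>\<^sup>+t. indicator A (?T (x(i := t))) \<partial>lborel) = (\<integral>\<^sup>+t. indicator A (x(i := t)) \<partial>lborel)"
        using e by (simp add: g_indep add.commute)
    qed
    also have "\<dots> = (\<integral>\<^sup>+y. indicator A y \<partial>Pi\<^sub>M (insert i ?J) (\<lambda>_. lborel))"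
      using I by (intro product_nn_integral_insert[symmetric]) (auto simp: insert_absorb)
    also have "\<dots> = emeasure ?M A" using A by (simp only: ins nn_integral_indicator)
    finally show "emeasure (distr ?M ?M ?T) A = emeasure ?M A" .
  qed simp
  with T show ?thesis by (simp add: preserves_lebesgue_def)
qed

text \<open>The shear never alters \<open>y i\<close>, so it can be built up one target coordinate
  at a time, each step being a coordinate map.\<close>

lemma preserves_lebesgue_shear:
  fixes c :: "'i \<Rightarrow> real"
  assumes I: "finite I" "i \<in> I" and J: "J \<subseteq> I - {i}"
  shows "preserves_lebesgue I (\<lambda>y j. if j \<in> J then y j + c j * y i else y j)"
proof -
  have "finite J" using J I finite_subset by blast
  thus ?thesis using J
  proof (induction J rule: finite_induct)
    case empty
    then show ?case by (simp add: preserves_lebesgue_id)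
  next
    case (insert k J)
    have k: "k \<in> I" "k \<noteq> i" "k \<notin> J" using insert by auto
    have ci: "(\<lambda>y. c k * y i) \<in> borel_measurable (Pi\<^sub>M I (\<lambda>_. lborel))"
      using I by measurable
    have "preserves_lebesgue I (\<lambda>y. y(k := 1 * y k + c k * y i))"
      using k I ci by (intro preserves_lebesgue_coordinate_map) auto
    from preserves_lebesgue_comp[OF this insert.IH] insert.prems
    have "preserves_lebesgue I (\<lambda>y. (\<lambda>y. y(k := 1 * y k + c k * y i))
            (\<lambda>j. if j \<in> J then y j + c j * y i else y j))" by auto
    thus ?case
    proof (rule preserves_lebesgue_cong)
      show "(\<lambda>y. y(k := 1 * y k + c k * y i)) (\<lambda>j. if j \<in> J then y j + c j * y i else y j) =
        (\<lambda>j. if j \<in> insert k J then y j + c j * y i else y j)" for y :: "'i \<Rightarrow> real"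
        using k insert.prems by (auto simp: fun_eq_iff)
    qed
  qed
qed

text \<open>After the shear that moves \<open>v\<close> to a multiple of the \<open>i\<close>-th basis vector, the
  reflection changes only the \<open>i\<close>-th coordinate.\<close>

lemma preserves_lebesgue_reflection:
  fixes v :: "'i \<Rightarrow> real"
  assumes I: "finite I" and s: "s = (\<Sum>i\<in>I. (v i)\<^sup>2)" "s \<noteq> 0"
  shows "preserves_lebesgue I (\<lambda>y. \<lambda>j\<in>I. y j - 2 / s * (\<Sum>i\<in>I. y i * v i) * v j)"
proof -
  obtain i where i: "i \<in> I" "v i \<noteq> 0"
    using s by (metis (no_types, lifting) sum.neutral zero_power2)
  let ?J = "I - {i}"
  define S where "S = (\<lambda>(y :: 'i \<Rightarrow> real) j. if j \<in> ?J then y j + (- v j / v i) * y i else y j)"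
  define S' where "S' = (\<lambda>(y :: 'i \<Rightarrow> real) j. if j \<in> ?J then y j + (v j / v i) * y i else y j)"
  \<comment> \<open>With z = S y, the inner product of y and v is s z_i / v_i plus the sum of z_j
    v_j over j \<noteq> i. The first summand turns z_i into -z_i, the rest of the correction is
    \<open>g\<close>; \<open>S'\<close> undoes the shear.\<close>
  define g where "g = (\<lambda>y :: 'i \<Rightarrow> real. - 2 / s * v i * (\<Sum>j\<in>?J. y j * v j))"
  define W where "W = (\<lambda>y. y(i := (-1) * y i + g y))"
  have "g \<in> borel_measurable (Pi\<^sub>M I (\<lambda>_. lborel))"
    unfolding g_def by measurable
  moreover have "g (y(i := t)) = g y" for y t
    by (auto simp: g_def intro!: sum.cong)
  ultimately have W: "preserves_lebesgue I W"
    unfolding W_def using I i by (intro preserves_lebesgue_coordinate_map) auto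
  have S: "preserves_lebesgue I S" "preserves_lebesgue I S'"
    unfolding S_def S'_def using I i by (intro preserves_lebesgue_shear; auto)+
  have "preserves_lebesgue I (\<lambda>y. S' (W (S y)))"
    using S W by (intro preserves_lebesgue_comp[OF S(2)] preserves_lebesgue_comp[OF W])
  thus ?thesis
  proof (rule preserves_lebesgue_cong)
    fix y :: "'i \<Rightarrow> real" assume y: "y \<in> extensional I"
    have sJ: "s = (v i)\<^sup>2 + (\<Sum>j\<in>?J. (v j)\<^sup>2)" 
      using I i by (simp add: s(1) sum.remove)
    have yJ: "(\<Sum>j\<in>I. y j * v j) = y i * v i + (\<Sum>j\<in>?J. y j * v j)" 
      using I i by (simp add: sum.remove)
    have Si: "S y i = y i" by (simp add: S_def)
    have "(\<Sum>j\<in>?J. S y j * v j) = (\<Sum>j\<in>?J. y j * v j - y i / v i * (v j)\<^sup>2)"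
      by (intro sum.cong) (auto simp: S_def field_simps power2_eq_square)
    also have "\<dots> = (\<Sum>j\<in>?J. y j * v j) - y i / v i * (\<Sum>j\<in>?J. (v j)\<^sup>2)"
      by (simp add: sum_subtractf sum_distrib_left)
    also have "\<dots> = (\<Sum>j\<in>I. y j * v j) - y i / v i * s"
      unfolding sJ yJ using i by (simp add: field_simps power2_eq_square)
    finally have WS: "W (S y) i = y i - 2 / s * (\<Sum>j\<in>I. y j * v j) * v i"
      using s i by (simp add: W_def g_def Si field_simps)
    have WSj: "W (S y) j = S y j" if "j \<noteq> i" for j using that by (simp add: W_def)
    show "S' (W (S y)) = (\<lambda>j\<in>I. y j - 2 / s * (\<Sum>i\<in>I. y i * v i) * v j)"
    proof
      fix j
      consider "j = i" | "j \<in> ?J" | "j \<notin> I" by auto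
      thus "S' (W (S y)) j = (\<lambda>j\<in>I. y j - 2 / s * (\<Sum>i\<in>I. y i * v i) * v j) j"
      proof cases
        case 1
        then show ?thesis using i WS by (simp add: S'_def)
      next
        case 2
        hence "S' (W (S y)) j = S y j + v j / v i * W (S y) i" using WSj by (simp add: S'_def)
        also have "\<dots> = y j - 2 / s * (\<Sum>i\<in>I. y i * v i) * v j"
          using 2 i by (simp add: WS) (simp add: S_def field_simps)
        finally show ?thesis using 2 by simp
      next
        case 3
        then show ?thesis using y i WSj[of j] by (auto simp: S'_def S_def extensional_def)
      qed
    qed
  qed
qed

text \<open>Orthogonality makes the corrections additive: the earlier reflections leave the inner
  product with \<open>w m\<close> unchanged, so composing with the next reflection just adds its
  term. The common squared length \<open>s\<close> gives one factor for all of them.\<close>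

lemma preserves_lebesgue_orthogonal_reflections:
  fixes w :: "nat \<Rightarrow> 'i \<Rightarrow> real"
  assumes I: "finite I" and s: "s \<noteq> 0"
    and orth: "\<And>a b. a < m \<Longrightarrow> b < m \<Longrightarrow> (\<Sum>i\<in>I. w a i * w b i) = (if a = b then s else 0)"
  shows "preserves_lebesgue I (\<lambda>y. \<lambda>j\<in>I. y j - 2 / s * (\<Sum>a<m. (\<Sum>i\<in>I. y i * w a i) * w a j))"
  using orth
proof (induction m)
  case 0
  show ?case by (rule preserves_lebesgue_cong[OF preserves_lebesgue_id])
      (auto simp: fun_eq_iff extensional_def)
next
  case (Suc m)
  let ?T = "\<lambda>y. \<lambda>j\<in>I. y j - 2 / s * (\<Sum>a<m. (\<Sum>i\<in>I. y i * w a i) * w a j)"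
  have "preserves_lebesgue I (\<lambda>y. \<lambda>j\<in>I. y j - 2 / s * (\<Sum>i\<in>I. y i * w m i) * w m j)"
    using I s Suc.prems[of m m] by (intro preserves_lebesgue_reflection) (auto simp: power2_eq_square)
  from preserves_lebesgue_comp[OF this Suc.IH] Suc.prems
  have "preserves_lebesgue I (\<lambda>y. (\<lambda>y. \<lambda>j\<in>I. y j - 2 / s * (\<Sum>i\<in>I. y i * w m i) * w m j) (?T y))" by auto
  thus ?case
  proof (rule preserves_lebesgue_cong)
    fix y :: "'i \<Rightarrow> real"
    have "(\<Sum>i\<in>I. ?T y i * w m i) = (\<Sum>i\<in>I. y i * w m i - 2 / s * (\<Sum>a<m. (\<Sum>i\<in>I. y i * w a i) * (w a i * w m i)))"
      by (intro sum.cong) (auto simp: algebra_simps sum_distrib_right sum_distrib_left)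
    also have "\<dots> = (\<Sum>i\<in>I. y i * w m i) - 2 / s * (\<Sum>a<m. (\<Sum>i\<in>I. y i * w a i) * (\<Sum>i\<in>I. w a i * w m i))"
      by (subst sum_subtractf, subst sum_distrib_left[symmetric], subst sum.swap)
         (simp add: sum_distrib_left)
    also have "(\<Sum>a<m. (\<Sum>i\<in>I. y i * w a i) * (\<Sum>i\<in>I. w a i * w m i)) = 0"
      using Suc.prems by (intro sum.neutral) auto
    finally have *: "(\<Sum>i\<in>I. ?T y i * w m i) = (\<Sum>i\<in>I. y i * w m i)" by simp
    show "(\<lambda>j\<in>I. ?T y j - 2 / s * (\<Sum>i\<in>I. ?T y i * w m i) * w m j) =
          (\<lambda>j\<in>I. y j - 2 / s * (\<Sum>a<Suc m. (\<Sum>i\<in>I. y i * w a i) * w a j))"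
      unfolding * by (auto simp: fun_eq_iff algebra_simps)
  qed
qed

section \<open>Matrices over the reals, complex numbers and quaternions\<close>

text \<open>The common complex format for the three fields: real and complex entries are blocks of
  size 1, quaternions blocks of size 2.\<close>

definition block_size :: "nat \<Rightarrow> nat" where
  "block_size b = (if b = 4 then 2 else 1)"

definition entry_block :: "nat \<Rightarrow> (nat \<Rightarrow> real) \<Rightarrow> nat \<Rightarrow> nat \<Rightarrow> complex" where
  "entry_block b r p q =
     (if b = 4 then quat_block (Complex (r 0) (r 1)) (Complex (r 2) (r 3)) p q
      else if b = 2 then Complex (r 0) (r 1) else complex_of_real (r 0))"

definition cmatrix :: "nat \<Rightarrow> nat \<Rightarrow> (nat \<Rightarrow> nat \<times> nat \<Rightarrow> real) \<Rightarrow> complex mat" where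
  "cmatrix b N x = Matrix.mat (block_size b * N) (block_size b * N) (\<lambda>(i, j).
     entry_block b (\<lambda>k. x (Suc (i div block_size b)) (j div block_size b, k))
       (i mod block_size b) (j mod block_size b))"

lemma cmatrix_carrier: "cmatrix b N x \<in> carrier_mat (block_size b * N) (block_size b * N)"
  by (simp add: cmatrix_def)

text \<open>Left multiplication of the entry \<open>r\<close> by the \<open>u\<close>-th of the units \<open>1, i, j, k\<close>.\<close>

definition unit_mult :: "nat \<Rightarrow> nat \<Rightarrow> (nat \<Rightarrow> real) \<Rightarrow> nat \<Rightarrow> real" where
  "unit_mult b u r k =
     (if u = 0 then r k
      else if b = 2 then (if k = 0 then - r 1 else r 0)
      else if u = 1 then (if k = 0 then - r 1 else if k = 1 then r 0 else if k = 2 then - r 3 else r 2)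
      else if u = 2 then (if k = 0 then - r 2 else if k = 1 then r 3 else if k = 2 then r 0 else - r 1)
      else (if k = 0 then - r 3 else if k = 1 then - r 2 else if k = 2 then r 1 else r 0))"

lemma sum_lessThan_4: "(\<Sum>k<(4::nat). f k) = f 0 + f 1 + f 2 + (f 3 :: 'a :: comm_monoid_add)"
  by (simp add: eval_nat_numeral lessThan_Suc ac_simps)

lemma sum_lessThan_2: "(\<Sum>k<(2::nat). f k) = f 0 + (f 1 :: 'a :: comm_monoid_add)"
  by (simp add: eval_nat_numeral lessThan_Suc ac_simps)

lemma less_4_cases: "a < (4::nat) \<Longrightarrow> a = 0 \<or> a = 1 \<or> a = 2 \<or> a = 3" by arith
lemma less_2_cases: "a < (2::nat) \<Longrightarrow> a = 0 \<or> a = 1" by arith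

text \<open>For quaternions, the real inner product of u r and w r is the real part of u r conj(r)
  conj(w) = |r|^2 u conj(w), which vanishes for distinct units. Here it is a finite check on
  components.\<close>

lemma unit_mult_orthogonal:
  assumes "b \<in> {1, 2, 4}" "u < b" "w < b"
  shows "(\<Sum>k<b. unit_mult b u r k * unit_mult b w r k) = (if u = w then \<Sum>k<b. (r k)\<^sup>2 else 0)"
proof -
  consider "b = 1" | "b = 2" | "b = 4" using assms by auto
  thus ?thesis
  proof cases
    case 3
    with assms have "u = 0 \<or> u = 1 \<or> u = 2 \<or> u = 3" "w = 0 \<or> w = 1 \<or> w = 2 \<or> w = 3"
      using less_4_cases by auto
    with 3 show ?thesis
      by (elim disjE) (simp_all add: unit_mult_def sum_lessThan_4 power2_eq_square)
  next
    case 2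
    with assms have "u = 0 \<or> u = 1" "w = 0 \<or> w = 1"
      using less_2_cases by auto
    with 2 show ?thesis
      by (elim disjE) (simp_all add: unit_mult_def sum_lessThan_2 power2_eq_square)
  qed (use assms in \<open>auto simp: unit_mult_def power2_eq_square\<close>)
qed

lemma unit_mult_linear: "unit_mult b u (\<lambda>k. r k + c * t k) k = unit_mult b u r k + c * unit_mult b u t k"
  by (simp add: unit_mult_def)

text \<open>The u-th component of y conj(v) is the real inner product of y with u v. This translates
  the real coefficients of reflections into matrix products.\<close>

lemma entry_block_times_adjoint:
  assumes "b \<in> {1, 2, 4}" "p < block_size b" "q < block_size b"
  shows "(\<Sum>r<block_size b. entry_block b y p r * cnj (entry_block b v q r)) =
         entry_block b (\<lambda>u. \<Sum>k<b. y k * unit_mult b u v k) p q"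
proof -
  consider "b = 1" | "b = 2" | "b = 4" using assms by auto
  thus ?thesis
  proof cases
    case 3
    with assms have "p = 0 \<or> p = 1" "q = 0 \<or> q = 1"
      using less_2_cases by (auto simp: block_size_def)
    with 3 show ?thesis
      by (elim disjE) (simp_all add: entry_block_def block_size_def quat_block_def unit_mult_def sum_lessThan_4
            sum_lessThan_2 complex_eq_iff algebra_simps)
  qed (use assms in \<open>auto simp: entry_block_def block_size_def quat_block_def unit_mult_def
            sum_lessThan_2 complex_eq_iff algebra_simps\<close>)
qed

text \<open>The left factor is expanded in the units: a w is the sum of a_u times u w.\<close>

lemma entry_block_times:
  assumes "b \<in> {1, 2, 4}" "p < block_size b" "q < block_size b"
  shows "(\<Sum>r<block_size b. entry_block b a p r * entry_block b w r q) =
         entry_block b (\<lambda>k. \<Sum>u<b. a u * unit_mult b u w k) p q"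
proof -
  consider "b = 1" | "b = 2" | "b = 4" using assms by auto
  thus ?thesis
  proof cases
    case 3
    with assms have "p = 0 \<or> p = 1" "q = 0 \<or> q = 1"
      using less_2_cases by (auto simp: block_size_def)
    with 3 show ?thesis
      by (elim disjE) (simp_all add: entry_block_def block_size_def quat_block_def unit_mult_def sum_lessThan_4
            sum_lessThan_2 complex_eq_iff algebra_simps)
  qed (use assms in \<open>auto simp: entry_block_def block_size_def quat_block_def unit_mult_def
            sum_lessThan_2 complex_eq_iff algebra_simps\<close>)
qed

lemma entry_block_diff:
  "entry_block b (\<lambda>k. y k - c * z k) p q = entry_block b y p q - complex_of_real c * entry_block b z p q"
  by (simp add: entry_block_def quat_block_def complex_eq_iff algebra_simps)

lemma entry_block_sum:
  "entry_block b (\<lambda>k. \<Sum>j\<in>J. f j k) p q = (\<Sum>j\<in>J. entry_block b (f j) p q)"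
  by (auto simp: entry_block_def quat_block_def complex_eq_iff Re_sum Im_sum sum_negf)

lemma entry_block_cong:
  assumes "b \<in> {1, 2, 4}" "\<And>k. k < b \<Longrightarrow> y k = z k"
  shows "entry_block b y p q = entry_block b z p q"
  using assms by (auto simp: entry_block_def)

lemma entry_block_unit:
  assumes "b \<in> {1, 2, 4}" "p < block_size b" "q < block_size b"
  shows "entry_block b (\<lambda>u. if u = 0 then c else 0) p q = (if p = q then complex_of_real c else 0)"
  using assms less_2_cases[of p] less_2_cases[of q]
  by (auto simp: entry_block_def block_size_def quat_block_def complex_eq_iff)

lemma sum_blocks:
  assumes "b \<in> {1, 2, 4}"
  shows "(\<Sum>i<block_size b * N. f (i div block_size b) (i mod block_size b)) =
         (\<Sum>j<N. \<Sum>q<block_size b. (f j q :: 'a :: comm_monoid_add))"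
proof (cases "b = 4")
  case True
  have "(\<Sum>i<2 * N. f (i div 2) (i mod 2)) = (\<Sum>j<N. \<Sum>q<2. f j q)"
  proof (induction N)
    case (Suc N)
    have "Suc (2 * N) mod 2 = 1" "Suc (2 * N) div 2 = N" by presburger+
    with Suc show ?case by (simp add: sum_lessThan_2 ac_simps)
  qed simp
  with True show ?thesis by (simp add: block_size_def)
qed (simp add: block_size_def)

lemma block_div_mod:
  assumes "i < block_size b * N"
  shows "i div block_size b < N" "i mod block_size b < block_size b"
  using assms by (auto simp: block_size_def less_mult_imp_div_less mult.commute)

section \<open>Rows as real vectors and the Householder reflection\<close>

definition row_inner :: "nat \<Rightarrow> nat \<Rightarrow> (nat \<times> nat \<Rightarrow> real) \<Rightarrow> (nat \<times> nat \<Rightarrow> real) \<Rightarrow> real" where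
  "row_inner b N y v = (\<Sum>i\<in>{..<N} \<times> {..<b}. y i * v i)"

lemma row_inner_iterated: "row_inner b N y v = (\<Sum>j<N. \<Sum>k<b. y (j, k) * v (j, k))"
  by (simp add: row_inner_def sum.cartesian_product)

lemma row_norm_sq_inner: "row_norm_sq b N v = row_inner b N v v"
  by (simp add: row_norm_sq_def row_inner_iterated power2_eq_square)

lemma row_norm_sq_sum: "row_norm_sq b N v = (\<Sum>i\<in>{..<N} \<times> {..<b}. (v i)\<^sup>2)"
  by (simp add: row_norm_sq_inner row_inner_def power2_eq_square)

definition row_unit_mult :: "nat \<Rightarrow> nat \<Rightarrow> (nat \<times> nat \<Rightarrow> real) \<Rightarrow> nat \<times> nat \<Rightarrow> real" where
  "row_unit_mult b u v = (\<lambda>(j, k). unit_mult b u (\<lambda>k. v (j, k)) k)"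

lemma row_unit_mult_orthogonal:
  assumes "b \<in> {1, 2, 4}" "u < b" "w < b"
  shows "row_inner b N (row_unit_mult b u v) (row_unit_mult b w v) = (if u = w then row_norm_sq b N v else 0)"
  using unit_mult_orthogonal[OF assms]
  by (simp add: row_inner_iterated row_unit_mult_def row_norm_sq_def)

text \<open>The reflection \<open>y \<mapsto> y - (2 / |v|\<^sup>2) (y v\<^sup>*) v\<close> over the reals, complex numbers or quaternions;
  it is the product of the real reflections in the \<open>b\<close> orthogonal vectors \<open>u v\<close>, \<open>u\<close> a unit.\<close>

definition householder :: "nat \<Rightarrow> nat \<Rightarrow> (nat \<times> nat \<Rightarrow> real) \<Rightarrow> (nat \<times> nat \<Rightarrow> real) \<Rightarrow> nat \<times> nat \<Rightarrow> real" where
  "householder b N v y = (\<lambda>i\<in>{..<N} \<times> {..<b}. y i - 2 / row_norm_sq b N v *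
     (\<Sum>u<b. row_inner b N y (row_unit_mult b u v) * row_unit_mult b u v i))"

text \<open>Let c_u be the inner product of y with u v, z the sum of the c_u (u v), and s = |v|^2.
  The inner product of y and z is the sum of the c_u^2, and |z|^2 is s times that sum, so the two
  corrections, with factors -4/s and 4/s^2, cancel.\<close>

lemma householder_norm:
  assumes b: "b \<in> {1, 2, 4}" and v: "row_norm_sq b N v \<noteq> 0"
  shows "row_norm_sq b N (householder b N v y) = row_norm_sq b N y"
proof -
  let ?I = "{..<N} \<times> {..<b}" and ?s = "row_norm_sq b N v"
  define w where "w = (\<lambda>u. row_unit_mult b u v)"
  define c where "c = (\<lambda>u. row_inner b N y (w u))"
  define z where "z = (\<lambda>i. \<Sum>u<b. c u * w u i)"
  have "row_norm_sq b N (householder b N v y) = (\<Sum>i\<in>?I. (y i - 2 / ?s * z i)\<^sup>2)"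
    by (auto simp: row_norm_sq_sum householder_def z_def c_def w_def intro!: sum.cong)
  also have "\<dots> = (\<Sum>i\<in>?I. (y i)\<^sup>2 - 4 / ?s * (y i * z i) + 4 / ?s\<^sup>2 * (z i * z i))"
    using v by (intro sum.cong) (auto simp: field_simps power2_eq_square)
  also have "\<dots> = row_norm_sq b N y - 4 / ?s * (\<Sum>i\<in>?I. y i * z i) + 4 / ?s\<^sup>2 * (\<Sum>i\<in>?I. z i * z i)"
    by (simp add: sum.distrib sum_subtractf sum_distrib_left row_norm_sq_sum)
  also have "(\<Sum>i\<in>?I. y i * z i) = (\<Sum>u<b. c u * c u)"
    unfolding z_def sum_distrib_left c_def row_inner_def
    by (subst sum.swap) (simp add: sum_distrib_left sum_distrib_right mult_ac)
  also have "(\<Sum>i\<in>?I. z i * z i) = (\<Sum>u<b. c u * (\<Sum>u'<b. c u' * row_inner b N (w u) (w u')))"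
  proof -
    have "(\<Sum>i\<in>?I. z i * z i) = (\<Sum>i\<in>?I. \<Sum>u<b. \<Sum>u'<b. c u * (c u' * (w u i * w u' i)))"
      by (simp add: z_def sum_distrib_left sum_distrib_right mult_ac)
    also have "\<dots> = (\<Sum>u<b. \<Sum>u'<b. \<Sum>i\<in>?I. c u * (c u' * (w u i * w u' i)))"
      by (subst sum.swap, rule sum.cong[OF refl], rule sum.swap)
    finally show ?thesis by (simp add: row_inner_def sum_distrib_left)
  qed
  also have "\<dots> = (\<Sum>u<b. c u * (\<Sum>u'<b. if u' = u then c u' * ?s else 0))"
    using row_unit_mult_orthogonal[OF b]
    by (intro sum.cong refl arg_cong2[where f = "(*)"]) (auto simp: w_def)
  also have "\<dots> = ?s * (\<Sum>u<b. c u * c u)"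
    by (simp add: sum_distrib_left mult_ac)
  finally show ?thesis using v by (simp add: power2_eq_square)
qed

section \<open>The squared modulus of the determinant via complex matrices\<close>

lemma det_map_cnj: "Determinant.det (map_mat cnj A) = cnj (Determinant.det A)"
proof -
  interpret comm_ring_hom cnj by standard auto
  show ?thesis by (rule hom_det)
qed

lemma det_adjoint_times:
  fixes A :: "complex mat"
  assumes "A \<in> carrier_mat n n"
  shows "Determinant.det (mat_adjoint A * A) = complex_of_real ((cmod (Determinant.det A))\<^sup>2)"
proof -
  have "mat_adjoint A = transpose_mat (map_mat cnj A)"
    using assms by (intro eq_matI) (simp_all add: mat_adjoint_def mat_of_rows_index)
  hence "Determinant.det (mat_adjoint A) = cnj (Determinant.det A)"
    using assms by (simp add: det_transpose[of _ n] det_map_cnj)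
  moreover have "mat_adjoint A \<in> carrier_mat n n"
    using assms by (intro carrier_matI) (simp_all add: mat_adjoint_def)
  ultimately show ?thesis
    using assms by (subst complex_norm_square) (simp add: det_mult[of _ n])
qed

text \<open>For square A, det (A^H A) is |det A|^2. Multiplicativity, block expansion and row
  permutations of the ordinary determinant thus become available for all three fields; the root of
  order 2 is the quaternion convention.\<close>

lemma abs_det_sq_cmatrix:
  assumes "b \<in> {1, 2, 4}"
  shows "abs_det_sq b N x = root (block_size b) ((cmod (Determinant.det (cmatrix b N x)))\<^sup>2)"
proof -
  consider "b = 1" | "b = 2" | "b = 4" using assms by auto
  thus ?thesis
  proof cases
    case 1
    let ?A = "real_matrix N x"
    have A: "?A \<in> carrier_mat N N" by (simp add: real_matrix_def)
    have "mat_adjoint ?A = transpose_mat ?A"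
      using A by (intro eq_matI) (simp_all add: mat_adjoint_def mat_of_rows_index)
    hence *: "Determinant.det (mat_adjoint ?A * ?A) = (Determinant.det ?A)\<^sup>2"
      using A by (simp add: det_mult[of _ N] det_transpose[of _ N] power2_eq_square)
    have "cmatrix b N x = map_mat complex_of_real ?A"
      by (rule eq_matI) (auto simp: 1 cmatrix_def block_size_def real_matrix_def entry_block_def)
    hence "Determinant.det (cmatrix b N x) = complex_of_real (Determinant.det ?A)"
      by (simp add: of_real_hom.hom_det)
    thus ?thesis using 1 * by (simp add: abs_det_sq_def block_size_def)
  next
    case 2
    have "cmatrix b N x = complex_matrix N x"
      by (rule eq_matI) (auto simp: 2 cmatrix_def block_size_def complex_matrix_def entry_block_def)
    thus ?thesis using 2 det_adjoint_times[OF cmatrix_carrier, of b N x]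
      by (simp add: abs_det_sq_def block_size_def)
  next
    case 3
    have "cmatrix b N x = quat_matrix N x"
      by (rule eq_matI) (auto simp: 3 cmatrix_def block_size_def quat_matrix_def entry_block_def Let_def)
    thus ?thesis using 3 det_adjoint_times[OF cmatrix_carrier, of b N x]
      by (simp add: abs_det_sq_def block_size_def sqrt_def)
  qed
qed

text \<open>Only the entries in range are read, so restrictions and updates that change other values
  of \<open>x\<close> are harmless.\<close>

lemma abs_det_sq_cong:
  assumes b: "b \<in> {1, 2, 4}" and "\<And>l j k. l \<in> {1..N} \<Longrightarrow> j < N \<Longrightarrow> k < b \<Longrightarrow> x l (j, k) = y l (j, k)"
  shows "abs_det_sq b N x = abs_det_sq b N y"
proof -
  have "cmatrix b N x = cmatrix b N y"
    by (rule eq_matI)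
       (auto simp: cmatrix_def assms Suc_leI block_div_mod intro!: entry_block_cong[OF b])
  thus ?thesis by (simp only: abs_det_sq_cmatrix[OF b])
qed

lemma preserves_lebesgue_householder:
  assumes b: "b \<in> {1, 2, 4}" and v: "row_norm_sq b N v \<noteq> 0"
  shows "preserves_lebesgue ({..<N} \<times> {..<b}) (householder b N v)"
  unfolding householder_def row_inner_def
  using v row_unit_mult_orthogonal[OF b, of _ _ N v]
  by (intro preserves_lebesgue_orthogonal_reflections) (auto simp: row_inner_def)

text \<open>In terms of the block row \<open>V\<close> of \<open>v\<close>, the reflection is right multiplication by
  \<open>1 - (2 / |v|\<^sup>2) V\<^sup>* V\<close>, and \<open>V V\<^sup>* = |v|\<^sup>2 1\<close>.\<close>

definition row_block :: "nat \<Rightarrow> (nat \<times> nat \<Rightarrow> real) \<Rightarrow> nat \<Rightarrow> nat \<Rightarrow> complex" where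
  "row_block b v r j = entry_block b (\<lambda>k. v (j div block_size b, k)) r (j mod block_size b)"

definition householder_matrix :: "nat \<Rightarrow> nat \<Rightarrow> (nat \<times> nat \<Rightarrow> real) \<Rightarrow> complex mat" where
  "householder_matrix b N v = Matrix.mat (block_size b * N) (block_size b * N) (\<lambda>(i, j).
     (if i = j then 1 else 0) - complex_of_real (2 / row_norm_sq b N v) *
       (\<Sum>r<block_size b. cnj (row_block b v r i) * row_block b v r j))"

lemma row_block_inner:
  assumes b: "b \<in> {1, 2, 4}" and "p < block_size b" "q < block_size b"
  shows "(\<Sum>i<block_size b * N. row_block b y p i * cnj (row_block b v q i)) =
         entry_block b (\<lambda>u. row_inner b N y (row_unit_mult b u v)) p q"
proof -
  have "(\<Sum>i<block_size b * N. row_block b y p i * cnj (row_block b v q i)) =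
        (\<Sum>j<N. \<Sum>r<block_size b. entry_block b (\<lambda>k. y (j, k)) p r * cnj (entry_block b (\<lambda>k. v (j, k)) q r))"
    unfolding row_block_def by (rule sum_blocks[OF b])
  also have "\<dots> = (\<Sum>j<N. entry_block b (\<lambda>u. \<Sum>k<b. y (j, k) * unit_mult b u (\<lambda>k. v (j, k)) k) p q)"
    by (simp add: entry_block_times_adjoint[OF assms])
  finally show ?thesis
    by (simp add: entry_block_sum[symmetric] row_inner_iterated row_unit_mult_def)
qed

lemma row_block_self_inner:
  assumes b: "b \<in> {1, 2, 4}" and "p < block_size b" "q < block_size b"
  shows "(\<Sum>i<block_size b * N. row_block b v p i * cnj (row_block b v q i)) =
         (if p = q then complex_of_real (row_norm_sq b N v) else 0)"
proof -
  have "entry_block b (\<lambda>u. row_inner b N v (row_unit_mult b u v)) p q =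
        entry_block b (\<lambda>u. if u = 0 then row_norm_sq b N v else 0) p q"
  proof (rule entry_block_cong[OF b])
    fix u assume u: "u < b"
    moreover have "row_unit_mult b 0 v = v" by (auto simp: row_unit_mult_def unit_mult_def)
    ultimately show "row_inner b N v (row_unit_mult b u v) = (if u = 0 then row_norm_sq b N v else 0)"
      using row_unit_mult_orthogonal[OF b, of 0 u N v] by auto
  qed
  thus ?thesis
    using assms by (simp add: row_block_inner[OF assms] entry_block_unit)
qed

lemma row_block_householder:
  assumes b: "b \<in> {1, 2, 4}" and p: "p < block_size b" and j: "j < block_size b * N"
  shows "row_block b (householder b N v y) p j = row_block b y p j - complex_of_real (2 / row_norm_sq b N v) *
     (\<Sum>r<block_size b. (\<Sum>i<block_size b * N. row_block b y p i * cnj (row_block b v r i)) * row_block b v r j)"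
proof -
  let ?j = "j div block_size b" and ?q = "j mod block_size b"
  define c where "c = (\<lambda>u. row_inner b N y (row_unit_mult b u v))"
  have "row_block b (householder b N v y) p j =
        entry_block b (\<lambda>k. y (?j, k) - 2 / row_norm_sq b N v * (\<Sum>u<b. c u * unit_mult b u (\<lambda>k. v (?j, k)) k)) p ?q"
    unfolding row_block_def
    by (rule entry_block_cong[OF b]) (use block_div_mod[OF j] in \<open>auto simp: householder_def c_def row_unit_mult_def\<close>)
  also have "\<dots> = row_block b y p j - complex_of_real (2 / row_norm_sq b N v) *
      entry_block b (\<lambda>k. \<Sum>u<b. c u * unit_mult b u (\<lambda>k. v (?j, k)) k) p ?q"
    by (simp only: entry_block_diff row_block_def)
  \<comment> \<open>\<open>c\<close> holds the components of y conj(v), so the sum over the units is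
    the product of that quantity with the entry of v.\<close>
  also have "entry_block b (\<lambda>k. \<Sum>u<b. c u * unit_mult b u (\<lambda>k. v (?j, k)) k) p ?q =
      (\<Sum>r<block_size b. entry_block b c p r * row_block b v r j)"
    using entry_block_times[OF b p block_div_mod(2)[OF j]] by (simp add: row_block_def)
  also have "\<dots> = (\<Sum>r<block_size b. (\<Sum>i<block_size b * N. row_block b y p i * cnj (row_block b v r i)) * row_block b v r j)"
    by (intro sum.cong) (auto simp: row_block_inner[OF b p] c_def)
  finally show ?thesis .
qed

lemma cmatrix_householder:
  assumes b: "b \<in> {1, 2, 4}"
  shows "cmatrix b N (\<lambda>l. householder b N v (x l)) = cmatrix b N x * householder_matrix b N v"
proof (rule eq_matI)
  let ?n = "block_size b * N" and ?m = "block_size b"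
  let ?c = "complex_of_real (2 / row_norm_sq b N v)"
  fix i j assume "i < dim_row (cmatrix b N x * householder_matrix b N v)"
    "j < dim_col (cmatrix b N x * householder_matrix b N v)"
  hence ij: "i < ?n" "j < ?n" by (simp_all add: cmatrix_def householder_matrix_def)
  define y where "y = row_block b (x (Suc (i div ?m))) (i mod ?m)"
  define V where "V = row_block b v"
  have "(cmatrix b N x * householder_matrix b N v) $$ (i, j) =
        (\<Sum>k<?n. y k * ((if k = j then 1 else 0) - ?c * (\<Sum>r<?m. cnj (V r k) * V r j)))"
    using ij by (simp add: cmatrix_def householder_matrix_def scalar_prod_def y_def V_def row_block_def
          lessThan_atLeast0)
  also have "\<dots> = (\<Sum>k<?n. (if k = j then y k else 0) - ?c * (\<Sum>r<?m. y k * (cnj (V r k) * V r j)))"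
    by (intro sum.cong) (auto simp: algebra_simps sum_distrib_left)
  also have "\<dots> = y j - ?c * (\<Sum>k<?n. \<Sum>r<?m. y k * (cnj (V r k) * V r j))"
    using ij by (simp add: sum_subtractf sum_distrib_left)
  also have "(\<Sum>k<?n. \<Sum>r<?m. y k * (cnj (V r k) * V r j)) = (\<Sum>r<?m. (\<Sum>k<?n. y k * cnj (V r k)) * V r j)"
    by (subst sum.swap) (simp add: sum_distrib_right mult.assoc)
  also have "y j - ?c * \<dots> = row_block b (householder b N v (x (Suc (i div ?m)))) (i mod ?m) j"
    using row_block_householder[OF b block_div_mod(2)[OF ij(1)] ij(2)] by (simp add: y_def V_def)
  also have "\<dots> = cmatrix b N (\<lambda>l. householder b N v (x l)) $$ (i, j)"
    using ij by (simp add: cmatrix_def row_block_def)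
  finally show "cmatrix b N (\<lambda>l. householder b N v (x l)) $$ (i, j) =
    (cmatrix b N x * householder_matrix b N v) $$ (i, j)" ..
qed (simp_all add: cmatrix_def householder_matrix_def)

lemma householder_matrix_square:
  assumes b: "b \<in> {1, 2, 4}" and v: "row_norm_sq b N v \<noteq> 0"
  shows "householder_matrix b N v * householder_matrix b N v = 1\<^sub>m (block_size b * N)"
proof (rule eq_matI)
  let ?n = "block_size b * N" and ?m = "block_size b" and ?s = "row_norm_sq b N v"
  define c where "c = complex_of_real (2 / ?s)"
  define V where "V = row_block b v"
  fix i j assume "i < dim_row (1\<^sub>m ?n :: complex mat)" "j < dim_col (1\<^sub>m ?n :: complex mat)"
  hence ij: "i < ?n" "j < ?n" by simp_all
  define A where "A = (\<lambda>i j. \<Sum>r<?m. cnj (V r i) * V r j)"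
  \<comment> \<open>\<open>A\<close> is V^H V, and V V^H = s 1 yields A A = s A. With c s = 2 the
    square of 1 - c A is the identity.\<close>
  have AA: "(\<Sum>k<?n. A i k * A k j) = complex_of_real ?s * A i j"
  proof -
    have "(\<Sum>k<?n. A i k * A k j) =
          (\<Sum>k<?n. \<Sum>r<?m. \<Sum>t<?m. (V r k * cnj (V t k)) * (cnj (V r i) * V t j))"
      by (simp add: A_def sum_product mult_ac)
    also have "\<dots> = (\<Sum>r<?m. \<Sum>t<?m. (\<Sum>k<?n. V r k * cnj (V t k)) * (cnj (V r i) * V t j))"
      by (subst sum.swap, rule sum.cong[OF refl], subst sum.swap) (simp add: sum_distrib_right)
    also have "\<dots> = (\<Sum>r<?m. \<Sum>t<?m. if t = r then complex_of_real ?s * (cnj (V r i) * V t j) else 0)"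
      by (intro sum.cong) (auto simp: V_def row_block_self_inner[OF b])
    finally show ?thesis by (simp add: A_def sum_distrib_left)
  qed
  have "(householder_matrix b N v * householder_matrix b N v) $$ (i, j) =
        (\<Sum>k<?n. ((if i = k then 1 else 0) - c * A i k) * ((if k = j then 1 else 0) - c * A k j))"
    using ij by (simp add: householder_matrix_def scalar_prod_def c_def A_def V_def lessThan_atLeast0)
  also have "\<dots> = (\<Sum>k<?n. (if k = i then (if i = j then 1 else 0) else 0) - (if k = i then c * A k j else 0)
      - (if k = j then c * A i k else 0) + c * c * (A i k * A k j))"
    by (intro sum.cong) (auto simp: algebra_simps)
  also have "\<dots> = (if i = j then 1 else 0) - c * A i j - c * A i j + c * c * (\<Sum>k<?n. A i k * A k j)"
    using ij by (simp add: sum.distrib sum_subtractf sum_distrib_left)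
  also have "\<dots> = (if i = j then 1 else 0) + (c * (c * complex_of_real ?s) - 2 * c) * A i j"
    unfolding AA by (simp add: algebra_simps)
  also have "c * complex_of_real ?s = 2" using v by (simp add: c_def)
  finally show "(householder_matrix b N v * householder_matrix b N v) $$ (i, j) = 1\<^sub>m ?n $$ (i, j)"
    using ij by simp
qed (simp_all add: householder_matrix_def)

text \<open>The reflection is right multiplication by an involution, whose determinant squares to 1
  and so has modulus 1.\<close>

lemma abs_det_sq_householder:
  assumes b: "b \<in> {1, 2, 4}" and v: "row_norm_sq b N v \<noteq> 0"
  shows "abs_det_sq b N (\<lambda>l. householder b N v (x l)) = abs_det_sq b N x"
proof -
  let ?n = "block_size b * N"
  let ?H = "householder_matrix b N v"
  have H: "?H \<in> carrier_mat ?n ?n" by (simp add: householder_matrix_def)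
  have "Determinant.det ?H * Determinant.det ?H = 1"
    using det_mult[OF H H] by (simp add: householder_matrix_square[OF assms])
  hence "cmod (Determinant.det ?H) * cmod (Determinant.det ?H) = 1"
    by (metis norm_mult norm_one)
  hence "cmod (Determinant.det ?H) = 1"
    using square_eq_1_iff[of "cmod (Determinant.det ?H)"] norm_ge_zero[of "Determinant.det ?H"] by linarith
  thus ?thesis
    by (simp add: abs_det_sq_cmatrix[OF b] cmatrix_householder[OF b] det_mult[OF cmatrix_carrier H] norm_mult)
qed

text \<open>The complex matrix is block upper triangular, with the last entry z as its corner block
  A. As A A^H = |z|^2 1, the number |det A|^2 is |z|^2 to the power of the block size, and the root
  in \<open>abs_det_sq_cmatrix\<close> returns |z|^2, the squared norm of the row.\<close>

lemma abs_det_sq_last_row: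
  assumes b: "b \<in> {1, 2, 4}" and zero: "\<And>j k. j < N \<Longrightarrow> k < b \<Longrightarrow> x (Suc N) (j, k) = 0"
  shows "abs_det_sq b (Suc N) x = row_norm_sq b (Suc N) (x (Suc N)) * abs_det_sq b N x"
proof -
  let ?m = "block_size b"
  have m: "?m > 0" by (simp add: block_size_def)
  let ?z = "\<lambda>k. x (Suc N) (N, k)"
  define A where "A = Matrix.mat ?m ?m (\<lambda>(p, q). entry_block b ?z p q)"
  define B where "B = Matrix.mat (?m * N) ?m (\<lambda>(i, q).
     entry_block b (\<lambda>k. x (Suc (i div ?m)) (N, k)) (i mod ?m) q)"
  have A: "A \<in> carrier_mat ?m ?m" by (simp add: A_def)
  have B: "B \<in> carrier_mat (?m * N) ?m" by (simp add: B_def)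
  have dm: "i div ?m = N \<and> i mod ?m = i - ?m * N" if "i < ?m * Suc N" "\<not> i < ?m * N" for i
  proof -
    have "i div ?m = N"
      using that m by (intro div_nat_eqI) (auto simp: mult.commute)
    thus ?thesis by (metis minus_mult_div_eq_mod)
  qed
  have "cmatrix b (Suc N) x = four_block_mat (cmatrix b N x) B (0\<^sub>m ?m (?m * N)) A"
  proof (rule eq_matI)
    fix i j assume "i < dim_row (four_block_mat (cmatrix b N x) B (0\<^sub>m ?m (?m * N)) A)"
      "j < dim_col (four_block_mat (cmatrix b N x) B (0\<^sub>m ?m (?m * N)) A)"
    hence ij: "i < ?m * Suc N" "j < ?m * Suc N"
      by (simp_all add: A_def cmatrix_def)
    have low: "entry_block b (\<lambda>k. x (Suc N) (j div ?m, k)) p q = 0" if "j < ?m * N" for p q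
    proof -
      have "entry_block b (\<lambda>k. x (Suc N) (j div ?m, k)) p q = entry_block b (\<lambda>k. 0) p q"
        using block_div_mod[OF that] zero by (intro entry_block_cong[OF b]) auto
      thus ?thesis by (simp add: entry_block_def quat_block_def complex_eq_iff)
    qed
    show "cmatrix b (Suc N) x $$ (i, j) = four_block_mat (cmatrix b N x) B (0\<^sub>m ?m (?m * N)) A $$ (i, j)"
      using ij dm[OF ij(1)] dm[OF ij(2)] low
      by (cases "i < ?m * N"; cases "j < ?m * N") (simp_all add: cmatrix_def A_def B_def)
  qed (simp_all add: cmatrix_def A_def)
  hence det: "Determinant.det (cmatrix b (Suc N) x) = Determinant.det (cmatrix b N x) * Determinant.det A"
    using det_four_block_mat_lower_left_zero[OF cmatrix_carrier B refl A] by simp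
  have norm: "row_norm_sq b (Suc N) (x (Suc N)) = (\<Sum>k<b. (?z k)\<^sup>2)"
    using zero by (simp add: row_norm_sq_def)
  have "(cmod (Determinant.det A))\<^sup>2 = (\<Sum>k<b. (?z k)\<^sup>2) ^ ?m"
  proof -
    have "mat_adjoint A = Matrix.mat ?m ?m (\<lambda>(p, q). cnj (entry_block b ?z q p))"
      using A by (intro eq_matI) (simp_all add: mat_adjoint_def mat_of_rows_index A_def)
    hence "A * mat_adjoint A = Matrix.mat ?m ?m (\<lambda>(p, q). \<Sum>r<?m. entry_block b ?z p r * cnj (entry_block b ?z q r))"
      by (intro eq_matI) (simp_all add: A_def scalar_prod_def lessThan_atLeast0)
    also have "\<dots> = complex_of_real (\<Sum>k<b. (?z k)\<^sup>2) \<cdot>\<^sub>m 1\<^sub>m ?m"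
    proof (rule eq_matI)
      fix p q assume "p < dim_row (complex_of_real (\<Sum>k<b. (?z k)\<^sup>2) \<cdot>\<^sub>m 1\<^sub>m ?m)"
         "q < dim_col (complex_of_real (\<Sum>k<b. (?z k)\<^sup>2) \<cdot>\<^sub>m 1\<^sub>m ?m)"
      hence pq: "p < ?m" "q < ?m" by simp_all
      \<comment> \<open>The single entry is read as a row of length 1, so that
        \<open>row_block_self_inner\<close> applies.\<close>
      have "(\<Sum>r<?m. entry_block b ?z p r * cnj (entry_block b ?z q r)) =
            (\<Sum>i<?m * 1. row_block b (\<lambda>(j, k). ?z k) p i * cnj (row_block b (\<lambda>(j, k). ?z k) q i))"
        by (simp add: row_block_def)
      also have "\<dots> = (if p = q then complex_of_real (row_norm_sq b 1 (\<lambda>(j, k). ?z k)) else 0)"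
        by (rule row_block_self_inner[OF b pq])
      finally show "Matrix.mat ?m ?m (\<lambda>(p, q). \<Sum>r<?m. entry_block b ?z p r * cnj (entry_block b ?z q r)) $$ (p, q) =
        (complex_of_real (\<Sum>k<b. (?z k)\<^sup>2) \<cdot>\<^sub>m 1\<^sub>m ?m) $$ (p, q)"
        using pq by (simp add: row_norm_sq_def)
    qed simp_all
    finally have AA: "A * mat_adjoint A = complex_of_real (\<Sum>k<b. (?z k)\<^sup>2) \<cdot>\<^sub>m 1\<^sub>m ?m" .
    have adj: "mat_adjoint A \<in> carrier_mat ?m ?m"
      using A by (intro carrier_matI) (simp_all add: mat_adjoint_def)
    have "Determinant.det (mat_adjoint A * A) = Determinant.det (A * mat_adjoint A)"
      using A adj by (simp add: det_mult[of _ ?m] mult.commute)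
    hence "complex_of_real ((cmod (Determinant.det A))\<^sup>2) = complex_of_real ((\<Sum>k<b. (?z k)\<^sup>2) ^ ?m)"
      using A by (simp add: AA det_adjoint_times[OF A] del: of_real_sum)
    thus ?thesis using of_real_eq_iff by blast
  qed
  moreover have "root ?m ((\<Sum>k<b. (?z k)\<^sup>2) ^ ?m) = (\<Sum>k<b. (?z k)\<^sup>2)"
    using m by (simp add: real_root_power_cancel sum_nonneg)
  ultimately show ?thesis
    by (simp add: abs_det_sq_cmatrix[OF b] det norm norm_mult power_mult_distrib real_root_mult)
qed

lemma abs_det_sq_reverse:
  assumes b: "b \<in> {1, 2, 4}"
  shows "abs_det_sq b N (\<lambda>l. x (Suc N - l)) = abs_det_sq b N x"
proof -
  let ?m = "block_size b"
  have m: "?m > 0" by (simp add: block_size_def)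
  \<comment> \<open>Reverses the order of the blocks and keeps the order inside each block; an
    involution, hence a permutation. Indices beyond the matrix are fixed, as \<open>permutes\<close>
    demands.\<close>
  define p where "p = (\<lambda>i. if i < ?m * N then ?m * (N - 1 - i div ?m) + i mod ?m else i)"
  have p_less: "p i < ?m * N" if "i < ?m * N" for i
  proof -
    have "?m * (N - 1 - i div ?m) + i mod ?m < ?m * (N - 1 - i div ?m) + ?m * 1"
      using m by simp
    also have "\<dots> = ?m * (N - 1 - i div ?m + 1)" by (simp only: distrib_left)
    also have "\<dots> \<le> ?m * N" using block_div_mod(1)[OF that] by (intro mult_le_mono2) simp
    finally show ?thesis using that by (simp add: p_def)
  qed
  have p_div: "p i div ?m = N - 1 - i div ?m" "p i mod ?m = i mod ?m" if "i < ?m * N" for i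
    using that m by (simp_all add: p_def)
  have pp: "p (p i) = i" for i
  proof (cases "i < ?m * N")
    case True
    have "p (p i) = ?m * (N - 1 - p i div ?m) + p i mod ?m"
      using p_less[OF True] unfolding p_def[THEN fun_cong, of "p i"] by simp
    also have "\<dots> = ?m * (N - 1 - (N - 1 - i div ?m)) + i mod ?m"
      by (simp only: p_div[OF True])
    also have "N - 1 - (N - 1 - i div ?m) = i div ?m"
      using block_div_mod(1)[OF True] by simp
    finally show ?thesis by simp
  qed (simp add: p_def)
  have "p i = i" if "i \<notin> {0..<?m * N}" for i
    using that by (simp add: p_def)
  hence perm: "p permutes {0..<?m * N}"
    unfolding permutes_def using pp by (intro conjI allI impI ex1I[of _ "p y" for y]) (simp_all, metis)
  have "cmatrix b N (\<lambda>l. x (Suc N - l)) = Matrix.mat (?m * N) (?m * N) (\<lambda>(i, j). cmatrix b N x $$ (p i, j))"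
  proof (rule eq_matI)
    fix i j assume "i < dim_row (Matrix.mat (?m * N) (?m * N) (\<lambda>(i, j). cmatrix b N x $$ (p i, j)))"
      "j < dim_col (Matrix.mat (?m * N) (?m * N) (\<lambda>(i, j). cmatrix b N x $$ (p i, j)))"
    hence ij: "i < ?m * N" "j < ?m * N" by simp_all
    have "Suc N - Suc (i div ?m) = Suc (p i div ?m)"
      using block_div_mod(1)[OF ij(1)] p_div(1)[OF ij(1)] by simp
    thus "cmatrix b N (\<lambda>l. x (Suc N - l)) $$ (i, j) =
        Matrix.mat (?m * N) (?m * N) (\<lambda>(i, j). cmatrix b N x $$ (p i, j)) $$ (i, j)"
      using ij p_less[OF ij(1)] p_div[OF ij(1)] by (simp add: cmatrix_def)
  qed (simp_all add: cmatrix_def)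
  hence "Determinant.det (cmatrix b N (\<lambda>l. x (Suc N - l))) = signof p * Determinant.det (cmatrix b N x)"
    using det_permute_rows[OF cmatrix_carrier perm] by simp
  moreover have "cmod (signof p) = 1" by (simp add: sign_def)
  ultimately show ?thesis by (simp add: abs_det_sq_cmatrix[OF b] norm_mult)
qed

text \<open>Unless x0 = 0, the Householder vector v is x0 plus |x0| t in the last entry, where t is
  the direction of the last entry of x0. The row product of x0 with conj(v) is then the real number
  |v|^2 / 2, so the reflection acts on x0 as a real one and sends it to x0 - v, which is supported
  in the last entry. The plus sign keeps v away from 0.\<close>

lemma obtain_row_rotation:
  assumes b: "b \<in> {1, 2, 4}"
  obtains T where "preserves_lebesgue ({..<Suc N} \<times> {..<b}) T"
    "\<And>y. row_norm_sq b (Suc N) (T y) = row_norm_sq b (Suc N) y"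
    "\<And>j k. j < N \<Longrightarrow> k < b \<Longrightarrow> T x0 (j, k) = 0"
    "\<And>x. abs_det_sq b (Suc N) (\<lambda>l. T (x l)) = abs_det_sq b (Suc N) x"
proof (cases "row_norm_sq b (Suc N) x0 = 0")
  case True
  hence "x0 (j, k) = 0" if "j < N" "k < b" for j k
  proof -
    from True have "\<forall>i\<in>{..<Suc N} \<times> {..<b}. (x0 i)\<^sup>2 = 0"
      unfolding row_norm_sq_sum by (subst (asm) sum_nonneg_eq_0_iff) auto
    with that show ?thesis by auto
  qed
  thus ?thesis
    by (intro that[of "\<lambda>y. y"]) (auto simp: preserves_lebesgue_id)
next
  case False
  let ?n = "Suc N"
  define r where "r = sqrt (row_norm_sq b ?n x0)"
  define a where "a = sqrt (\<Sum>k<b. (x0 (N, k))\<^sup>2)"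
  \<comment> \<open>The last entry of x0 is a t, and t has norm 1; if that entry is 0 its direction
    is arbitrary, and the unit 1 is taken.\<close>
  define t where "t = (\<lambda>k. if a = 0 then (if k = 0 then 1 else 0) else x0 (N, k) / a)"
  define v where "v = (\<lambda>(j, k). x0 (j, k) + r * (if j = N then t k else 0))"
  have b0: "0 < b" using b by auto
  have r2: "row_norm_sq b ?n x0 = r\<^sup>2" and r: "r > 0"
    using False by (simp_all add: r_def row_norm_sq_def sum_nonneg less_le)
  have a2: "(\<Sum>k<b. (x0 (N, k))\<^sup>2) = a\<^sup>2" and a: "a \<ge> 0"
    by (simp_all add: a_def sum_nonneg)
  have xt: "x0 (N, k) = a * t k" if "k < b" for k
  proof (cases "a = 0")
    case True
    hence "(\<Sum>k<b. (x0 (N, k))\<^sup>2) = 0" using a2 by simp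
    hence "\<forall>k\<in>{..<b}. (x0 (N, k))\<^sup>2 = 0"
      by (subst (asm) sum_nonneg_eq_0_iff) auto
    with True that show ?thesis by simp
  qed (simp add: t_def)
  have tt: "(\<Sum>k<b. (t k)\<^sup>2) = 1"
  proof (cases "a = 0")
    case True
    hence "(\<Sum>k<b. (t k)\<^sup>2) = (\<Sum>k<b. if k = 0 then 1 else 0)"
      by (intro sum.cong) (auto simp: t_def)
    thus ?thesis using b0 by simp
  next
    case False
    hence "(\<Sum>k<b. (t k)\<^sup>2) = (\<Sum>k<b. (x0 (N, k))\<^sup>2) / a\<^sup>2"
      by (simp add: t_def power_divide sum_divide_distrib)
    thus ?thesis using False by (simp add: a2)
  qed
  \<comment> \<open>The components with u \<noteq> 0 vanish since each entry of x0 times the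
    conjugate of the same entry of v is real: v equals x0 except in the last place, where both are
    real multiples of t.\<close>
  have inner: "row_inner b ?n x0 (row_unit_mult b u v) = (if u = 0 then r\<^sup>2 + r * a else 0)" if u: "u < b" for u
  proof -
    have orth: "(\<Sum>k<b. z k * unit_mult b u z k) = (if u = 0 then \<Sum>k<b. (z k)\<^sup>2 else 0)" for z
      using unit_mult_orthogonal[OF b b0 u, of z] by (auto simp: unit_mult_def)
    have "row_inner b ?n x0 (row_unit_mult b u v) =
       (\<Sum>j<?n. (\<Sum>k<b. x0 (j, k) * unit_mult b u (\<lambda>k. x0 (j, k)) k) +
          r * (\<Sum>k<b. x0 (j, k) * unit_mult b u (\<lambda>k. if j = N then t k else 0) k))"
      by (simp add: row_inner_iterated row_unit_mult_def v_def unit_mult_linear distrib_left sum.distrib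
          sum_distrib_left mult_ac)
    also have "\<dots> = (if u = 0 then row_norm_sq b ?n x0 else 0) +
         r * (\<Sum>j<?n. \<Sum>k<b. x0 (j, k) * unit_mult b u (\<lambda>k. if j = N then t k else 0) k)"
      by (simp add: sum.distrib orth row_norm_sq_def sum_distrib_left distrib_left)
    also have "(\<Sum>j<?n. \<Sum>k<b. x0 (j, k) * unit_mult b u (\<lambda>k. if j = N then t k else 0) k) =
        (\<Sum>j<N. \<Sum>k<b. x0 (j, k) * unit_mult b u (\<lambda>k. if j = N then t k else 0) k) +
        (\<Sum>k<b. x0 (N, k) * unit_mult b u t k)"
      by simp
    also have "(\<Sum>j<N. \<Sum>k<b. x0 (j, k) * unit_mult b u (\<lambda>k. if j = N then t k else 0) k) = 0"
      by (intro sum.neutral ballI) (simp add: unit_mult_def)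
    also have "0 + (\<Sum>k<b. x0 (N, k) * unit_mult b u t k) = a * (\<Sum>k<b. t k * unit_mult b u t k)"
      by (simp add: xt sum_distrib_left mult_ac)
    finally show ?thesis by (simp add: orth tt r2)
  qed
  have v2: "row_norm_sq b ?n v = 2 * (r\<^sup>2 + r * a)"
  proof -
    have "row_norm_sq b ?n v = (\<Sum>j<?n. \<Sum>k<b. v (j, k) * x0 (j, k)) +
        r * (\<Sum>j<?n. \<Sum>k<b. v (j, k) * (if j = N then t k else 0))"
      by (simp add: row_norm_sq_def power2_eq_square v_def distrib_left sum.distrib sum_distrib_left mult_ac)
    also have "(\<Sum>j<?n. \<Sum>k<b. v (j, k) * x0 (j, k)) = r\<^sup>2 + r * a"
      using inner[OF b0] by (simp add: row_inner_iterated row_unit_mult_def unit_mult_def mult_ac)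
    also have "(\<Sum>j<?n. \<Sum>k<b. v (j, k) * (if j = N then t k else 0)) = (\<Sum>k<b. v (N, k) * t k)"
      by simp
    also have "\<dots> = (\<Sum>k<b. (a + r) * (t k)\<^sup>2)"
      by (intro sum.cong) (auto simp: v_def xt algebra_simps power2_eq_square)
    also have "\<dots> = a + r" by (simp add: sum_distrib_left[symmetric] tt)
    finally show ?thesis by (simp add: power2_eq_square algebra_simps)
  qed
  have ra: "r\<^sup>2 + r * a > 0" using r a by (simp add: add_pos_nonneg)
  hence v0: "row_norm_sq b ?n v \<noteq> 0" using v2 by simp
  have unit0: "row_unit_mult b 0 v = v"
    by (auto simp: row_unit_mult_def unit_mult_def)
  define R where "R = r\<^sup>2 + r * a"
  have "householder b ?n v x0 (j, k) = 0" if "j < N" "k < b" for j k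
  proof -
    have "(\<Sum>u<b. row_inner b ?n x0 (row_unit_mult b u v) * row_unit_mult b u v (j, k)) =
          (\<Sum>u<b. if u = 0 then R * v (j, k) else 0)"
      by (intro sum.cong) (auto simp: inner unit0 R_def)
    also have "\<dots> = R * v (j, k)" using b0 by simp
    finally have *: "(\<Sum>u<b. row_inner b ?n x0 (row_unit_mult b u v) * row_unit_mult b u v (j, k)) =
      R * v (j, k)" .
    have "householder b ?n v x0 (j, k) = x0 (j, k) - v (j, k)"
      using that ra by (simp add: householder_def * v2 flip: R_def)
    thus ?thesis using that by (simp add: v_def)
  qed
  thus ?thesis
    by (intro that[of "householder b ?n v"] preserves_lebesgue_householder[OF b v0] householder_norm[OF b v0]
      abs_det_sq_householder[OF b v0])
qed

section \<open>Gamma and Beta integrals\<close>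

lemma nn_integral_inverse_infinite:
  assumes c: "c > (0::real)"
  shows "(\<integral>\<^sup>+t. ennreal (if 0 < t \<and> t < c then 1 / t else 0) \<partial>lborel) = \<infinity>"
proof -
  have "of_nat n \<le> (\<integral>\<^sup>+t. ennreal (if 0 < t \<and> t < c then 1 / t else 0) \<partial>lborel)" for n
  proof -
    \<comment> \<open>Chosen so that the integral of 1/t from a to c is n.\<close>
    define a where "a = c / exp (real n)"
    have a: "0 < a" "a \<le> c" using c by (auto simp: a_def field_simps)
    have "(\<integral>\<^sup>+t. ennreal (1 / t) * indicator {a..c} t \<partial>lborel) = ennreal (ln c - ln a)"
      using a by (intro nn_integral_FTC_Icc) (auto intro!: DERIV_ln_divide)
    also have "ln c - ln a = real n" using c by (simp add: a_def ln_div)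
    finally have "of_nat n = (\<integral>\<^sup>+t. ennreal (1 / t) * indicator {a..c} t \<partial>lborel)"
      by (simp add: ennreal_of_nat_eq_real_of_nat)
    also have "\<dots> \<le> (\<integral>\<^sup>+t. ennreal (if 0 < t \<and> t < c then 1 / t else 0) \<partial>lborel)"
    proof (rule nn_integral_mono_AE)
      have "AE t in lborel. t \<noteq> c" by (rule AE_lborel_singleton)
      thus "AE t in lborel. ennreal (1 / t) * indicator {a..c} t \<le> ennreal (if 0 < t \<and> t < c then 1 / t else 0)"
        by eventually_elim (use a in \<open>auto split: split_indicator\<close>)
    qed
    finally show ?thesis .
  qed
  hence "(\<Squnion>n. of_nat n) \<le> (\<integral>\<^sup>+t. ennreal (if 0 < t \<and> t < c then 1 / t else 0) \<partial>lborel)"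
    by (intro SUP_least)
  thus ?thesis by (simp add: ennreal_SUP_of_nat_eq_top top_unique)
qed

text \<open>The Gamma integral with values in [0, \<infinity>]. For a \<le> 0 it is infinite whereas
  \<open>Gamma a\<close> is still some real number, so it tells convergent moments from divergent
  ones.\<close>

definition Gamma_nn :: "real \<Rightarrow> ennreal" where
  "Gamma_nn a = (\<integral>\<^sup>+t. ennreal (if 0 < t then t powr (a - 1) * exp (- t) else 0) \<partial>lborel)"

lemma Gamma_nn_pos: "a > 0 \<Longrightarrow> Gamma_nn a = ennreal (Gamma a)"
  unfolding Gamma_nn_def
  by (subst Gamma_conv_nn_integral_real) (auto intro!: nn_integral_cong simp: exp_minus field_simps)

text \<open>On (0, 1) the integrand dominates exp(-1) / t, whose integral diverges.\<close>

lemma Gamma_nn_nonpos: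
  assumes "a \<le> 0"
  shows "Gamma_nn a = \<infinity>"
proof -
  have "\<infinity> = ennreal (exp (-1)) * (\<integral>\<^sup>+t. ennreal (if 0 < t \<and> t < (1::real) then 1 / t else 0) \<partial>lborel)"
    by (subst nn_integral_inverse_infinite) (auto simp: ennreal_mult_top)
  also have "\<dots> = (\<integral>\<^sup>+t. ennreal (exp (-1)) * ennreal (if 0 < t \<and> t < (1::real) then 1 / t else 0) \<partial>lborel)"
    by (rule nn_integral_cmult[symmetric]) measurable
  also have "\<dots> \<le> Gamma_nn a"
    unfolding Gamma_nn_def
  proof (rule nn_integral_mono)
    fix t :: real
    have "exp (-1) * (1 / t) \<le> t powr (a - 1) * exp (- t)" if t: "0 < t" "t < 1"
    proof -
      have "1 / t = t powr (-1)" using t by (simp add: powr_minus_divide)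
      also have "\<dots> \<le> t powr (a - 1)" using t assms by (intro powr_mono') auto
      finally show ?thesis using t by (subst mult.commute) (intro mult_mono, auto)
    qed
    thus "ennreal (exp (-1)) * ennreal (if 0 < t \<and> t < 1 then 1 / t else 0) \<le>
          ennreal (if 0 < t then t powr (a - 1) * exp (- t) else 0)"
      by (auto simp flip: ennreal_mult' intro!: ennreal_leI)
  qed
  finally show ?thesis by (simp add: top_unique)
qed

lemma Gamma_nn_eq_0: "Gamma_nn a \<noteq> 0"
  by (cases "a > 0") (auto simp: Gamma_nn_pos Gamma_nn_nonpos less_imp_neq[OF Gamma_real_pos, symmetric] ennreal_eq_0_iff not_le)

lemma Gamma_nn_scaled:
  assumes s: "s > 0"
  shows "(\<integral>\<^sup>+t. ennreal (if 0 < t then t powr (a - 1) * exp (- (s * t)) else 0) \<partial>lborel) =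
         ennreal (s powr - a) * Gamma_nn a"
proof -
  let ?f = "\<lambda>t. ennreal (if 0 < t then t powr (a - 1) * exp (- t) else 0)"
  have "Gamma_nn a = ennreal s * (\<integral>\<^sup>+t. ?f (s * t) \<partial>lborel)"
    unfolding Gamma_nn_def using s nn_integral_real_affine[of ?f s 0] by (simp cong: if_cong)
  hence "ennreal (s powr - a) * Gamma_nn a = (\<integral>\<^sup>+t. ennreal (s powr - a * s) * ?f (s * t) \<partial>lborel)"
    using s by (subst nn_integral_cmult) (auto simp: ennreal_mult' mult.assoc)
  also have "\<dots> = (\<integral>\<^sup>+t. ennreal (if 0 < t then t powr (a - 1) * exp (- (s * t)) else 0) \<partial>lborel)"
  proof (intro nn_integral_cong)
    fix t :: real
    have "s powr - a * s * (s * t) powr (a - 1) = t powr (a - 1)" if "0 < t"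
    proof -
      have "s powr - a * s * (s * t) powr (a - 1) = (s powr - a * s powr 1 * s powr (a - 1)) * t powr (a - 1)"
        using s that by (simp add: powr_mult)
      also have "s powr - a * s powr 1 * s powr (a - 1) = s powr 0"
        unfolding powr_add[symmetric] by simp
      finally show ?thesis using s by simp
    qed
    thus "ennreal (s powr - a * s) * ?f (s * t) =
          ennreal (if 0 < t then t powr (a - 1) * exp (- (s * t)) else 0)"
      using s by (auto simp: zero_less_mult_iff simp flip: ennreal_mult' mult.assoc)
  qed
  finally show ?thesis ..
qed

lemma Beta_nn:
  assumes "a > 0" "b > (0::real)"
  shows "(\<integral>\<^sup>+t. ennreal (if 0 < t \<and> t < 1 then t powr (a - 1) * (1 - t) powr (b - 1) else 0) \<partial>lborel) =
         ennreal (Beta a b)"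
proof -
  have "(\<integral>\<^sup>+t. ennreal (if 0 < t \<and> t < 1 then t powr (a - 1) * (1 - t) powr (b - 1) else 0) \<partial>lborel) =
        (\<integral>\<^sup>+t. ennreal (indicator {0..1} t * (t powr (a - 1) * (1 - t) powr (b - 1))) \<partial>lborel)"
    by (auto intro!: nn_integral_cong split: split_indicator)
  thus ?thesis
    using nn_integral_has_integral_lebesgue[OF _ has_integral_Beta_real[OF assms]] by simp
qed

lemma Beta_nn_infinite:
  assumes "a \<le> 0" "b > (0::real)"
  shows "(\<integral>\<^sup>+t. ennreal (if 0 < t \<and> t < 1 then t powr (a - 1) * (1 - t) powr (b - 1) else 0) \<partial>lborel) = \<infinity>"
proof -
  \<comment> \<open>A lower bound for (1 - t)^(b - 1) on (0, 1/2): the power is at least (1/2)^(b -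
    1) if b \<ge> 1, and at least 1 if b < 1. What remains is compared with 1/t.\<close>
  define c where "c = min 1 ((1/2) powr (b - 1))"
  have c: "c > 0" by (simp add: c_def)
  have "\<infinity> = ennreal c * (\<integral>\<^sup>+t. ennreal (if 0 < t \<and> t < (1/2::real) then 1 / t else 0) \<partial>lborel)"
    using c by (subst nn_integral_inverse_infinite) (auto simp: ennreal_mult_top)
  also have "\<dots> = (\<integral>\<^sup>+t. ennreal c * ennreal (if 0 < t \<and> t < (1/2::real) then 1 / t else 0) \<partial>lborel)"
    by (rule nn_integral_cmult[symmetric]) measurable
  also have "\<dots> \<le> (\<integral>\<^sup>+t. ennreal (if 0 < t \<and> t < 1 then t powr (a - 1) * (1 - t) powr (b - 1) else 0) \<partial>lborel)"
  proof (rule nn_integral_mono)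
    fix t :: real
    have "c * (1 / t) \<le> t powr (a - 1) * (1 - t) powr (b - 1)" if t: "0 < t" "t < 1/2"
    proof -
      have "c \<le> (1 - t) powr (b - 1)"
      proof (cases "b \<ge> 1")
        case True
        have "(1/2) powr (b - 1) \<le> (1 - t) powr (b - 1)" using t True by (intro powr_mono2) auto
        thus ?thesis by (simp add: c_def)
      next
        case False
        have "(1 - t) powr 0 \<le> (1 - t) powr (b - 1)" using t False by (intro powr_mono') auto
        thus ?thesis using t by (simp add: c_def)
      qed
      moreover have "1 / t = t powr (-1)" using t by (simp add: powr_minus_divide)
      moreover have "t powr (-1) \<le> t powr (a - 1)" using t assms by (intro powr_mono') auto
      ultimately show ?thesis using t c by (subst mult.commute) (intro mult_mono, auto)
    qed
    thus "ennreal c * ennreal (if 0 < t \<and> t < 1/2 then 1 / t else 0) \<le>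
          ennreal (if 0 < t \<and> t < 1 then t powr (a - 1) * (1 - t) powr (b - 1) else 0)"
      using c by (auto simp flip: ennreal_mult' intro!: ennreal_leI)
  qed
  finally show ?thesis by (simp add: top_unique)
qed

lemma Beta_nn_scaled:
  assumes a: "a > 0" "b > (0::real)" and s: "s > 0"
  shows "(\<integral>\<^sup>+t. ennreal (if 0 < t \<and> t < s then t powr (a - 1) * (s - t) powr (b - 1) else 0) \<partial>lborel) =
         ennreal (s powr (a + b - 1) * Beta a b)"
proof -
  let ?f = "\<lambda>s t. ennreal (if 0 < t \<and> t < s then t powr (a - 1) * (s - t) powr (b - 1) else 0)"
  have "(\<integral>\<^sup>+t. ?f s t \<partial>lborel) = ennreal s * (\<integral>\<^sup>+t. ?f s (s * t) \<partial>lborel)"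
    using s nn_integral_real_affine[of "?f s" s 0] by (simp cong: if_cong)
  also have "\<dots> = (\<integral>\<^sup>+t. ennreal s * ?f s (s * t) \<partial>lborel)"
    by (subst nn_integral_cmult) auto
  also have "\<dots> = (\<integral>\<^sup>+t. ennreal (s powr (a + b - 1)) * ?f 1 t \<partial>lborel)"
  proof (intro nn_integral_cong)
    fix t :: real
    have "s * ((s * t) powr (a - 1) * (s - s * t) powr (b - 1)) =
          s powr (a + b - 1) * (t powr (a - 1) * (1 - t) powr (b - 1))" if "0 < t" "t < 1"
    proof -
      have "(s - s * t) powr (b - 1) = s powr (b - 1) * (1 - t) powr (b - 1)"
        using powr_mult[of s "1 - t"] by (simp add: right_diff_distrib)
      hence "s * ((s * t) powr (a - 1) * (s - s * t) powr (b - 1)) =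
          (s powr 1 * s powr (a - 1) * s powr (b - 1)) * (t powr (a - 1) * (1 - t) powr (b - 1))"
        using s by (simp add: powr_mult)
      also have "s powr 1 * s powr (a - 1) * s powr (b - 1) = s powr (a + b - 1)"
        unfolding powr_add[symmetric] by (simp add: add_diff_eq)
      finally show ?thesis .
    qed
    thus "ennreal s * ?f s (s * t) = ennreal (s powr (a + b - 1)) * ?f 1 t"
      using s by (auto simp: zero_less_mult_iff simp flip: ennreal_mult')
  qed
  also have "\<dots> = ennreal (s powr (a + b - 1)) * ennreal (Beta a b)"
    using a by (subst nn_integral_cmult) (auto simp: Beta_nn)
  finally show ?thesis by (simp add: ennreal_mult')
qed

text \<open>Writing \<open>(c + u) powr - p\<close> as a Gamma integral and exchanging the order of integration
  also covers the exponents for which the integral diverges.\<close>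

lemma Beta_prime_nn:
  assumes p: "p > 0" and c: "c > 0"
  shows "(\<integral>\<^sup>+u. ennreal (if 0 < u then u powr (a - 1) * (c + u) powr - p else 0) \<partial>lborel) =
         ennreal (c powr (a - p) / Gamma p) * (Gamma_nn a * Gamma_nn (p - a))"
proof -
  let ?F = "\<lambda>u s. ennreal (if 0 < u then u powr (a - 1) else 0) *
     ennreal (if 0 < s then s powr (p - 1) * exp (- ((c + u) * s)) else 0)"
  have Gp: "Gamma p > 0" using p by simp
  have "ennreal (Gamma p) * (\<integral>\<^sup>+u. ennreal (if 0 < u then u powr (a - 1) * (c + u) powr - p else 0) \<partial>lborel) =
        (\<integral>\<^sup>+u. ennreal (Gamma p) * ennreal (if 0 < u then u powr (a - 1) * (c + u) powr - p else 0) \<partial>lborel)"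
    by (rule nn_integral_cmult[symmetric]) measurable
  also have "\<dots> = (\<integral>\<^sup>+u. \<integral>\<^sup>+s. ?F u s \<partial>lborel \<partial>lborel)"
  proof (intro nn_integral_cong)
    fix u :: real
    show "ennreal (Gamma p) * ennreal (if 0 < u then u powr (a - 1) * (c + u) powr - p else 0) =
       (\<integral>\<^sup>+s. ?F u s \<partial>lborel)"
    proof (cases "u > 0")
      case True
      have "(\<integral>\<^sup>+s. ?F u s \<partial>lborel) = ennreal (u powr (a - 1)) * (ennreal ((c + u) powr - p) * Gamma_nn p)"
        using True c by (subst nn_integral_cmult) (auto simp: Gamma_nn_scaled)
      thus ?thesis using True p by (simp add: Gamma_nn_pos mult_ac flip: ennreal_mult')
    qed simp
  qed
  also have "\<dots> = (\<integral>\<^sup>+s. \<integral>\<^sup>+u. ?F u s \<partial>lborel \<partial>lborel)"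
    by (rule lborel_pair.Fubini') measurable
  also have "\<dots> = (\<integral>\<^sup>+s. ennreal (if 0 < s then s powr (p - a - 1) * exp (- (c * s)) else 0) * Gamma_nn a \<partial>lborel)"
  proof (intro nn_integral_cong)
    fix s :: real
    show "(\<integral>\<^sup>+u. ?F u s \<partial>lborel) = ennreal (if 0 < s then s powr (p - a - 1) * exp (- (c * s)) else 0) * Gamma_nn a"
    proof (cases "s > 0")
      case True
      have "(\<integral>\<^sup>+u. ?F u s \<partial>lborel) = (\<integral>\<^sup>+u. ennreal (s powr (p - 1) * exp (- (c * s))) *
          ennreal (if 0 < u then u powr (a - 1) * exp (- (s * u)) else 0) \<partial>lborel)"
        using True by (intro nn_integral_cong) (auto simp: exp_add[symmetric] algebra_simps simp flip: ennreal_mult')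
      also have "\<dots> = ennreal (s powr (p - 1) * exp (- (c * s))) * (ennreal (s powr - a) * Gamma_nn a)"
        using True by (subst nn_integral_cmult) (auto simp: Gamma_nn_scaled)
      also have "\<dots> = ennreal (s powr (p - 1) * exp (- (c * s)) * s powr - a) * Gamma_nn a"
        by (simp add: ennreal_mult' mult.assoc)
      also have "s powr (p - 1) * exp (- (c * s)) * s powr - a = s powr (p - a - 1) * exp (- (c * s))"
        using True by (simp add: powr_diff powr_minus powr_add field_simps)
      finally show ?thesis using True by simp
    qed simp
  qed
  also have "\<dots> = (ennreal (c powr - (p - a)) * Gamma_nn (p - a)) * Gamma_nn a"
    using c by (subst nn_integral_multc) (auto simp: Gamma_nn_scaled)
  finally have *: "ennreal (Gamma p) * (\<integral>\<^sup>+u. ennreal (if 0 < u then u powr (a - 1) * (c + u) powr - p else 0) \<partial>lborel) =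
    (ennreal (c powr - (p - a)) * Gamma_nn (p - a)) * Gamma_nn a" .
  have "(\<integral>\<^sup>+u. ennreal (if 0 < u then u powr (a - 1) * (c + u) powr - p else 0) \<partial>lborel) =
    ennreal (1 / Gamma p) * (ennreal (Gamma p) * (\<integral>\<^sup>+u. ennreal (if 0 < u then u powr (a - 1) * (c + u) powr - p else 0) \<partial>lborel))"
    using Gp by (simp add: mult.assoc[symmetric] flip: ennreal_mult')
  also have "\<dots> = (ennreal (1 / Gamma p) * ennreal (c powr (a - p))) * (Gamma_nn a * Gamma_nn (p - a))"
    unfolding * by (simp add: mult_ac)
  also have "ennreal (1 / Gamma p) * ennreal (c powr (a - p)) = ennreal (c powr (a - p) / Gamma p)"
    using Gp by (simp flip: ennreal_mult')
  finally show ?thesis .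
qed

section \<open>The squared norm under Lebesgue measure\<close>

text \<open>The derivative in t of the volume pi^(d/2) t^(d/2) / Gamma(d/2 + 1) of the ball of
  radius sqrt t in R^d, that is, the density of |v|^2 under Lebesgue measure.\<close>

definition sq_norm_density :: "nat \<Rightarrow> real \<Rightarrow> real" where
  "sq_norm_density d t = (if 0 < t then pi powr (d / 2) / Gamma (d / 2) * t powr (d / 2 - 1) else 0)"

lemma sq_norm_density_measurable [measurable]: "sq_norm_density d \<in> borel_measurable borel"
  unfolding sq_norm_density_def[abs_def] by measurable

lemma sq_norm_density_nonneg: "0 \<le> sq_norm_density d t"
  by (cases "d = 0") (auto simp: sq_norm_density_def Gamma_real_pos less_imp_le)

text \<open>The image of Lebesgue measure under squaring and the measure with the claimed density
  both give \<open>{..t}\<close> the mass \<open>ennreal (2 * sqrt t)\<close>; being finite on these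
  half-lines, they are determined by them.\<close>

lemma nn_integral_square:
  assumes g[measurable]: "g \<in> borel_measurable borel"
  shows "(\<integral>\<^sup>+y. g (y\<^sup>2) \<partial>lborel) = (\<integral>\<^sup>+t. ennreal (sq_norm_density 1 t) * g t \<partial>lborel)"
proof -
  let ?M = "distr lborel borel (\<lambda>y :: real. y\<^sup>2)"
  let ?N = "density lborel (\<lambda>t. ennreal (sq_norm_density 1 t))"
  have M: "emeasure ?M {..t} = ennreal (2 * sqrt t)" for t
  proof (cases "t \<ge> 0")
    case True
    have "(\<lambda>y. y\<^sup>2) -` {..t} \<inter> space lborel = {- sqrt t..sqrt t}"
    proof -
      have "y\<^sup>2 \<le> t \<longleftrightarrow> \<bar>y\<bar> \<le> sqrt t" for y
        by (metis real_sqrt_abs real_sqrt_le_iff)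
      thus ?thesis by (auto simp: abs_le_iff)
    qed
    thus ?thesis using True by (subst emeasure_distr) auto
  next
    case False
    hence "(\<lambda>y. y\<^sup>2) -` {..t} \<inter> space lborel = {}"
      by (auto simp: not_le) (meson less_le_trans not_less zero_le_power2)
    thus ?thesis using False by (subst emeasure_distr) (auto simp: ennreal_neg)
  qed
  have N: "emeasure ?N {..t} = ennreal (2 * sqrt t)" for t
  proof -
    have "emeasure ?N {..t} = (\<integral>\<^sup>+u. ennreal (sq_norm_density 1 u) * indicator {..t} u \<partial>lborel)"
      by (rule emeasure_density) auto
    \<comment> \<open>The factor with exponent \<open>1 - 1\<close> is 1 and brings the integral
      into Beta form; the integrands differ at most at u = t.\<close>
    also have "\<dots> = (\<integral>\<^sup>+u. ennreal (if 0 < u \<and> u < t then u powr (1/2 - 1) * (t - u) powr (1 - 1) else 0) \<partial>lborel)"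
    proof (rule nn_integral_cong_AE)
      have "AE u in lborel. u \<noteq> t" by (rule AE_lborel_singleton)
      thus "AE u in lborel. ennreal (sq_norm_density 1 u) * indicator {..t} u =
          ennreal (if 0 < u \<and> u < t then u powr (1/2 - 1) * (t - u) powr (1 - 1) else 0)"
        by eventually_elim
          (auto simp: sq_norm_density_def Gamma_one_half_real powr_half_sqrt split: split_indicator)
    qed
    also have "\<dots> = ennreal (2 * sqrt t)"
    proof (cases "t > 0")
      case True
      have "Beta (1/2) 1 = (2 :: real)"
      proof -
        have "(1/2 :: real) \<notin> \<int>\<^sub>\<le>\<^sub>0"
          using nonpos_Ints_nonpos[of "1/2 :: real"] by fastforce
        from Gamma_plus1[OF this] have "sqrt pi = 2 * Gamma (3/2)"
          by (simp add: Gamma_one_half_real)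
        moreover have "Gamma (3/2 :: real) \<noteq> 0"
          by (rule less_imp_neq[OF Gamma_real_pos, symmetric]) simp
        ultimately show ?thesis by (simp add: Beta_def Gamma_one_half_real)
      qed
      thus ?thesis using Beta_nn_scaled[of "1/2" 1 t] True by (simp add: powr_half_sqrt mult.commute)
    next
      case False
      hence "(\<integral>\<^sup>+u. ennreal (if 0 < u \<and> u < t then u powr (1/2 - 1) * (t - u) powr (1 - 1) else 0) \<partial>lborel) = 0"
        by (subst nn_integral_0_iff_AE) (auto simp: ennreal_eq_0_iff)
      thus ?thesis using False by (simp add: ennreal_neg)
    qed
    finally show ?thesis .
  qed
  have "?M = ?N"
  proof (rule measure_eqI_generator_eq[where E = "range atMost" and \<Omega> = UNIV and A = "\<lambda>n. {..real n}"])
    show "Int_stable (range (atMost :: real \<Rightarrow> real set))"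
      by (auto simp: Int_stable_def)
    show "sets ?M = sigma_sets UNIV (range atMost)" "sets ?N = sigma_sets UNIV (range atMost)"
      by (simp_all add: borel_eq_atMost)
    show "(\<Union>n. {..real n}) = UNIV" using real_arch_simple by auto
    show "emeasure ?M {..real n} \<noteq> \<infinity>" for n by (simp add: M)
  qed (auto simp: M N simp del: One_nat_def)
  have "(\<integral>\<^sup>+y. g (y\<^sup>2) \<partial>lborel) = (\<integral>\<^sup>+t. g t \<partial>?M)"
    by (rule nn_integral_distr[symmetric]) auto
  also have "\<dots> = (\<integral>\<^sup>+t. g t \<partial>?N)" using \<open>?M = ?N\<close> by (simp only:)
  also have "\<dots> = (\<integral>\<^sup>+t. ennreal (sq_norm_density 1 t) * g t \<partial>lborel)"
    by (rule nn_integral_density) auto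
  finally show ?thesis .
qed

text \<open>Radial form of splitting R^(d+e) into R^d and R^e: the Beta integral over (0, w)
  produces Gamma(d/2) Gamma(e/2) / Gamma((d+e)/2), which turns the two constants into the one for d
  + e.\<close>

lemma sq_norm_density_convolution:
  assumes d: "d > 0" "e > 0"
  shows "(\<integral>\<^sup>+t. ennreal (sq_norm_density d t) * ennreal (sq_norm_density e (w - t)) \<partial>lborel) =
         ennreal (sq_norm_density (d + e) w)"
proof -
  define C where "C = pi powr (d / 2) / Gamma (d / 2) * (pi powr (e / 2) / Gamma (e / 2))"
  have Gd: "Gamma (d / 2) > 0" "Gamma (e / 2) > 0" "Gamma ((d + e) / 2) > 0"
    using d by (simp_all add: Gamma_real_pos)
  have C: "C \<ge> 0" using d by (simp add: C_def Gamma_real_pos less_imp_le)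
  have "(\<integral>\<^sup>+t. ennreal (sq_norm_density d t) * ennreal (sq_norm_density e (w - t)) \<partial>lborel) =
    (\<integral>\<^sup>+t. ennreal C * ennreal (if 0 < t \<and> t < w then t powr (d/2 - 1) * (w - t) powr (e/2 - 1) else 0) \<partial>lborel)"
    using C Gd by (intro nn_integral_cong) (auto simp: sq_norm_density_def C_def simp flip: ennreal_mult)
  also have "\<dots> = ennreal C * (\<integral>\<^sup>+t. ennreal (if 0 < t \<and> t < w then t powr (d/2 - 1) * (w - t) powr (e/2 - 1) else 0) \<partial>lborel)"
    by (rule nn_integral_cmult) measurable
  also have "\<dots> = ennreal (sq_norm_density (d + e) w)"
  proof (cases "w > 0")
    case True
    have "C * (w powr (d/2 + e/2 - 1) * Beta (d/2) (e/2)) = sq_norm_density (d + e) w"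
      using Gd True by (simp add: C_def Beta_def sq_norm_density_def powr_add add_divide_distrib)
    thus ?thesis using d True C by (subst Beta_nn_scaled) (auto simp flip: ennreal_mult')
  next
    case False
    hence "(\<integral>\<^sup>+t. ennreal (if 0 < t \<and> t < w then t powr (d/2 - 1) * (w - t) powr (e/2 - 1) else 0) \<partial>lborel) = 0"
      by (subst nn_integral_0_iff_AE) (auto simp: ennreal_eq_0_iff)
    thus ?thesis using False by (simp add: sq_norm_density_def)
  qed
  finally show ?thesis .
qed

text \<open>Induction on the coordinates: one more square is a convolution with
  \<open>sq_norm_density 1\<close>. \<open>I\<close> is nonempty because without coordinates the
  squared norm is constantly 0, a point mass without density.\<close>

lemma nn_integral_sum_squares:
  assumes "finite I" "I \<noteq> {}" and "g \<in> borel_measurable borel"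
  shows "(\<integral>\<^sup>+v. g (\<Sum>i\<in>I. (v i)\<^sup>2) \<partial>Pi\<^sub>M I (\<lambda>_. lborel)) =
         (\<integral>\<^sup>+t. ennreal (sq_norm_density (card I) t) * g t \<partial>lborel)"
  using assms
proof (induction I arbitrary: g rule: finite_ne_induct)
  case (singleton i)
  interpret product_sigma_finite "\<lambda>_ :: 'a. lborel :: real measure" ..
  note singleton[measurable]
  have "(\<integral>\<^sup>+v. g ((v i)\<^sup>2) \<partial>Pi\<^sub>M {i} (\<lambda>_. lborel)) = (\<integral>\<^sup>+y. g (y\<^sup>2) \<partial>lborel)"
    by (rule product_nn_integral_singleton) measurable
  thus ?case using singleton by (simp add: nn_integral_square)
next
  case (insert i I)
  interpret product_sigma_finite "\<lambda>_ :: 'a. lborel :: real measure" ..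
  note g[measurable] = \<open>g \<in> borel_measurable borel\<close>
  let ?d = "card I"
  have d: "?d > 0" using insert by (simp add: card_gt_0_iff)
  have "(\<integral>\<^sup>+v. g (\<Sum>i\<in>insert i I. (v i)\<^sup>2) \<partial>Pi\<^sub>M (insert i I) (\<lambda>_. lborel)) =
     (\<integral>\<^sup>+x. \<integral>\<^sup>+y. g (\<Sum>j\<in>insert i I. ((x(i := y)) j)\<^sup>2) \<partial>lborel \<partial>Pi\<^sub>M I (\<lambda>_. lborel))"
    using insert by (intro product_nn_integral_insert) auto
  also have "\<dots> = (\<integral>\<^sup>+x. \<integral>\<^sup>+y. g (y\<^sup>2 + (\<Sum>j\<in>I. (x j)\<^sup>2)) \<partial>lborel \<partial>Pi\<^sub>M I (\<lambda>_. lborel))"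
  proof -
    have "(\<Sum>j\<in>insert i I. ((x(i := y)) j)\<^sup>2) = y\<^sup>2 + (\<Sum>j\<in>I. (x j)\<^sup>2)" for x and y :: real
    proof -
      have "(\<Sum>j\<in>I. ((x(i := y)) j)\<^sup>2) = (\<Sum>j\<in>I. (x j)\<^sup>2)"
        using insert by (intro sum.cong) auto
      thus ?thesis using insert by (simp del: fun_upd_apply) simp
    qed
    thus ?thesis by (simp only:)
  qed
  also have "\<dots> = (\<integral>\<^sup>+t. ennreal (sq_norm_density ?d t) * (\<integral>\<^sup>+y. g (y\<^sup>2 + t) \<partial>lborel) \<partial>lborel)"
    by (rule insert.IH) measurable
  also have "\<dots> = (\<integral>\<^sup>+t. \<integral>\<^sup>+w. ennreal (sq_norm_density ?d t) * ennreal (sq_norm_density 1 (w - t)) * g w \<partial>lborel \<partial>lborel)"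
  proof (intro nn_integral_cong)
    fix t :: real
    have "(\<integral>\<^sup>+y. g (y\<^sup>2 + t) \<partial>lborel) = (\<integral>\<^sup>+u. ennreal (sq_norm_density 1 u) * g (u + t) \<partial>lborel)"
      by (rule nn_integral_square) measurable
    also have "\<dots> = (\<integral>\<^sup>+w. ennreal (sq_norm_density 1 (w - t)) * g w \<partial>lborel)"
      by (subst nn_integral_real_affine[where c = 1 and t = "-t"]) (auto simp: algebra_simps)
    finally show "ennreal (sq_norm_density ?d t) * (\<integral>\<^sup>+y. g (y\<^sup>2 + t) \<partial>lborel) =
       (\<integral>\<^sup>+w. ennreal (sq_norm_density ?d t) * ennreal (sq_norm_density 1 (w - t)) * g w \<partial>lborel)"
      by (simp add: nn_integral_cmult mult.assoc)
  qed
  also have "\<dots> = (\<integral>\<^sup>+w. \<integral>\<^sup>+t. ennreal (sq_norm_density ?d t) * ennreal (sq_norm_density 1 (w - t)) * g w \<partial>lborel \<partial>lborel)"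
    by (rule lborel_pair.Fubini') measurable
  also have "\<dots> = (\<integral>\<^sup>+w. ennreal (sq_norm_density (?d + 1) w) * g w \<partial>lborel)"
    using d by (subst nn_integral_multc) (auto simp: sq_norm_density_convolution)
  finally show ?case using insert by simp
qed

section \<open>The law of the determinant\<close>

text \<open>\<open>M\<close> is arbitrary outside \<open>insert i I\<close>, whereas the Fubini rule
  asks for a probability measure at every index; \<open>K\<close> fills the other indices with point
  masses.\<close>

lemma nn_integral_PiM_insert_prob:
  assumes I: "finite I" "i \<notin> I" and M: "\<And>j. j \<in> insert i I \<Longrightarrow> prob_space (M j)"
    and f: "f \<in> borel_measurable (Pi\<^sub>M (insert i I) M)"
  shows "integral\<^sup>N (Pi\<^sub>M (insert i I) M) f = (\<integral>\<^sup>+y. \<integral>\<^sup>+x. f (x(i := y)) \<partial>Pi\<^sub>M I M \<partial>M i)"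
proof -
  define K where "K = (\<lambda>j. if j \<in> insert i I then M j else return (count_space UNIV) undefined)"
  interpret K: product_prob_space K
    by (rule product_prob_spaceI) (auto simp: K_def intro!: M prob_space_return)
  have eq: "Pi\<^sub>M (insert i I) M = Pi\<^sub>M (insert i I) K" "Pi\<^sub>M I M = Pi\<^sub>M I K" "M i = K i"
    by (auto simp: K_def intro!: PiM_cong)
  show ?thesis
    using f I unfolding eq by (intro K.product_nn_integral_insert_rev)
qed

section \<open>Radial row laws and their marginals\<close>

definition row_law :: "nat \<Rightarrow> nat \<Rightarrow> (real \<Rightarrow> ennreal) \<Rightarrow> (nat \<times> nat \<Rightarrow> real) measure" where
  "row_law b n f = density (row_space b n) (\<lambda>v. f (row_norm_sq b n v))"

definition norm_law :: "nat \<Rightarrow> nat \<Rightarrow> (nat \<Rightarrow> real \<Rightarrow> ennreal) \<Rightarrow> real measure" where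
  "norm_law b n P = distr (row_law b n (P n)) borel (row_norm_sq b n)"

text \<open>\<open>P n\<close> is the density, as a function of the squared norm, of the first \<open>n\<close> entries of a
  row of length \<open>N\<close>.\<close>

definition radial_family :: "nat \<Rightarrow> nat \<Rightarrow> (nat \<Rightarrow> real \<Rightarrow> ennreal) \<Rightarrow> bool" where
  "radial_family b N P \<longleftrightarrow> (\<forall>n\<le>N. P n \<in> borel_measurable borel) \<and> P 0 0 = 1 \<and>
     (\<forall>n<N. \<forall>t\<ge>0. (\<integral>\<^sup>+u. ennreal (sq_norm_density b u) * P (Suc n) (t + u) \<partial>lborel) = P n t)"

lemma radial_family_mono: "radial_family b N P \<Longrightarrow> n \<le> N \<Longrightarrow> radial_family b n P"
  by (auto simp: radial_family_def)

lemma row_norm_sq_measurable [measurable]: "row_norm_sq b n \<in> borel_measurable (row_space b n)"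
  unfolding row_norm_sq_sum[abs_def] row_space_def by measurable

lemma row_norm_sq_nonneg: "0 \<le> row_norm_sq b n v"
  by (simp add: row_norm_sq_def sum_nonneg)

lemma sets_row_law [simp, measurable_cong]: "sets (row_law b n f) = sets (row_space b n)"
  by (simp add: row_law_def)

lemma space_row_law [simp]: "space (row_law b n f) = space (row_space b n)"
  by (simp add: row_law_def)

lemma restrict_row_measurable:
  "(\<lambda>v. restrict v ({..<n} \<times> {..<b})) \<in> measurable (row_space b (Suc n)) (row_space b n)"
  unfolding row_space_def by (rule measurable_restrict_subset) auto

text \<open>Splitting off the b components of the last entry adds their squared norm to that of the
  rest; \<open>nn_integral_sum_squares\<close> turns the integral over them into the one-dimensional
  integral in \<open>radial_family\<close>.\<close>

lemma row_law_marginal: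
  assumes b: "b > 0" and P: "radial_family b N P" and n: "n < N"
  shows "distr (row_law b (Suc n) (P (Suc n))) (row_space b n) (\<lambda>v. restrict v ({..<n} \<times> {..<b})) =
         row_law b n (P n)"
proof (rule measure_eqI)
  interpret product_sigma_finite "\<lambda>_ :: nat \<times> nat. lborel :: real measure" ..
  let ?I = "{..<n} \<times> {..<b}" and ?J = "{n} \<times> {..<b}"
  let ?L = "\<lambda>_ :: nat \<times> nat. lborel :: real measure"
  have [measurable]: "P n \<in> borel_measurable borel" "P (Suc n) \<in> borel_measurable borel"
    using P n by (auto simp: radial_family_def)
  note restrict_row_measurable[measurable]
  have un: "?I \<union> ?J = {..<Suc n} \<times> {..<b}" by auto
  fix A assume "A \<in> sets (distr (row_law b (Suc n) (P (Suc n))) (row_space b n) (\<lambda>v. restrict v ?I))"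
  hence A[measurable]: "A \<in> sets (row_space b n)" by simp
  have "emeasure (distr (row_law b (Suc n) (P (Suc n))) (row_space b n) (\<lambda>v. restrict v ?I)) A =
     (\<integral>\<^sup>+v. indicator A v \<partial>distr (row_law b (Suc n) (P (Suc n))) (row_space b n) (\<lambda>v. restrict v ?I))"
    by simp
  also have "\<dots> = (\<integral>\<^sup>+v. indicator A (restrict v ?I) \<partial>row_law b (Suc n) (P (Suc n)))"
    by (rule nn_integral_distr) measurable
  also have "\<dots> = (\<integral>\<^sup>+v. P (Suc n) (row_norm_sq b (Suc n) v) * indicator A (restrict v ?I) \<partial>row_space b (Suc n))"
    unfolding row_law_def by (rule nn_integral_density) measurable
  also have "\<dots> = (\<integral>\<^sup>+v. P (Suc n) (row_norm_sq b (Suc n) v) * indicator A (restrict v ?I) \<partial>Pi\<^sub>M (?I \<union> ?J) ?L)"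
    by (simp only: un row_space_def)
  also have "\<dots> = (\<integral>\<^sup>+x. \<integral>\<^sup>+y. P (Suc n) (row_norm_sq b (Suc n) (merge ?I ?J (x, y))) *
      indicator A (restrict (merge ?I ?J (x, y)) ?I) \<partial>Pi\<^sub>M ?J ?L \<partial>Pi\<^sub>M ?I ?L)"
    by (rule product_nn_integral_fold) (auto simp: un simp flip: row_space_def)
  also have "\<dots> = (\<integral>\<^sup>+x. P n (row_norm_sq b n x) * indicator A x \<partial>row_space b n)"
    unfolding row_space_def
  proof (rule nn_integral_cong)
    fix x assume x: "x \<in> space (Pi\<^sub>M ?I ?L)"
    have r: "restrict (merge ?I ?J (x, y)) ?I = x" for y
      using x by (auto simp: space_PiM merge_def fun_eq_iff PiE_def extensional_def)
    have s: "row_norm_sq b (Suc n) (merge ?I ?J (x, y)) = row_norm_sq b n x + (\<Sum>i\<in>?J. (y i)\<^sup>2)" for y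
    proof -
      have "row_norm_sq b (Suc n) (merge ?I ?J (x, y)) =
          (\<Sum>i\<in>?I. (merge ?I ?J (x, y) i)\<^sup>2) + (\<Sum>i\<in>?J. (merge ?I ?J (x, y) i)\<^sup>2)"
        unfolding row_norm_sq_sum un[symmetric] by (rule sum.union_disjoint) auto
      also have "(\<Sum>i\<in>?I. (merge ?I ?J (x, y) i)\<^sup>2) = (\<Sum>i\<in>?I. (x i)\<^sup>2)"
        by (intro sum.cong) (auto simp: merge_def)
      also have "(\<Sum>i\<in>?J. (merge ?I ?J (x, y) i)\<^sup>2) = (\<Sum>i\<in>?J. (y i)\<^sup>2)"
        by (intro sum.cong) (auto simp: merge_def)
      finally show ?thesis by (simp only: row_norm_sq_sum)
    qed
    have "(\<integral>\<^sup>+y. P (Suc n) (row_norm_sq b (Suc n) (merge ?I ?J (x, y))) *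
        indicator A (restrict (merge ?I ?J (x, y)) ?I) \<partial>Pi\<^sub>M ?J ?L) =
      (\<integral>\<^sup>+y. P (Suc n) (row_norm_sq b n x + (\<Sum>i\<in>?J. (y i)\<^sup>2)) \<partial>Pi\<^sub>M ?J ?L) * indicator A x"
      unfolding r s by (rule nn_integral_multc) measurable
    also have "(\<integral>\<^sup>+y. P (Suc n) (row_norm_sq b n x + (\<Sum>i\<in>?J. (y i)\<^sup>2)) \<partial>Pi\<^sub>M ?J ?L) =
       (\<integral>\<^sup>+u. ennreal (sq_norm_density b u) * P (Suc n) (row_norm_sq b n x + u) \<partial>lborel)"
      using b by (subst nn_integral_sum_squares) auto
    also have "\<dots> = P n (row_norm_sq b n x)"
      using P n row_norm_sq_nonneg by (auto simp: radial_family_def)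
    finally show "(\<integral>\<^sup>+y. P (Suc n) (row_norm_sq b (Suc n) (merge ?I ?J (x, y))) *
        indicator A (restrict (merge ?I ?J (x, y)) ?I) \<partial>Pi\<^sub>M ?J ?L) =
      P n (row_norm_sq b n x) * indicator A x" .
  qed
  also have "\<dots> = emeasure (row_law b n (P n)) A"
    unfolding row_law_def by (rule emeasure_density[symmetric]) measurable
  finally show "emeasure (distr (row_law b (Suc n) (P (Suc n))) (row_space b n) (\<lambda>v. restrict v ?I)) A =
     emeasure (row_law b n (P n)) A" .
qed simp

text \<open>Marginals keep the total mass, which therefore equals that of the one-point space at n =
  0, namely \<open>P 0 0 = 1\<close>. So the normalisation of the row densities comes with the
  recursion.\<close>

lemma prob_space_row_law:
  assumes b: "b > 0" and P: "radial_family b N P" and n: "n \<le> N"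
  shows "prob_space (row_law b n (P n))"
  using n
proof (induction n)
  case 0
  have [measurable]: "P 0 \<in> borel_measurable borel" using P by (auto simp: radial_family_def)
  have "emeasure (row_law b 0 (P 0)) (space (row_law b 0 (P 0))) = (\<integral>\<^sup>+v. P 0 (row_norm_sq b 0 v) \<partial>row_space b 0)"
    unfolding row_law_def by (subst emeasure_density) (auto intro!: nn_integral_cong)
  also have "\<dots> = 1"
    using P by (simp add: row_norm_sq_def row_space_def PiM_empty radial_family_def nn_integral_count_space_finite)
  finally show ?case by (rule prob_spaceI)
next
  case (Suc n)
  let ?r = "\<lambda>v :: nat \<times> nat \<Rightarrow> real. restrict v ({..<n} \<times> {..<b})"
  note restrict_row_measurable[measurable]
  interpret prob_space "row_law b n (P n)" using Suc by auto
  have "emeasure (row_law b (Suc n) (P (Suc n))) (space (row_law b (Suc n) (P (Suc n)))) =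
    emeasure (distr (row_law b (Suc n) (P (Suc n))) (row_space b n) ?r) (space (row_space b n))"
    by (subst emeasure_distr)
       (auto intro!: arg_cong[where f = "emeasure _"] measurable_space[OF restrict_row_measurable])
  also have "\<dots> = 1"
    using row_law_marginal[OF b P, of n] Suc.prems emeasure_space_1 by simp
  finally show ?case by (rule prob_spaceI)
qed

text \<open>As \<open>T\<close> keeps the norm, the density at v is also the density at T v, so it
  passes through the image measure unchanged and only Lebesgue measure has to be
  transported.\<close>

lemma row_law_rotation:
  assumes f[measurable]: "f \<in> borel_measurable borel"
    and T: "preserves_lebesgue ({..<n} \<times> {..<b}) T" "\<And>y. row_norm_sq b n (T y) = row_norm_sq b n y"
  shows "T \<in> measurable (row_space b n) (row_space b n)"
    "distr (row_law b n f) (row_space b n) T = row_law b n f"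
proof -
  show m[measurable]: "T \<in> measurable (row_space b n) (row_space b n)"
    using T(1) by (simp add: preserves_lebesgue_def row_space_def)
  have "distr (row_law b n f) (row_space b n) T =
        distr (density (row_space b n) (\<lambda>v. f (row_norm_sq b n (T v)))) (row_space b n) T"
    by (simp add: row_law_def T(2))
  also have "\<dots> = density (distr (row_space b n) (row_space b n) T) (\<lambda>v. f (row_norm_sq b n v))"
    by (rule density_distr[symmetric]) measurable
  also have "distr (row_space b n) (row_space b n) T = row_space b n"
    using T(1) by (simp add: preserves_lebesgue_def row_space_def)
  finally show "distr (row_law b n f) (row_space b n) T = row_law b n f"
    by (simp add: row_law_def)
qed

text \<open>By the Leibniz formula the determinant is a polynomial in the matrix entries.\<close>

lemma abs_det_sq_measurable:
  assumes b: "b \<in> {1, 2, 4}" and L: "{1..N} \<subseteq> L"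
  shows "abs_det_sq b N \<in> borel_measurable (Pi\<^sub>M L (\<lambda>_. row_space b N))"
proof -
  let ?M = "Pi\<^sub>M L (\<lambda>_. row_space b N)" and ?m = "block_size b"
  have comp: "(\<lambda>x. x (Suc i) (j, k)) \<in> borel_measurable ?M" if "i < N" "j < N" "k < b" for i j k
  proof -
    have "(\<lambda>x. x (Suc i)) \<in> measurable ?M (row_space b N)"
      using that L by (intro measurable_component_singleton) auto
    moreover have "(\<lambda>v. v (j, k)) \<in> measurable (row_space b N) lborel"
      unfolding row_space_def using that by (intro measurable_component_singleton) auto
    ultimately have "(\<lambda>x. x (Suc i) (j, k)) \<in> measurable ?M lborel" by (rule measurable_compose)
    thus ?thesis by simp
  qed
  have Complex[measurable (raw)]: "(\<lambda>x. Complex (f x) (g x)) \<in> borel_measurable ?M"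
    if "f \<in> borel_measurable ?M" "g \<in> borel_measurable ?M" for f g
    using that unfolding Complex_eq by measurable
  have cnj[measurable (raw)]: "(\<lambda>x. cnj (f x)) \<in> borel_measurable ?M"
    if "f \<in> borel_measurable ?M" for f
    using that by (rule measurable_compose) (intro borel_measurable_continuous_onI continuous_intros)
  have entry: "(\<lambda>x. cmatrix b N x $$ (i, j)) \<in> borel_measurable ?M" if ij: "i < ?m * N" "j < ?m * N" for i j
  proof -
    let ?i = "i div ?m" and ?j = "j div ?m"
    have k: "(\<lambda>x. x (Suc ?i) (?j, k)) \<in> borel_measurable ?M" if "k < b" for k
      using that ij by (intro comp block_div_mod) auto
    have "(\<lambda>x. entry_block b (\<lambda>k. x (Suc ?i) (?j, k)) p q) \<in> borel_measurable ?M" for p q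
    proof -
      consider "b = 1" | "b = 2" | "b = 4" using b by auto
      thus ?thesis
      proof cases
        case 1
        have [measurable]: "(\<lambda>x. x (Suc ?i) (?j, 0)) \<in> borel_measurable ?M"
          by (rule k) (simp add: 1)
        have eq: "entry_block b r p q = complex_of_real (r 0)" for r
          using 1 by (simp add: entry_block_def)
        show ?thesis unfolding eq by measurable
      next
        case 2
        have [measurable]: "(\<lambda>x. x (Suc ?i) (?j, 0)) \<in> borel_measurable ?M"
          "(\<lambda>x. x (Suc ?i) (?j, 1)) \<in> borel_measurable ?M"
          by (rule k, simp add: 2)+
        have eq: "entry_block b r p q = Complex (r 0) (r 1)" for r
          using 2 by (simp add: entry_block_def)
        show ?thesis unfolding eq by measurable
      next
        case 3
        have [measurable]: "(\<lambda>x. x (Suc ?i) (?j, 0)) \<in> borel_measurable ?M"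
          "(\<lambda>x. x (Suc ?i) (?j, 1)) \<in> borel_measurable ?M"
          "(\<lambda>x. x (Suc ?i) (?j, 2)) \<in> borel_measurable ?M"
          "(\<lambda>x. x (Suc ?i) (?j, 3)) \<in> borel_measurable ?M"
          by (rule k, simp add: 3)+
        have eq: "entry_block b r p q = quat_block (Complex (r 0) (r 1)) (Complex (r 2) (r 3)) p q" for r
          using 3 by (simp add: entry_block_def)
        show ?thesis unfolding eq quat_block_def by measurable
      qed
    qed
    thus ?thesis using ij by (simp add: cmatrix_def)
  qed
  have "(\<lambda>x. Determinant.det (cmatrix b N x)) \<in> borel_measurable ?M"
    unfolding det_def'[OF cmatrix_carrier]
  proof (intro borel_measurable_sum borel_measurable_times borel_measurable_const borel_measurable_prod)
    fix p i assume "p \<in> {p. p permutes {0..<?m * N}}" "i \<in> {0..<?m * N}"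
    thus "(\<lambda>x. cmatrix b N x $$ (i, p i)) \<in> borel_measurable ?M"
      using permutes_in_image[of p "{0..<?m * N}" i] by (intro entry) auto
  qed
  hence "(\<lambda>x. root ?m ((cmod (Determinant.det (cmatrix b N x)))\<^sup>2)) \<in> borel_measurable ?M"
    by measurable
  thus ?thesis by (subst abs_det_sq_cmatrix[OF b, abs_def])
qed

lemma prob_space_norm_law:
  assumes "b > 0" "radial_family b N P" "n \<le> N"
  shows "prob_space (norm_law b n P)"
  unfolding norm_law_def
  by (intro prob_space.prob_space_distr prob_space_row_law[OF assms]) measurable

lemma sets_norm_law [simp, measurable_cong]: "sets (norm_law b n P) = sets borel"
  by (simp add: norm_law_def)

lemma prod_coordinates_measurable:
  assumes "\<And>l. l \<in> L \<Longrightarrow> sets (K l) = sets borel"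
  shows "(\<lambda>y. \<Prod>l\<in>L. y l :: real) \<in> borel_measurable (Pi\<^sub>M L K)"
proof (intro borel_measurable_prod)
  fix l assume l: "l \<in> L"
  have "(\<lambda>y. y l) \<in> measurable (Pi\<^sub>M L K) (K l)" by (rule measurable_component_singleton[OF l])
  also have "measurable (Pi\<^sub>M L K) (K l) = borel_measurable (Pi\<^sub>M L K)"
    by (intro measurable_cong_sets refl assms l)
  finally show "(\<lambda>y. y l) \<in> borel_measurable (Pi\<^sub>M L K)" .
qed

lemma distr_PiM_empty_const: "distr (Pi\<^sub>M {} K) borel (\<lambda>_. c :: real) = return borel c"
  by (intro prob_space.distr_const prob_space_PiM) auto

text \<open>Each induction step removes the last row and one entry of every other row. Row l has l
  entries left when it becomes the last one, hence \<open>norm_law\<close> at dimension l. For N = 0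
  both sides are the point mass at 1.\<close>

lemma distr_abs_det_sq_row_laws:
  assumes b: "b \<in> {1, 2, 4}" and P: "\<And>l. l \<in> {1..N} \<Longrightarrow> radial_family b N (P l)"
  shows "distr (Pi\<^sub>M {1..N} (\<lambda>l. row_law b N (P l N))) borel (abs_det_sq b N) =
         product_law {1..N} (\<lambda>l. norm_law b l (P l))"
  using P
proof (induction N)
  case 0
  have "abs_det_sq b 0 x = 1" for x
    by (simp add: abs_det_sq_cmatrix[OF b] det_dim_zero[of "cmatrix b 0 x"] cmatrix_def block_size_def)
  thus ?case by (simp add: product_law_def distr_PiM_empty_const)
next
  case (Suc N)
  have b0: "b > 0" using b by auto
  let ?L = "{1..N}" and ?l = "Suc N"
  have ins: "insert ?l ?L = {1..Suc N}" by auto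
  let ?\<mu> = "\<lambda>l. row_law b (Suc N) (P l (Suc N))"
  let ?\<mu>' = "\<lambda>l. row_law b N (P l N)"
  let ?\<kappa> = "\<lambda>l. norm_law b l (P l)"
  let ?R = "row_space b (Suc N)" and ?R' = "row_space b N"
  have rf: "radial_family b (Suc N) (P l)" if "l \<in> insert ?l ?L" for l
    using Suc.prems that by auto
  have prob: "prob_space (?\<mu> l)" "prob_space (?\<kappa> l)" if "l \<in> insert ?l ?L" for l
    using that by (auto intro!: prob_space_row_law[OF b0 rf[OF that]] prob_space_norm_law[OF b0 rf[OF that]])
  have prob': "prob_space (?\<mu>' l)" if "l \<in> ?L" for l
    using that by (intro prob_space_row_law[OF b0 rf]) auto
  have IH: "distr (Pi\<^sub>M ?L ?\<mu>') borel (abs_det_sq b N) = product_law ?L ?\<kappa>"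
    using radial_family_mono[OF rf] by (intro Suc.IH) auto
  have setsP: "sets (Pi\<^sub>M J ?\<mu>) = sets (Pi\<^sub>M J (\<lambda>_. ?R))" "sets (Pi\<^sub>M J ?\<mu>') = sets (Pi\<^sub>M J (\<lambda>_. ?R'))" for J
    by (auto intro!: sets_PiM_cong)
  have D[measurable]: "abs_det_sq b (Suc N) \<in> borel_measurable (Pi\<^sub>M (insert ?l ?L) ?\<mu>)"
    unfolding measurable_cong_sets[OF setsP(1) refl]
    by (rule abs_det_sq_measurable[OF b]) auto
  have D'[measurable]: "abs_det_sq b N \<in> borel_measurable (Pi\<^sub>M ?L ?\<mu>')"
    unfolding measurable_cong_sets[OF setsP(2) refl]
    by (rule abs_det_sq_measurable[OF b]) auto
  note prod_coordinates_measurable[of "insert ?l ?L" ?\<kappa>, measurable]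
  note prod_coordinates_measurable[of ?L ?\<kappa>, measurable]
  show ?case
  proof (rule measure_eqI)
    fix A :: "real set" assume "A \<in> sets (distr (Pi\<^sub>M {1..Suc N} ?\<mu>) borel (abs_det_sq b (Suc N)))"
    hence [measurable]: "A \<in> sets borel" by simp
    define g where "g = (indicator A :: real \<Rightarrow> ennreal)"
    have g[measurable]: "g \<in> borel_measurable borel" by (simp add: g_def)
    \<comment> \<open>\<open>x\<close> is a constant here, so the rotation chosen for it below is
      one fixed map applied to the other rows; the outcome involves \<open>x\<close> through its
      norm alone.\<close>
    have inner: "(\<integral>\<^sup>+r. g (abs_det_sq b (Suc N) (r(?l := x))) \<partial>Pi\<^sub>M ?L ?\<mu>) =
        (\<integral>\<^sup>+z. g (row_norm_sq b (Suc N) x * (\<Prod>l\<in>?L. z l)) \<partial>Pi\<^sub>M ?L ?\<kappa>)" for x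
    proof -
      obtain T where T: "preserves_lebesgue ({..<Suc N} \<times> {..<b}) T"
        "\<And>y. row_norm_sq b (Suc N) (T y) = row_norm_sq b (Suc N) y"
        "\<And>j k. j < N \<Longrightarrow> k < b \<Longrightarrow> T x (j, k) = 0"
        "\<And>x. abs_det_sq b (Suc N) (\<lambda>l. T (x l)) = abs_det_sq b (Suc N) x"
        by (rule obtain_row_rotation[OF b, of N x]) (rule that)
      let ?c = "\<lambda>v :: nat \<times> nat \<Rightarrow> real. restrict v ({..<N} \<times> {..<b})"
      \<comment> \<open>Rotation followed by dropping the last entry: the rotation keeps the radial
        law, the restriction passes to its marginal.\<close>
      define S where "S = (\<lambda>v. ?c (T v))"
      have Pm: "P l (Suc N) \<in> borel_measurable borel" if "l \<in> ?L" for l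
        using rf[of l] that by (auto simp: radial_family_def)
      have Tm[measurable]: "T \<in> measurable ?R ?R"
        by (rule row_law_rotation(1)[OF _ T(1,2), of "\<lambda>_. 0"]) auto
      note restrict_row_measurable[measurable]
      have S: "S \<in> measurable (?\<mu> l) (?\<mu>' l)" for l unfolding S_def by measurable
      have Sl: "distr (?\<mu> l) (?\<mu>' l) S = ?\<mu>' l" if l: "l \<in> ?L" for l
      proof -
        have "distr (?\<mu> l) (?\<mu>' l) S = distr (?\<mu> l) ?R' (?c \<circ> T)"
          by (rule distr_cong) (auto simp: S_def)
        also have "\<dots> = distr (distr (?\<mu> l) ?R T) ?R' ?c"
          by (rule distr_distr[symmetric]) measurable
        also have "\<dots> = distr (?\<mu> l) ?R' ?c"
          by (simp add: row_law_rotation(2)[OF Pm[OF l] T(1,2)])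
        also have "\<dots> = ?\<mu>' l"
          using l by (intro row_law_marginal[OF b0 rf]) auto
        finally show ?thesis .
      qed
      have "abs_det_sq b (Suc N) (r(?l := x)) = row_norm_sq b (Suc N) x * abs_det_sq b N (compose ?L S r)" for r
      proof -
        have "abs_det_sq b (Suc N) (r(?l := x)) = abs_det_sq b (Suc N) (\<lambda>l. T ((r(?l := x)) l))"
          by (rule T(4)[symmetric])
        also have "\<dots> = row_norm_sq b (Suc N) (T x) * abs_det_sq b N (\<lambda>l. T ((r(?l := x)) l))"
          using T(3) by (subst abs_det_sq_last_row[OF b]) auto
        also have "abs_det_sq b N (\<lambda>l. T ((r(?l := x)) l)) = abs_det_sq b N (compose ?L S r)"
          by (rule abs_det_sq_cong[OF b]) (auto simp: compose_def S_def)
        finally show ?thesis by (simp only: T(2))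
      qed
      hence "(\<integral>\<^sup>+r. g (abs_det_sq b (Suc N) (r(?l := x))) \<partial>Pi\<^sub>M ?L ?\<mu>) =
        (\<integral>\<^sup>+r. g (row_norm_sq b (Suc N) x * abs_det_sq b N (compose ?L S r)) \<partial>Pi\<^sub>M ?L ?\<mu>)"
        by simp
      also have "\<dots> = (\<integral>\<^sup>+q. g (row_norm_sq b (Suc N) x * abs_det_sq b N q) \<partial>distr (Pi\<^sub>M ?L ?\<mu>) (Pi\<^sub>M ?L ?\<mu>') (compose ?L S))"
      proof (rule nn_integral_distr[symmetric])
        show "compose ?L S \<in> measurable (Pi\<^sub>M ?L ?\<mu>) (Pi\<^sub>M ?L ?\<mu>')"
          unfolding compose_def
          by (rule measurable_restrict, rule measurable_compose[OF _ S], rule measurable_component_singleton)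
      qed measurable
      also have "distr (Pi\<^sub>M ?L ?\<mu>) (Pi\<^sub>M ?L ?\<mu>') (compose ?L S) = Pi\<^sub>M ?L (\<lambda>l. distr (?\<mu> l) (?\<mu>' l) S)"
        using prob prob' S by (intro distr_PiM_finite_prob_space') auto
      also have "\<dots> = Pi\<^sub>M ?L ?\<mu>'" by (intro PiM_cong Sl) auto
      also have "(\<integral>\<^sup>+q. g (row_norm_sq b (Suc N) x * abs_det_sq b N q) \<partial>Pi\<^sub>M ?L ?\<mu>') =
        (\<integral>\<^sup>+z. g (row_norm_sq b (Suc N) x * z) \<partial>distr (Pi\<^sub>M ?L ?\<mu>') borel (abs_det_sq b N))"
        by (rule nn_integral_distr[symmetric]) measurable
      also have "\<dots> = (\<integral>\<^sup>+z. g (row_norm_sq b (Suc N) x * (\<Prod>l\<in>?L. z l)) \<partial>Pi\<^sub>M ?L ?\<kappa>)"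
        unfolding IH product_law_def by (rule nn_integral_distr) measurable
      finally show ?thesis .
    qed
    have sf: "sigma_finite_measure (Pi\<^sub>M ?L ?\<kappa>)"
      using prob by (intro prob_space_imp_sigma_finite prob_space_PiM) auto
    have "emeasure (distr (Pi\<^sub>M {1..Suc N} ?\<mu>) borel (abs_det_sq b (Suc N))) A =
        (\<integral>\<^sup>+y. g y \<partial>distr (Pi\<^sub>M (insert ?l ?L) ?\<mu>) borel (abs_det_sq b (Suc N)))"
      unfolding ins by (simp add: g_def)
    also have "\<dots> = (\<integral>\<^sup>+x. g (abs_det_sq b (Suc N) x) \<partial>Pi\<^sub>M (insert ?l ?L) ?\<mu>)"
      by (rule nn_integral_distr) measurable
    also have "\<dots> = (\<integral>\<^sup>+x. \<integral>\<^sup>+r. g (abs_det_sq b (Suc N) (r(?l := x))) \<partial>Pi\<^sub>M ?L ?\<mu> \<partial>?\<mu> ?l)"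
      by (rule nn_integral_PiM_insert_prob) (simp, simp, erule prob, measurable)
    also have "\<dots> = (\<integral>\<^sup>+x. \<integral>\<^sup>+z. g (row_norm_sq b (Suc N) x * (\<Prod>l\<in>?L. z l)) \<partial>Pi\<^sub>M ?L ?\<kappa> \<partial>?\<mu> ?l)"
      by (simp only: inner)
    \<comment> \<open>The last row enters by its squared norm only, so the outer integral moves to
      the law of that norm.\<close>
    also have "\<dots> = (\<integral>\<^sup>+y. \<integral>\<^sup>+z. g (y * (\<Prod>l\<in>?L. z l)) \<partial>Pi\<^sub>M ?L ?\<kappa> \<partial>?\<kappa> ?l)"
      unfolding norm_law_def[of b ?l]
      by (rule nn_integral_distr[symmetric])
         (measurable, intro sigma_finite_measure.borel_measurable_nn_integral[OF sf], measurable)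
    also have "\<dots> = (\<integral>\<^sup>+y. \<integral>\<^sup>+z. g (\<Prod>l\<in>insert ?l ?L. (z(?l := y)) l) \<partial>Pi\<^sub>M ?L ?\<kappa> \<partial>?\<kappa> ?l)"
    proof -
      have "(\<Prod>l\<in>insert ?l ?L. (z(?l := y)) l) = y * (\<Prod>l\<in>?L. z l)" for z and y :: real
      proof -
        have "(\<Prod>l\<in>?L. (z(?l := y)) l) = (\<Prod>l\<in>?L. z l)" by (intro prod.cong) auto
        thus ?thesis by (subst prod.insert) auto
      qed
      thus ?thesis by (simp only:)
    qed
    also have "\<dots> = (\<integral>\<^sup>+z. g (\<Prod>l\<in>insert ?l ?L. z l) \<partial>Pi\<^sub>M (insert ?l ?L) ?\<kappa>)"
      by (rule nn_integral_PiM_insert_prob[symmetric]) (simp, simp, erule prob, measurable)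
    also have "\<dots> = (\<integral>\<^sup>+y. g y \<partial>product_law {1..Suc N} ?\<kappa>)"
      unfolding product_law_def ins[symmetric] by (rule nn_integral_distr[symmetric]) measurable
    also have "\<dots> = emeasure (product_law {1..Suc N} ?\<kappa>) A"
      by (simp add: g_def product_law_def)
    finally show "emeasure (distr (Pi\<^sub>M {1..Suc N} ?\<mu>) borel (abs_det_sq b (Suc N))) A =
      emeasure (product_law {1..Suc N} ?\<kappa>) A" .
  qed (simp add: product_law_def)
qed

text \<open>Reversing the rows changes the determinant by a factor of modulus 1, so the direct
  pairing applies to the reversed family; reindexing the product by the same involution then pairs
  the family of row l with dimension N + 1 - l.\<close>

lemma distr_abs_det_sq_row_laws_reversed:
  assumes b: "b \<in> {1, 2, 4}" and P: "\<And>l. l \<in> {1..N} \<Longrightarrow> radial_family b N (P l)"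
  shows "distr (Pi\<^sub>M {1..N} (\<lambda>l. row_law b N (P l N))) borel (abs_det_sq b N) =
         product_law {1..N} (\<lambda>l. norm_law b (Suc N - l) (P l))"
proof -
  have b0: "b > 0" using b by auto
  let ?L = "{1..N}" and ?r = "\<lambda>l. Suc N - l"
  let ?\<mu> = "\<lambda>l. row_law b N (P l N)" and ?\<kappa> = "\<lambda>l. norm_law b (Suc N - l) (P l)"
  have r: "inj_on ?r ?L" "?r \<in> ?L \<rightarrow> ?L" by (auto simp: inj_on_def)
  have bij: "bij_betw ?r ?L ?L"
    by (rule bij_betw_byWitness[where f' = ?r]) auto
  have prob: "prob_space (?\<mu> l)" "prob_space (?\<kappa> l)" if "l \<in> ?L" for l
    using that by (auto intro!: prob_space_row_law[OF b0 P] prob_space_norm_law[OF b0 P])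
  have D: "abs_det_sq b N \<in> borel_measurable (Pi\<^sub>M ?L K)" if "\<And>l. sets (K l) = sets (row_space b N)" for K
  proof -
    have "sets (Pi\<^sub>M ?L K) = sets (Pi\<^sub>M ?L (\<lambda>_. row_space b N))" by (intro sets_PiM_cong that refl)
    thus ?thesis using abs_det_sq_measurable[OF b order_refl] measurable_cong_sets[OF _ refl] by blast
  qed
  have "distr (Pi\<^sub>M ?L ?\<mu>) borel (abs_det_sq b N) =
        distr (Pi\<^sub>M ?L ?\<mu>) borel (abs_det_sq b N \<circ> (\<lambda>\<omega>. \<lambda>l\<in>?L. \<omega> (?r l)))"
  proof (rule distr_cong[OF refl refl])
    fix x
    have "abs_det_sq b N (\<lambda>l\<in>?L. x (?r l)) = abs_det_sq b N (\<lambda>l. x (?r l))"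
      by (rule abs_det_sq_cong[OF b]) auto
    thus "abs_det_sq b N x = (abs_det_sq b N \<circ> (\<lambda>\<omega>. \<lambda>l\<in>?L. \<omega> (?r l))) x"
      by (simp add: abs_det_sq_reverse[OF b])
  qed
  also have "\<dots> = distr (distr (Pi\<^sub>M ?L ?\<mu>) (Pi\<^sub>M ?L (\<lambda>l. ?\<mu> (?r l))) (\<lambda>\<omega>. \<lambda>l\<in>?L. \<omega> (?r l))) borel (abs_det_sq b N)"
  proof (rule distr_distr[symmetric])
    show "(\<lambda>\<omega>. \<lambda>l\<in>?L. \<omega> (?r l)) \<in> measurable (Pi\<^sub>M ?L ?\<mu>) (Pi\<^sub>M ?L (\<lambda>l. ?\<mu> (?r l)))"
      using r(2) by (intro measurable_restrict measurable_component_singleton) auto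
  qed (rule D, simp)
  also have "\<dots> = distr (Pi\<^sub>M ?L (\<lambda>l. ?\<mu> (?r l))) borel (abs_det_sq b N)"
    using r prob by (subst distr_PiM_reindex) auto
  also have "\<dots> = product_law ?L (\<lambda>l. norm_law b l (P (?r l)))"
    using r(2) by (intro distr_abs_det_sq_row_laws[OF b, of N "\<lambda>l. P (?r l)"] P) auto
  also have "\<dots> = distr (Pi\<^sub>M ?L (\<lambda>l. ?\<kappa> (?r l))) borel (\<lambda>y. \<Prod>l\<in>?L. y l)"
    unfolding product_law_def by (intro arg_cong2[where f = "\<lambda>A. distr A borel"] PiM_cong refl) auto
  also have "\<dots> = distr (distr (Pi\<^sub>M ?L ?\<kappa>) (Pi\<^sub>M ?L (\<lambda>l. ?\<kappa> (?r l))) (\<lambda>\<omega>. \<lambda>l\<in>?L. \<omega> (?r l))) borel (\<lambda>y. \<Prod>l\<in>?L. y l)"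
    using r prob by (subst distr_PiM_reindex) auto
  also have "\<dots> = distr (Pi\<^sub>M ?L ?\<kappa>) borel ((\<lambda>y. \<Prod>l\<in>?L. y l) \<circ> (\<lambda>\<omega>. \<lambda>l\<in>?L. \<omega> (?r l)))"
  proof (rule distr_distr)
    show "(\<lambda>\<omega>. \<lambda>l\<in>?L. \<omega> (?r l)) \<in> measurable (Pi\<^sub>M ?L ?\<kappa>) (Pi\<^sub>M ?L (\<lambda>l. ?\<kappa> (?r l)))"
      using r(2) by (intro measurable_restrict measurable_component_singleton) auto
  qed (rule prod_coordinates_measurable, simp)
  also have "\<dots> = product_law ?L ?\<kappa>"
    unfolding product_law_def
  proof (rule distr_cong[OF refl refl])
    fix y :: "nat \<Rightarrow> real"
    have "(\<Prod>l\<in>?L. y (?r l)) = (\<Prod>l\<in>?L. y l)"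
      by (rule prod.reindex_bij_betw[OF bij])
    thus "((\<lambda>y. \<Prod>l\<in>?L. y l) \<circ> (\<lambda>\<omega>. \<lambda>l\<in>?L. \<omega> (?r l))) y = (\<Prod>l\<in>?L. y l)" by simp
  qed
  finally show ?thesis .
qed

lemma distr_abs_det_sq_random:
  assumes M: "prob_space M" and b: "b \<in> {1, 2, 4}" and N: "N \<ge> 1"
    and indep: "prob_space.indep_vars M (\<lambda>_. row_space b N) x {1..N}"
    and dist: "\<And>l. l \<in> {1..N} \<Longrightarrow> distributed M (row_space b N) (x l) (\<lambda>v. P l N (row_norm_sq b N v))"
  shows "(\<lambda>w. abs_det_sq b N (\<lambda>l. x l w)) \<in> borel_measurable M"
    "distr M borel (\<lambda>w. abs_det_sq b N (\<lambda>l. x l w)) =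
     distr (Pi\<^sub>M {1..N} (\<lambda>l. row_law b N (P l N))) borel (abs_det_sq b N)"
proof -
  interpret prob_space M by fact
  let ?L = "{1..N}"
  let ?X = "\<lambda>w. \<lambda>l\<in>?L. x l w"
  have rv: "x l \<in> measurable M (row_space b N)" if "l \<in> ?L" for l
    using dist[OF that] by (simp add: distributed_def)
  have X: "?X \<in> measurable M (Pi\<^sub>M ?L (\<lambda>_. row_space b N))"
    by (rule measurable_restrict) (rule rv)
  note D = abs_det_sq_measurable[OF b order_refl]
  have eq: "(\<lambda>w. abs_det_sq b N (\<lambda>l. x l w)) = abs_det_sq b N \<circ> ?X"
    by (rule ext, unfold o_def, rule abs_det_sq_cong[OF b]) auto
  show "(\<lambda>w. abs_det_sq b N (\<lambda>l. x l w)) \<in> borel_measurable M"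
    unfolding eq by (rule measurable_comp[OF X D])
  have "distr M borel (\<lambda>w. abs_det_sq b N (\<lambda>l. x l w)) =
      distr (distr M (Pi\<^sub>M ?L (\<lambda>_. row_space b N)) ?X) borel (abs_det_sq b N)"
    unfolding eq by (rule distr_distr[OF D X, symmetric])
  also have "distr M (Pi\<^sub>M ?L (\<lambda>_. row_space b N)) ?X = Pi\<^sub>M ?L (\<lambda>l. distr M (row_space b N) (x l))"
    using indep rv N by (subst (asm) indep_vars_iff_distr_eq_PiM') auto
  also have "\<dots> = Pi\<^sub>M ?L (\<lambda>l. row_law b N (P l N))"
    using dist by (intro PiM_cong) (auto simp: distributed_def row_law_def)
  finally show "distr M borel (\<lambda>w. abs_det_sq b N (\<lambda>l. x l w)) =
    distr (Pi\<^sub>M ?L (\<lambda>l. row_law b N (P l N))) borel (abs_det_sq b N)" .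
qed

section \<open>Densities of squared norms, and moments of product laws\<close>

lemma norm_law_density:
  assumes bn: "b > 0" "n > 0" and f[measurable]: "P n \<in> borel_measurable borel"
  shows "norm_law b n P = density lborel (\<lambda>t. ennreal (sq_norm_density (b * n) t) * P n t)"
proof (rule measure_eqI)
  fix A assume "A \<in> sets (norm_law b n P)"
  hence [measurable]: "A \<in> sets borel" by simp
  let ?I = "{..<n} \<times> {..<b}"
  have ne: "?I \<noteq> {}" using bn by auto
  have "emeasure (norm_law b n P) A = (\<integral>\<^sup>+t. indicator A t \<partial>norm_law b n P)" by simp
  also have "\<dots> = (\<integral>\<^sup>+v. indicator A (row_norm_sq b n v) \<partial>row_law b n (P n))"
    unfolding norm_law_def by (rule nn_integral_distr) measurable
  also have "\<dots> = (\<integral>\<^sup>+v. P n (row_norm_sq b n v) * indicator A (row_norm_sq b n v) \<partial>row_space b n)"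
    unfolding row_law_def by (rule nn_integral_density) measurable
  also have "\<dots> = (\<integral>\<^sup>+t. ennreal (sq_norm_density (card ?I) t) * (P n t * indicator A t) \<partial>lborel)"
    unfolding row_space_def row_norm_sq_sum by (rule nn_integral_sum_squares) (use ne in auto)
  also have "\<dots> = (\<integral>\<^sup>+t. (ennreal (sq_norm_density (b * n) t) * P n t) * indicator A t \<partial>lborel)"
    by (simp add: mult.assoc mult.commute[of b])
  also have "\<dots> = emeasure (density lborel (\<lambda>t. ennreal (sq_norm_density (b * n) t) * P n t)) A"
    by (rule emeasure_density[symmetric]) measurable
  finally show "emeasure (norm_law b n P) A =
    emeasure (density lborel (\<lambda>t. ennreal (sq_norm_density (b * n) t) * P n t)) A" .
qed simp

text \<open>In \<open>[0, \<infinity>]\<close> the moment of the product is the product of the moments, none of which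
  vanishes; so if it is finite, all the factors are.\<close>

lemma expectation_powr_product_law:
  fixes m :: "nat \<Rightarrow> real"
  assumes M: "prob_space M" and D[measurable]: "D \<in> borel_measurable M"
    and law: "distr M borel D = product_law L K" and L: "finite L"
    and K: "\<And>l. l \<in> L \<Longrightarrow> prob_space (K l)" "\<And>l. l \<in> L \<Longrightarrow> sets (K l) = sets borel"
    and moment: "\<And>l. l \<in> L \<Longrightarrow> (\<integral>\<^sup>+y. ennreal (y powr \<alpha>) \<partial>K l) = ennreal (m l) \<or>
        (\<integral>\<^sup>+y. ennreal (y powr \<alpha>) \<partial>K l) = \<infinity>"
    and pos: "\<And>l. l \<in> L \<Longrightarrow> (\<integral>\<^sup>+y. ennreal (y powr \<alpha>) \<partial>K l) \<noteq> 0"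
    and int: "integrable M (\<lambda>w. D w powr \<alpha>)"
  shows "prob_space.expectation M (\<lambda>w. D w powr \<alpha>) = (\<Prod>l\<in>L. m l)"
proof -
  \<comment> \<open>A point mass outside \<open>L\<close>, since the product rule for integrals
    wants a probability measure at every index.\<close>
  define K' where "K' = (\<lambda>l. if l \<in> L then K l else return borel 0)"
  interpret K': product_prob_space K'
    by (rule product_prob_spaceI) (auto simp: K'_def intro!: K prob_space_return)
  have setsK': "sets (K' l) = sets borel" for l using K(2) by (simp add: K'_def)
  let ?I = "\<lambda>l. \<integral>\<^sup>+y. ennreal (y powr \<alpha>) \<partial>K l"
  have pw: "(\<lambda>y. ennreal (y powr \<alpha>)) \<in> borel_measurable (K' l)" for l
    unfolding measurable_cong_sets[OF setsK' refl] by measurable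
  note prod_coordinates_measurable[of L K', OF setsK', measurable]
  have "(\<integral>\<^sup>+w. ennreal (D w powr \<alpha>) \<partial>M) = (\<integral>\<^sup>+z. ennreal (z powr \<alpha>) \<partial>distr M borel D)"
    by (rule nn_integral_distr[symmetric]) measurable
  also have "distr M borel D = distr (Pi\<^sub>M L K') borel (\<lambda>y. \<Prod>l\<in>L. y l)"
    unfolding law product_law_def K'_def by (intro arg_cong2[where f = "\<lambda>A. distr A borel"] PiM_cong refl) auto
  also have "(\<integral>\<^sup>+z. ennreal (z powr \<alpha>) \<partial>\<dots>) = (\<integral>\<^sup>+y. ennreal ((\<Prod>l\<in>L. y l) powr \<alpha>) \<partial>Pi\<^sub>M L K')"
    by (rule nn_integral_distr) measurable
  also have "\<dots> = (\<integral>\<^sup>+y. (\<Prod>l\<in>L. ennreal (y l powr \<alpha>)) \<partial>Pi\<^sub>M L K')"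
    by (simp add: prod_powr_distrib prod_ennreal)
  also have "\<dots> = (\<Prod>l\<in>L. \<integral>\<^sup>+y. ennreal (y powr \<alpha>) \<partial>K' l)"
    by (rule K'.product_nn_integral_prod[OF L pw])
  also have "\<dots> = (\<Prod>l\<in>L. ?I l)" by (intro prod.cong) (auto simp: K'_def)
  finally have prod: "(\<integral>\<^sup>+w. ennreal (D w powr \<alpha>) \<partial>M) = (\<Prod>l\<in>L. ?I l)" .
  have E: "(\<integral>\<^sup>+w. ennreal (D w powr \<alpha>) \<partial>M) = ennreal (\<integral>w. D w powr \<alpha> \<partial>M)"
    by (rule nn_integral_eq_integral[OF int]) simp
  hence "(\<Prod>l\<in>L. ?I l) \<noteq> \<infinity>" using prod by simp
  hence fin: "?I l \<noteq> \<infinity>" if "l \<in> L" for l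
    using that pos L by (auto simp: ennreal_prod_eq_top)
  have m: "?I l = ennreal (m l)" if "l \<in> L" for l
    using moment[OF that] fin[OF that] by auto
  \<comment> \<open>\<open>ennreal\<close> sends negative numbers to 0, so a finite nonzero moment
    forces \<open>m l\<close> to be nonnegative.\<close>
  have m0: "m l \<ge> 0" if "l \<in> L" for l
    using m[OF that] pos[OF that] ennreal_neg[of "m l"] by (cases "m l \<ge> 0") auto
  have "ennreal (\<integral>w. D w powr \<alpha> \<partial>M) = ennreal (\<Prod>l\<in>L. m l)"
    using E prod m m0 by (simp add: prod_ennreal)
  thus ?thesis using m0 by (subst (asm) ennreal_inj) (auto intro!: prod_nonneg)
qed

text \<open>Shape \<open>a\<close> and scale \<open>s\<close>: the common form of the squared norm
  of a Gaussian row and of a scaled chi-squared variable.\<close>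

definition gamma_law :: "real \<Rightarrow> real \<Rightarrow> real measure" where
  "gamma_law a s = density lborel (\<lambda>t. ennreal (if 0 < t then
     s powr - a / Gamma a * (t powr (a - 1) * exp (- (t / s))) else 0))"

text \<open>The factor y^\<alpha> shifts the shape from a to a + \<alpha>; \<open>Gamma_nn\<close>
  keeps the identity true when the moment diverges.\<close>

lemma moment_gamma_law:
  assumes a: "a > 0" and s: "s > 0"
  shows "(\<integral>\<^sup>+y. ennreal (y powr \<alpha>) \<partial>gamma_law a s) = ennreal (s powr \<alpha> / Gamma a) * Gamma_nn (a + \<alpha>)"
proof -
  have G: "Gamma a > 0" using a by simp
  have "(\<integral>\<^sup>+y. ennreal (y powr \<alpha>) \<partial>gamma_law a s) =
    (\<integral>\<^sup>+t. ennreal (if 0 < t then s powr - a / Gamma a * (t powr (a - 1) * exp (- (t / s))) else 0) *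
       ennreal (t powr \<alpha>) \<partial>lborel)"
    unfolding gamma_law_def by (rule nn_integral_density) measurable
  also have "\<dots> = (\<integral>\<^sup>+t. ennreal (s powr - a / Gamma a) *
      ennreal (if 0 < t then t powr ((a + \<alpha>) - 1) * exp (- ((1 / s) * t)) else 0) \<partial>lborel)"
  proof (intro nn_integral_cong)
    fix t :: real
    have "t powr (a - 1) * t powr \<alpha> = t powr ((a + \<alpha>) - 1)" if "0 < t"
      unfolding powr_add[symmetric] by (simp add: algebra_simps)
    thus "ennreal (if 0 < t then s powr - a / Gamma a * (t powr (a - 1) * exp (- (t / s))) else 0) * ennreal (t powr \<alpha>) =
      ennreal (s powr - a / Gamma a) * ennreal (if 0 < t then t powr ((a + \<alpha>) - 1) * exp (- ((1 / s) * t)) else 0)"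
      using G by (auto simp: mult_ac simp flip: ennreal_mult)
  qed
  also have "\<dots> = ennreal (s powr - a / Gamma a) * (ennreal ((1 / s) powr - (a + \<alpha>)) * Gamma_nn (a + \<alpha>))"
    using s by (subst nn_integral_cmult) (measurable, simp add: Gamma_nn_scaled[of "1 / s" "a + \<alpha>", simplified])
  also have "\<dots> = ennreal (s powr - a / Gamma a * (1 / s) powr - (a + \<alpha>)) * Gamma_nn (a + \<alpha>)"
    using G by (subst ennreal_mult') (simp_all add: mult.assoc)
  also have "s powr - a / Gamma a * (1 / s) powr - (a + \<alpha>) = s powr - a * s powr (a + \<alpha>) / Gamma a"
  proof -
    have "1 / s = s powr -1" using s by (simp add: powr_minus_divide)
    hence "(1 / s) powr - (a + \<alpha>) = s powr (a + \<alpha>)" by (simp only: powr_powr) (simp add: add.commute)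
    thus ?thesis by simp
  qed
  also have "s powr - a * s powr (a + \<alpha>) = s powr \<alpha>"
    unfolding powr_add[symmetric] by simp
  finally show ?thesis .
qed

lemma moment_beta_law:
  assumes a: "a > 0" "b > 0"
  shows "(\<integral>\<^sup>+y. ennreal (y powr \<alpha>) \<partial>beta_law a b) = ennreal (1 / Beta a b) *
    (\<integral>\<^sup>+t. ennreal (if 0 < t \<and> t < 1 then t powr ((a + \<alpha>) - 1) * (1 - t) powr (b - 1) else 0) \<partial>lborel)"
proof -
  have B: "Beta a b > 0" using a by (simp add: Beta_def)
  have "(\<integral>\<^sup>+y. ennreal (y powr \<alpha>) \<partial>beta_law a b) =
    (\<integral>\<^sup>+t. ennreal (if 0 < t \<and> t < 1 then t powr (a - 1) * (1 - t) powr (b - 1) / Beta a b else 0) *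
       ennreal (t powr \<alpha>) \<partial>lborel)"
    unfolding beta_law_def by (rule nn_integral_density) measurable
  also have "\<dots> = (\<integral>\<^sup>+t. ennreal (1 / Beta a b) *
      ennreal (if 0 < t \<and> t < 1 then t powr ((a + \<alpha>) - 1) * (1 - t) powr (b - 1) else 0) \<partial>lborel)"
  proof (intro nn_integral_cong)
    fix t :: real
    have "t powr (a - 1) * t powr \<alpha> = t powr ((a + \<alpha>) - 1)" if "0 < t"
      unfolding powr_add[symmetric] by (simp add: algebra_simps)
    thus "ennreal (if 0 < t \<and> t < 1 then t powr (a - 1) * (1 - t) powr (b - 1) / Beta a b else 0) * ennreal (t powr \<alpha>) =
      ennreal (1 / Beta a b) * ennreal (if 0 < t \<and> t < 1 then t powr ((a + \<alpha>) - 1) * (1 - t) powr (b - 1) else 0)"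
      using B by (auto simp: mult_ac simp flip: ennreal_mult)
  qed
  also have "\<dots> = ennreal (1 / Beta a b) *
    (\<integral>\<^sup>+t. ennreal (if 0 < t \<and> t < 1 then t powr ((a + \<alpha>) - 1) * (1 - t) powr (b - 1) else 0) \<partial>lborel)"
    by (rule nn_integral_cmult) measurable
  finally show ?thesis .
qed

lemma moment_beta_prime_law:
  assumes a: "a > 0" "b > 0"
  shows "(\<integral>\<^sup>+y. ennreal (y powr \<alpha>) \<partial>beta_prime_law a b) =
    ennreal (1 / (Gamma a * Gamma b)) * (Gamma_nn (a + \<alpha>) * Gamma_nn (b - \<alpha>))"
proof -
  have G: "Gamma a > 0" "Gamma b > 0" "Gamma (a + b) > 0" using a by simp_all
  have "(\<integral>\<^sup>+y. ennreal (y powr \<alpha>) \<partial>beta_prime_law a b) =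
    (\<integral>\<^sup>+t. ennreal (if 0 < t then t powr (a - 1) / (1 + t) powr (a + b) / Beta a b else 0) *
       ennreal (t powr \<alpha>) \<partial>lborel)"
    unfolding beta_prime_law_def by (rule nn_integral_density) measurable
  also have "\<dots> = (\<integral>\<^sup>+t. ennreal (1 / Beta a b) *
      ennreal (if 0 < t then t powr ((a + \<alpha>) - 1) * (1 + t) powr - (a + b) else 0) \<partial>lborel)"
  proof (intro nn_integral_cong)
    fix t :: real
    have *: "t powr (a - 1) * t powr \<alpha> = t powr ((a + \<alpha>) - 1)" if "0 < t"
      unfolding powr_add[symmetric] by (simp add: algebra_simps)
    have "t powr (a - 1) / (1 + t) powr (a + b) / Beta a b * t powr \<alpha> =
        1 / Beta a b * (t powr ((a + \<alpha>) - 1) * (1 + t) powr - (a + b))" if "0 < t"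
      unfolding *[OF that, symmetric] powr_minus_divide[of _ "a + b"] by simp
    moreover have "0 < Beta a b" using G by (simp add: Beta_def)
    ultimately show "ennreal (if 0 < t then t powr (a - 1) / (1 + t) powr (a + b) / Beta a b else 0) * ennreal (t powr \<alpha>) =
      ennreal (1 / Beta a b) * ennreal (if 0 < t then t powr ((a + \<alpha>) - 1) * (1 + t) powr - (a + b) else 0)"
      by (cases "0 < t") (simp_all only: ennreal_mult[symmetric] if_True if_False ennreal_0 mult_zero_left
        mult_zero_right powr_ge_zero divide_nonneg_pos divide_nonneg_nonneg mult_nonneg_nonneg less_imp_le zero_le_one)
  qed
  also have "\<dots> = ennreal (1 / Beta a b) * (ennreal (1 / Gamma (a + b)) * (Gamma_nn (a + \<alpha>) * Gamma_nn (b - \<alpha>)))"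
  proof -
    have "(\<integral>\<^sup>+t. ennreal (if 0 < t then t powr ((a + \<alpha>) - 1) * (1 + t) powr - (a + b) else 0) \<partial>lborel) =
       ennreal (1 powr ((a + \<alpha>) - (a + b)) / Gamma (a + b)) * (Gamma_nn (a + \<alpha>) * Gamma_nn ((a + b) - (a + \<alpha>)))"
      using a by (intro Beta_prime_nn) auto
    hence "(\<integral>\<^sup>+t. ennreal (if 0 < t then t powr ((a + \<alpha>) - 1) * (1 + t) powr - (a + b) else 0) \<partial>lborel) =
       ennreal (1 / Gamma (a + b)) * (Gamma_nn (a + \<alpha>) * Gamma_nn (b - \<alpha>))"
      by simp
    moreover have "(\<integral>\<^sup>+t. ennreal (1 / Beta a b) *
        ennreal (if 0 < t then t powr ((a + \<alpha>) - 1) * (1 + t) powr - (a + b) else 0) \<partial>lborel) =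
      ennreal (1 / Beta a b) *
        (\<integral>\<^sup>+t. ennreal (if 0 < t then t powr ((a + \<alpha>) - 1) * (1 + t) powr - (a + b) else 0) \<partial>lborel)"
      by (rule nn_integral_cmult) measurable
    ultimately show ?thesis by (simp only:)
  qed
  also have "\<dots> = ennreal (1 / Beta a b * (1 / Gamma (a + b))) * (Gamma_nn (a + \<alpha>) * Gamma_nn (b - \<alpha>))"
    using a by (subst ennreal_mult') (simp_all only: mult.assoc Beta_def, simp)
  also have "1 / Beta a b * (1 / Gamma (a + b)) = 1 / (Gamma a * Gamma b)"
    using G(3) by (simp add: Beta_def)
  finally show ?thesis .
qed

section \<open>The three row densities\<close>

text \<open>The alternative is there because the Gamma quotient is a real number also for a +
  \<alpha> \<le> 0, where the moment is infinite. Together with nonvanishing it is what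
  \<open>expectation_powr_product_law\<close> asks of each factor.\<close>

lemma gamma_law_moment_cases:
  assumes a: "a > 0" and s: "s > 0"
  shows "(\<integral>\<^sup>+y. ennreal (y powr \<alpha>) \<partial>gamma_law a s) = ennreal (s powr \<alpha> * rpoch a \<alpha>) \<or>
         (\<integral>\<^sup>+y. ennreal (y powr \<alpha>) \<partial>gamma_law a s) = \<infinity>"
    "(\<integral>\<^sup>+y. ennreal (y powr \<alpha>) \<partial>gamma_law a s) \<noteq> 0"
proof -
  have G: "Gamma a > 0" using a by simp
  show "(\<integral>\<^sup>+y. ennreal (y powr \<alpha>) \<partial>gamma_law a s) \<noteq> 0"
    using G s by (simp add: moment_gamma_law[OF a s] Gamma_nn_eq_0 ennreal_eq_0_iff not_le)
  show "(\<integral>\<^sup>+y. ennreal (y powr \<alpha>) \<partial>gamma_law a s) = ennreal (s powr \<alpha> * rpoch a \<alpha>) \<or>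
         (\<integral>\<^sup>+y. ennreal (y powr \<alpha>) \<partial>gamma_law a s) = \<infinity>"
  proof (cases "a + \<alpha> > 0")
    case True
    thus ?thesis using G by (simp add: moment_gamma_law[OF a s] Gamma_nn_pos rpoch_def flip: ennreal_mult')
  next
    case False
    thus ?thesis using G s by (simp add: moment_gamma_law[OF a s] Gamma_nn_nonpos ennreal_mult_top)
  qed
qed

lemma beta_law_moment_cases:
  assumes a: "a > 0" "b > 0"
  shows "(\<integral>\<^sup>+y. ennreal (y powr \<alpha>) \<partial>beta_law a b) = ennreal (rpoch a \<alpha> / rpoch (a + b) \<alpha>) \<or>
         (\<integral>\<^sup>+y. ennreal (y powr \<alpha>) \<partial>beta_law a b) = \<infinity>"
    "(\<integral>\<^sup>+y. ennreal (y powr \<alpha>) \<partial>beta_law a b) \<noteq> 0"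
proof -
  have G: "Gamma a > 0" "Gamma b > 0" "Gamma (a + b) > 0" using a by simp_all
  have B: "Beta a b > 0" using G by (simp add: Beta_def)
  have *: "((\<integral>\<^sup>+y. ennreal (y powr \<alpha>) \<partial>beta_law a b) = ennreal (rpoch a \<alpha> / rpoch (a + b) \<alpha>) \<or>
         (\<integral>\<^sup>+y. ennreal (y powr \<alpha>) \<partial>beta_law a b) = \<infinity>) \<and>
         (\<integral>\<^sup>+y. ennreal (y powr \<alpha>) \<partial>beta_law a b) \<noteq> 0"
  proof (cases "a + \<alpha> > 0")
    case True
    have G': "Gamma (a + \<alpha>) > 0" "Gamma (a + \<alpha> + b) > 0" using True a by simp_all
    have "(\<integral>\<^sup>+y. ennreal (y powr \<alpha>) \<partial>beta_law a b) = ennreal (1 / Beta a b) * ennreal (Beta (a + \<alpha>) b)"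
      using True a by (simp add: moment_beta_law[OF a] Beta_nn)
    also have "\<dots> = ennreal (1 / Beta a b * Beta (a + \<alpha>) b)"
      using B by (subst ennreal_mult') simp_all
    also have "1 / Beta a b * Beta (a + \<alpha>) b = rpoch a \<alpha> / rpoch (a + b) \<alpha>"
      using G by (simp add: Beta_def rpoch_def add_ac)
    finally have eq: "(\<integral>\<^sup>+y. ennreal (y powr \<alpha>) \<partial>beta_law a b) = ennreal (rpoch a \<alpha> / rpoch (a + b) \<alpha>)" .
    have "rpoch a \<alpha> / rpoch (a + b) \<alpha> > 0"
      using G G' by (simp add: rpoch_def add_ac)
    thus ?thesis using eq by (simp add: ennreal_eq_0_iff not_le)
  next
    case False
    thus ?thesis using B a by (simp add: moment_beta_law[OF a] Beta_nn_infinite ennreal_mult_top)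
  qed
  from * show "(\<integral>\<^sup>+y. ennreal (y powr \<alpha>) \<partial>beta_law a b) = ennreal (rpoch a \<alpha> / rpoch (a + b) \<alpha>) \<or>
         (\<integral>\<^sup>+y. ennreal (y powr \<alpha>) \<partial>beta_law a b) = \<infinity>"
    "(\<integral>\<^sup>+y. ennreal (y powr \<alpha>) \<partial>beta_law a b) \<noteq> 0" by blast+
qed

lemma beta_prime_law_moment_cases:
  assumes a: "a > 0" "b > 0"
  shows "(\<integral>\<^sup>+y. ennreal (y powr \<alpha>) \<partial>beta_prime_law a b) = ennreal (rpoch a \<alpha> * rpoch b (- \<alpha>)) \<or>
         (\<integral>\<^sup>+y. ennreal (y powr \<alpha>) \<partial>beta_prime_law a b) = \<infinity>"
    "(\<integral>\<^sup>+y. ennreal (y powr \<alpha>) \<partial>beta_prime_law a b) \<noteq> 0"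
proof -
  have G: "1 / (Gamma a * Gamma b) > 0" using a by simp
  show "(\<integral>\<^sup>+y. ennreal (y powr \<alpha>) \<partial>beta_prime_law a b) \<noteq> 0"
    using G by (simp add: moment_beta_prime_law[OF a] Gamma_nn_eq_0 ennreal_eq_0_iff not_le)
  show "(\<integral>\<^sup>+y. ennreal (y powr \<alpha>) \<partial>beta_prime_law a b) = ennreal (rpoch a \<alpha> * rpoch b (- \<alpha>)) \<or>
         (\<integral>\<^sup>+y. ennreal (y powr \<alpha>) \<partial>beta_prime_law a b) = \<infinity>"
  proof (cases "a + \<alpha> > 0 \<and> b - \<alpha> > 0")
    case True
    hence "Gamma (a + \<alpha>) > 0" "Gamma (b - \<alpha>) > 0" by simp_all
    hence "(\<integral>\<^sup>+y. ennreal (y powr \<alpha>) \<partial>beta_prime_law a b) =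
       ennreal (1 / (Gamma a * Gamma b) * (Gamma (a + \<alpha>) * Gamma (b - \<alpha>)))"
      using True G by (simp add: moment_beta_prime_law[OF a] Gamma_nn_pos ennreal_mult'[OF less_imp_le[OF G]]
          ennreal_mult'[of "Gamma (a + \<alpha>)"] del: times_divide_eq_left)
    thus ?thesis by (simp add: rpoch_def)
  next
    case False
    hence "Gamma_nn (a + \<alpha>) = \<infinity> \<or> Gamma_nn (b - \<alpha>) = \<infinity>"
      using Gamma_nn_nonpos by (meson not_less)
    \<comment> \<open>Neither factor is 0, so one infinite factor makes the product
      infinite.\<close>
    hence "Gamma_nn (a + \<alpha>) * Gamma_nn (b - \<alpha>) = \<infinity>"
      by (auto simp: ennreal_mult_eq_top_iff Gamma_nn_eq_0)
    moreover have "ennreal (1 / (Gamma a * Gamma b)) \<noteq> 0"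
      using G by (simp only: ennreal_eq_0_iff not_le)
    ultimately show ?thesis by (simp only: moment_beta_prime_law[OF a] ennreal_mult_eq_top_iff infinity_ennreal_def) simp
  qed
qed

section \<open>The Gaussian weight\<close>

definition gauss_family :: "nat \<Rightarrow> real \<Rightarrow> nat \<Rightarrow> real \<Rightarrow> ennreal" where
  "gauss_family b s n t =
     ennreal ((2 * pi * s\<^sup>2) powr (- (real b * real n / 2)) * exp (- t / (2 * s\<^sup>2)))"

lemma gauss_family_measurable [measurable]: "gauss_family b s n \<in> borel_measurable borel"
  unfolding gauss_family_def[abs_def] by measurable

text \<open>Each entry integrated out contributes (2 pi s^2)^(b/2), which lowers the dimension in
  the constant by one entry.\<close>

lemma radial_family_gauss:
  assumes b: "b > 0" and s: "s > 0"
  shows "radial_family b N (gauss_family b s)"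
  unfolding radial_family_def
proof (intro conjI allI impI)
  show "gauss_family b s n \<in> borel_measurable borel" for n by measurable
  show "gauss_family b s 0 0 = 1" using s by (simp add: gauss_family_def)
  fix n t
  let ?v = "2 * pi * s\<^sup>2" and ?a = "real b / 2"
  define C where "C = pi powr ?a / Gamma ?a * (?v powr (- (real b * real (Suc n) / 2)) * exp (- t / (2 * s\<^sup>2)))"
  have a: "?a > 0" using b by simp
  have G: "Gamma ?a > 0" using a by simp
  have C: "C \<ge> 0" using G by (simp add: C_def)
  have "(\<integral>\<^sup>+u. ennreal (sq_norm_density b u) * gauss_family b s (Suc n) (t + u) \<partial>lborel) =
     (\<integral>\<^sup>+u. ennreal C * ennreal (if 0 < u then u powr (?a - 1) * exp (- (1 / (2 * s\<^sup>2) * u)) else 0) \<partial>lborel)"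
  proof (intro nn_integral_cong)
    fix u :: real
    have "exp (- (t + u) / (2 * s\<^sup>2)) = exp (- t / (2 * s\<^sup>2)) * exp (- (1 / (2 * s\<^sup>2) * u))"
      unfolding exp_add[symmetric] by (simp add: add_divide_distrib diff_divide_distrib)
    hence "ennreal (pi powr ?a / Gamma ?a * u powr (?a - 1)) * gauss_family b s (Suc n) (t + u) =
       ennreal C * ennreal (u powr (?a - 1) * exp (- (1 / (2 * s\<^sup>2) * u)))"
      unfolding gauss_family_def C_def using G by (subst (1 2) ennreal_mult[symmetric]) (simp_all add: mult_ac)
    thus "ennreal (sq_norm_density b u) * gauss_family b s (Suc n) (t + u) =
       ennreal C * ennreal (if 0 < u then u powr (?a - 1) * exp (- (1 / (2 * s\<^sup>2) * u)) else 0)"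
      by (simp add: sq_norm_density_def)
  qed
  also have "\<dots> = ennreal C * (\<integral>\<^sup>+u. ennreal (if 0 < u then u powr (?a - 1) * exp (- (1 / (2 * s\<^sup>2) * u)) else 0) \<partial>lborel)"
    by (rule nn_integral_cmult) measurable
  also have "\<dots> = ennreal C * (ennreal ((1 / (2 * s\<^sup>2)) powr - ?a) * ennreal (Gamma ?a))"
    using s a by (subst Gamma_nn_scaled) (simp_all add: Gamma_nn_pos)
  also have "\<dots> = ennreal (C * ((1 / (2 * s\<^sup>2)) powr - ?a * Gamma ?a))"
    using C G by (simp only: ennreal_mult[symmetric] powr_ge_zero less_imp_le mult_nonneg_nonneg)
  also have "C * ((1 / (2 * s\<^sup>2)) powr - ?a * Gamma ?a) =
      ?v powr (- (real b * real n / 2)) * exp (- t / (2 * s\<^sup>2))"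
  proof -
    have "1 / (2 * s\<^sup>2) = (2 * s\<^sup>2) powr -1" using s by (simp add: powr_minus_divide)
    hence "(1 / (2 * s\<^sup>2)) powr - ?a = (2 * s\<^sup>2) powr ?a" by (simp only: powr_powr) simp
    hence "pi powr ?a * (1 / (2 * s\<^sup>2)) powr - ?a = ?v powr ?a"
      using powr_mult[of pi "2 * s\<^sup>2" ?a] by (simp add: mult_ac)
    moreover have "?v powr ?a * ?v powr (- (real b * real (Suc n) / 2)) = ?v powr (- (real b * real n / 2))"
      unfolding powr_add[symmetric] by (simp add: field_simps)
    moreover have "C * ((1 / (2 * s\<^sup>2)) powr - ?a * Gamma ?a) = (pi powr ?a * (1 / (2 * s\<^sup>2)) powr - ?a) *
        ?v powr (- (real b * real (Suc n) / 2)) * exp (- t / (2 * s\<^sup>2))"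
      using G by (simp add: C_def mult_ac)
    ultimately show ?thesis by (simp only:)
  qed
  finally show "(\<integral>\<^sup>+u. ennreal (sq_norm_density b u) * gauss_family b s (Suc n) (t + u) \<partial>lborel) =
    gauss_family b s n t" by (simp only: gauss_family_def)
qed

lemma norm_law_gauss:
  assumes "b > 0" "n > 0" and s: "s > 0"
  shows "norm_law b n (gauss_family b s) = gamma_law (real (b * n) / 2) (2 * s\<^sup>2)"
proof -
  let ?a = "real (b * n) / 2"
  have G: "Gamma ?a > 0" using assms by simp
  have "ennreal (sq_norm_density (b * n) t) * gauss_family b s n t =
        ennreal (if 0 < t then (2 * s\<^sup>2) powr - ?a / Gamma ?a * (t powr (?a - 1) * exp (- (t / (2 * s\<^sup>2)))) else 0)" for t
  proof (cases "t > 0")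
    case True
    have v: "(2 * pi * s\<^sup>2) powr - ?a = pi powr - ?a * (2 * s\<^sup>2) powr - ?a"
      using powr_mult[of pi "2 * s\<^sup>2" "- ?a"] by (simp add: mult_ac)
    have "pi powr ?a * pi powr - ?a = 1" by (simp add: powr_minus)
    hence "pi powr ?a / Gamma ?a * t powr (?a - 1) * ((2 * pi * s\<^sup>2) powr - ?a * exp (- t / (2 * s\<^sup>2))) =
       (2 * s\<^sup>2) powr - ?a / Gamma ?a * (t powr (?a - 1) * exp (- (t / (2 * s\<^sup>2))))"
      unfolding v by (simp add: mult_ac)
    thus ?thesis using True G
      by (simp add: sq_norm_density_def gauss_family_def flip: ennreal_mult)
  qed (simp add: sq_norm_density_def)
  thus ?thesis
    by (simp only: norm_law_density[OF assms(1,2) gauss_family_measurable] gamma_law_def)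
qed

text \<open>It suffices to compare the measures on boxes, where the indicator and the density both
  factor.\<close>

lemma PiM_density_lborel:
  fixes f :: "real \<Rightarrow> ennreal"
  assumes I: "finite I" and f[measurable]: "f \<in> borel_measurable borel" and p: "prob_space (density lborel f)"
  shows "Pi\<^sub>M I (\<lambda>_. density lborel f) = density (Pi\<^sub>M I (\<lambda>_. lborel)) (\<lambda>z. \<Prod>i\<in>I. f (z i))"
proof (rule sym)
  interpret L: product_sigma_finite "\<lambda>_ :: 'a. lborel :: real measure" ..
  interpret F: product_prob_space "\<lambda>_ :: 'a. density lborel f"
    by (rule product_prob_spaceI) (rule p)
  show "density (Pi\<^sub>M I (\<lambda>_. lborel)) (\<lambda>z. \<Prod>i\<in>I. f (z i)) = Pi\<^sub>M I (\<lambda>_. density lborel f)"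
  proof (rule F.PiM_eqI[OF I])
    show "sets (density (Pi\<^sub>M I (\<lambda>_. lborel)) (\<lambda>z. \<Prod>i\<in>I. f (z i))) = sets (Pi\<^sub>M I (\<lambda>_. density lborel f))"
      by (simp cong: sets_PiM_cong)
    fix A assume "\<And>i. i \<in> I \<Longrightarrow> A i \<in> sets (density lborel f)"
    hence A: "A i \<in> sets borel" if "i \<in> I" for i using that by simp
    have "emeasure (density (Pi\<^sub>M I (\<lambda>_. lborel)) (\<lambda>z. \<Prod>i\<in>I. f (z i))) (Pi\<^sub>E I A) =
       (\<integral>\<^sup>+z. (\<Prod>i\<in>I. f (z i)) * indicator (Pi\<^sub>E I A) z \<partial>Pi\<^sub>M I (\<lambda>_. lborel))"
      using I A by (intro emeasure_density sets_PiM_I_finite) auto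
    also have "\<dots> = (\<integral>\<^sup>+z. (\<Prod>i\<in>I. f (z i) * indicator (A i) (z i)) \<partial>Pi\<^sub>M I (\<lambda>_. lborel))"
    proof (rule nn_integral_cong)
      fix z assume "z \<in> space (Pi\<^sub>M I (\<lambda>_. lborel :: real measure))"
      hence "indicator (Pi\<^sub>E I A) z = (\<Prod>i\<in>I. indicator (A i) (z i) :: ennreal)"
        using I by (auto simp: indicator_def space_PiM PiE_iff prod.neutral intro: prod_zero)
      thus "(\<Prod>i\<in>I. f (z i)) * indicator (Pi\<^sub>E I A) z = (\<Prod>i\<in>I. f (z i) * indicator (A i) (z i))"
        by (simp add: prod.distrib)
    qed
    also have "\<dots> = (\<Prod>i\<in>I. \<integral>\<^sup>+t. f t * indicator (A i) t \<partial>lborel)"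
      using I A by (intro L.product_nn_integral_prod) auto
    also have "\<dots> = (\<Prod>i\<in>I. emeasure (density lborel f) (A i))"
      using A by (intro prod.cong) (auto simp: emeasure_density)
    finally show "emeasure (density (Pi\<^sub>M I (\<lambda>_. lborel)) (\<lambda>z. \<Prod>i\<in>I. f (z i))) (Pi\<^sub>E I A) =
      (\<Prod>i\<in>I. emeasure (density lborel f) (A i))" .
  qed
qed

text \<open>The joint density of independent standard normals is a function of the sum of squares,
  so \<open>nn_integral_sum_squares\<close> gives the law of that sum; the substitution of t / s^2
  for t brings in the scale 2 s^2.\<close>

lemma scaled_chi_squared:
  assumes j: "j > 0" and s: "s > 0"
  shows "distr (chi_squared j) borel (\<lambda>t. s\<^sup>2 * t) = gamma_law (real j / 2) (2 * s\<^sup>2)"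
proof (rule measure_eqI)
  let ?a = "real j / 2"
  let ?phi = "\<lambda>t. ennreal (std_normal_density t)"
  let ?I = "{..<j}"
  have G: "Gamma ?a > 0" using j by simp
  fix A assume "A \<in> sets (distr (chi_squared j) borel (\<lambda>t. s\<^sup>2 * t))"
  hence [measurable]: "A \<in> sets borel" by simp
  have phi: "(\<Prod>i\<in>?I. ?phi (z i)) = ennreal ((2 * pi) powr - ?a * exp (- (\<Sum>i\<in>?I. (z i)\<^sup>2) / 2))" for z
  proof -
    have "1 / sqrt (2 * pi) = (2 * pi) powr - (1 / 2)"
      by (simp add: powr_minus_divide powr_half_sqrt)
    moreover have "((2 * pi) powr - (1 / 2)) ^ j = (2 * pi) powr - ?a"
      by (subst powr_realpow[symmetric]) (simp_all add: powr_powr)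
    ultimately have "(\<Prod>i\<in>?I. std_normal_density (z i)) = (2 * pi) powr - ?a * (\<Prod>i\<in>?I. exp (- (z i)\<^sup>2 / 2))"
      by (simp add: std_normal_density_def prod.distrib)
    also have "(\<Prod>i\<in>?I. exp (- (z i)\<^sup>2 / 2)) = exp (- (\<Sum>i\<in>?I. (z i)\<^sup>2) / 2)"
      by (simp add: exp_sum[symmetric] sum_divide_distrib sum_negf)
    finally show ?thesis by (simp add: prod_ennreal)
  qed
  have "emeasure (distr (chi_squared j) borel (\<lambda>t. s\<^sup>2 * t)) A = (\<integral>\<^sup>+t. indicator A t \<partial>distr (chi_squared j) borel (\<lambda>t. s\<^sup>2 * t))"
    by simp
  also have "\<dots> = (\<integral>\<^sup>+t. indicator A (s\<^sup>2 * t) \<partial>chi_squared j)"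
    by (rule nn_integral_distr) (auto simp: chi_squared_def)
  also have "\<dots> = (\<integral>\<^sup>+z. indicator A (s\<^sup>2 * (\<Sum>i\<in>?I. (z i)\<^sup>2)) \<partial>Pi\<^sub>M ?I (\<lambda>_. density lborel ?phi))"
    unfolding chi_squared_def by (rule nn_integral_distr) measurable
  also have "\<dots> = (\<integral>\<^sup>+z. indicator A (s\<^sup>2 * (\<Sum>i\<in>?I. (z i)\<^sup>2)) \<partial>density (Pi\<^sub>M ?I (\<lambda>_. lborel)) (\<lambda>z. \<Prod>i\<in>?I. ?phi (z i)))"
    by (subst PiM_density_lborel) (auto intro: prob_space_normal_density)
  also have "\<dots> = (\<integral>\<^sup>+z. (\<Prod>i\<in>?I. ?phi (z i)) * indicator A (s\<^sup>2 * (\<Sum>i\<in>?I. (z i)\<^sup>2)) \<partial>Pi\<^sub>M ?I (\<lambda>_. lborel))"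
    by (rule nn_integral_density) measurable
  also have "\<dots> = (\<integral>\<^sup>+z. (\<lambda>t. ennreal ((2 * pi) powr - ?a * exp (- t / 2)) * indicator A (s\<^sup>2 * t))
      (\<Sum>i\<in>?I. (z i)\<^sup>2) \<partial>Pi\<^sub>M ?I (\<lambda>_. lborel))"
    by (simp only: phi)
  also have "\<dots> = (\<integral>\<^sup>+t. ennreal (sq_norm_density (card ?I) t) *
      (ennreal ((2 * pi) powr - ?a * exp (- t / 2)) * indicator A (s\<^sup>2 * t)) \<partial>lborel)"
    using j by (intro nn_integral_sum_squares) (auto simp: lessThan_empty_iff)
  also have "\<dots> = ennreal \<bar>1 / s\<^sup>2\<bar> * (\<integral>\<^sup>+t. ennreal (sq_norm_density (card ?I) (0 + 1 / s\<^sup>2 * t)) *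
      (ennreal ((2 * pi) powr - ?a * exp (- (0 + 1 / s\<^sup>2 * t) / 2)) * indicator A (s\<^sup>2 * (0 + 1 / s\<^sup>2 * t))) \<partial>lborel)"
    using s by (intro nn_integral_real_affine) auto
  also have "\<dots> = (\<integral>\<^sup>+t. ennreal \<bar>1 / s\<^sup>2\<bar> * (ennreal (sq_norm_density (card ?I) (0 + 1 / s\<^sup>2 * t)) *
      (ennreal ((2 * pi) powr - ?a * exp (- (0 + 1 / s\<^sup>2 * t) / 2)) * indicator A (s\<^sup>2 * (0 + 1 / s\<^sup>2 * t)))) \<partial>lborel)"
    by (rule nn_integral_cmult[symmetric]) measurable
  also have "\<dots> = (\<integral>\<^sup>+t. ennreal (if 0 < t then (2 * s\<^sup>2) powr - ?a / Gamma ?a *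
      (t powr (?a - 1) * exp (- (t / (2 * s\<^sup>2)))) else 0) * indicator A t \<partial>lborel)"
  proof (intro nn_integral_cong)
    fix t :: real
    have "\<bar>1 / s\<^sup>2\<bar> * (sq_norm_density j (1 / s\<^sup>2 * t) * ((2 * pi) powr - ?a * exp (- (1 / s\<^sup>2 * t) / 2))) =
       (if 0 < t then (2 * s\<^sup>2) powr - ?a / Gamma ?a * (t powr (?a - 1) * exp (- (t / (2 * s\<^sup>2)))) else 0)"
    proof (cases "t > 0")
      case True
      have "1 / s\<^sup>2 = (s\<^sup>2) powr -1" using s by (simp add: powr_minus_divide)
      hence "1 / s\<^sup>2 * (1 / s\<^sup>2 * t) powr (?a - 1) = (s\<^sup>2) powr -1 * (((s\<^sup>2) powr -1) powr (?a - 1) * t powr (?a - 1))"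
        by (simp only: powr_mult)
      also have "\<dots> = (s\<^sup>2) powr - ?a * t powr (?a - 1)"
        unfolding powr_powr mult.assoc[symmetric] powr_add[symmetric] by simp
      finally have 1: "1 / s\<^sup>2 * (1 / s\<^sup>2 * t) powr (?a - 1) = (s\<^sup>2) powr - ?a * t powr (?a - 1)" .
      have 2: "pi powr ?a * (2 * pi) powr - ?a * (s\<^sup>2) powr - ?a = (2 * s\<^sup>2) powr - ?a"
        by (simp add: powr_mult powr_minus)
      have "\<bar>1 / s\<^sup>2\<bar> * (sq_norm_density j (1 / s\<^sup>2 * t) * ((2 * pi) powr - ?a * exp (- (1 / s\<^sup>2 * t) / 2))) =
         pi powr ?a * (2 * pi) powr - ?a / Gamma ?a * (1 / s\<^sup>2 * (1 / s\<^sup>2 * t) powr (?a - 1)) * exp (- (t / (2 * s\<^sup>2)))"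
        using True s by (simp add: sq_norm_density_def mult_ac)
      also have "\<dots> = (pi powr ?a * (2 * pi) powr - ?a * (s\<^sup>2) powr - ?a) / Gamma ?a * (t powr (?a - 1) * exp (- (t / (2 * s\<^sup>2))))"
        unfolding 1 by simp
      finally show ?thesis using True unfolding 2 by simp
    next
      case False
      hence "\<not> 0 < 1 / s\<^sup>2 * t" using s by (simp add: zero_less_divide_iff)
      thus ?thesis using False by (simp add: sq_norm_density_def)
    qed
    moreover have "s\<^sup>2 * (0 + 1 / s\<^sup>2 * t) = t" using s by simp
    ultimately show "ennreal \<bar>1 / s\<^sup>2\<bar> * (ennreal (sq_norm_density (card ?I) (0 + 1 / s\<^sup>2 * t)) *
      (ennreal ((2 * pi) powr - ?a * exp (- (0 + 1 / s\<^sup>2 * t) / 2)) * indicator A (s\<^sup>2 * (0 + 1 / s\<^sup>2 * t)))) =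
      ennreal (if 0 < t then (2 * s\<^sup>2) powr - ?a / Gamma ?a *
      (t powr (?a - 1) * exp (- (t / (2 * s\<^sup>2)))) else 0) * indicator A t"
      by (simp only: mult.assoc[symmetric] card_lessThan add_0_left ennreal_mult[symmetric] abs_ge_zero
          sq_norm_density_nonneg mult_nonneg_nonneg powr_ge_zero exp_ge_zero)
  qed
  also have "\<dots> = emeasure (gamma_law ?a (2 * s\<^sup>2)) A"
    unfolding gamma_law_def by (rule emeasure_density[symmetric]) measurable
  finally show "emeasure (distr (chi_squared j) borel (\<lambda>t. s\<^sup>2 * t)) A = emeasure (gamma_law ?a (2 * s\<^sup>2)) A" .
qed (simp add: gamma_law_def)

section \<open>The beta type I weight\<close>

text \<open>Integrating out one entry raises \<nu> by 1: the first n entries have the type I density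
  for dimension n with parameter \<nu> + N - n.\<close>

definition beta1_family :: "nat \<Rightarrow> nat \<Rightarrow> real \<Rightarrow> nat \<Rightarrow> real \<Rightarrow> ennreal" where
  "beta1_family b N \<nu> n t = ennreal (if t < 1 then
     pi powr (- (real b * real n / 2)) * rpoch (real b * (\<nu> + real N - real n) / 2) (real b * real n / 2)
       * (1 - t) powr (real b * (\<nu> + real N - real n) / 2 - 1) else 0)"

lemma beta1_family_measurable [measurable]: "beta1_family b N \<nu> n \<in> borel_measurable borel"
  unfolding beta1_family_def[abs_def] by measurable

text \<open>In this form the numerator is free of n, so it is a common factor of both sides of the
  recursion.\<close>

lemma rpoch_beta1:
  "rpoch (real b * (\<nu> + real N - real n) / 2) (real b * real n / 2) =
   Gamma (real b * (\<nu> + real N) / 2) / Gamma (real b * (\<nu> + real N - real n) / 2)"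
proof -
  have "real b * (\<nu> + real N - real n) / 2 + real b * real n / 2 = real b * (\<nu> + real N) / 2"
    by (simp add: field_simps)
  thus ?thesis by (simp only: rpoch_def)
qed

text \<open>The omitted entry has squared norm u < 1 - t, which gives a Beta integral over (0, 1 -
  t). For t \<ge> 1 both sides vanish.\<close>

lemma radial_family_beta1:
  assumes b: "b > 0" and \<nu>: "\<nu> > 0"
  shows "radial_family b N (beta1_family b N \<nu>)"
  unfolding radial_family_def
proof (intro conjI allI impI)
  let ?a = "real b / 2" and ?c = "real b * (\<nu> + real N) / 2"
  have G: "Gamma ?a > 0" "Gamma ?c > 0" using b \<nu> by simp_all
  show "beta1_family b N \<nu> n \<in> borel_measurable borel" for n by measurable
  show "beta1_family b N \<nu> 0 0 = 1" using G(2) by (simp add: beta1_family_def rpoch_def)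
  fix n and t :: real assume n: "n < N" and t: "0 \<le> t"
  let ?q = "real b * (\<nu> + real N - real n) / 2" and ?q' = "real b * (\<nu> + real N - real (Suc n)) / 2"
  have q': "?q' > 0" using b \<nu> n by simp
  have aq: "?a + ?q' = ?q" by (simp add: field_simps)
  have q: "?q > 0" using q' aq by simp
  have G': "Gamma ?q' > 0" "Gamma ?q > 0" using q' q by (intro Gamma_real_pos; simp)+
  show "(\<integral>\<^sup>+u. ennreal (sq_norm_density b u) * beta1_family b N \<nu> (Suc n) (t + u) \<partial>lborel) =
    beta1_family b N \<nu> n t"
  proof (cases "t < 1")
    case False
    hence "ennreal (sq_norm_density b u) * beta1_family b N \<nu> (Suc n) (t + u) = 0" for u
      by (auto simp: sq_norm_density_def beta1_family_def)
    hence "(\<integral>\<^sup>+u. ennreal (sq_norm_density b u) * beta1_family b N \<nu> (Suc n) (t + u) \<partial>lborel) = 0"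
      by (simp only: nn_integral_const mult_zero_left)
    thus ?thesis using False by (simp add: beta1_family_def)
  next
    case True
    define C where "C = pi powr ?a / Gamma ?a * (pi powr (- (real b * real (Suc n) / 2)) * (Gamma ?c / Gamma ?q'))"
    have C: "C \<ge> 0" using G G' by (simp add: C_def)
    have "(\<integral>\<^sup>+u. ennreal (sq_norm_density b u) * beta1_family b N \<nu> (Suc n) (t + u) \<partial>lborel) =
       (\<integral>\<^sup>+u. ennreal C * ennreal (if 0 < u \<and> u < 1 - t then u powr (?a - 1) * ((1 - t) - u) powr (?q' - 1) else 0) \<partial>lborel)"
    proof (intro nn_integral_cong)
      fix u :: real
      have "sq_norm_density b u * (if t + u < 1 then pi powr (- (real b * real (Suc n) / 2)) * (Gamma ?c / Gamma ?q')
           * (1 - (t + u)) powr (?q' - 1) else 0) =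
         C * (if 0 < u \<and> u < 1 - t then u powr (?a - 1) * ((1 - t) - u) powr (?q' - 1) else 0)"
        by (auto simp: sq_norm_density_def C_def diff_diff_eq)
      thus "ennreal (sq_norm_density b u) * beta1_family b N \<nu> (Suc n) (t + u) =
         ennreal C * ennreal (if 0 < u \<and> u < 1 - t then u powr (?a - 1) * ((1 - t) - u) powr (?q' - 1) else 0)"
        unfolding beta1_family_def rpoch_beta1 using C sq_norm_density_nonneg[of b u]
        by (simp only: ennreal_mult'[symmetric])
    qed
    also have "\<dots> = ennreal C * (\<integral>\<^sup>+u. ennreal (if 0 < u \<and> u < 1 - t then u powr (?a - 1) * ((1 - t) - u) powr (?q' - 1) else 0) \<partial>lborel)"
      by (rule nn_integral_cmult) measurable
    also have "\<dots> = ennreal C * ennreal ((1 - t) powr (?a + ?q' - 1) * Beta ?a ?q')"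
      using b q' True by (subst Beta_nn_scaled) auto
    also have "\<dots> = ennreal (C * ((1 - t) powr (?q - 1) * Beta ?a ?q'))"
      using C by (simp only: ennreal_mult'[symmetric] aq)
    also have "C * ((1 - t) powr (?q - 1) * Beta ?a ?q') =
        (pi powr ?a * pi powr (- (real b * real (Suc n) / 2))) * (Gamma ?c / Gamma ?q) * (1 - t) powr (?q - 1)"
      unfolding Beta_def aq C_def using G G' by simp
    also have "pi powr ?a * pi powr (- (real b * real (Suc n) / 2)) = pi powr (- (real b * real n / 2))"
      unfolding powr_add[symmetric] by (simp add: field_simps)
    finally show ?thesis using True by (simp only: beta1_family_def rpoch_beta1 if_True)
  qed
qed

lemma norm_law_beta1:
  assumes bn: "b > 0" "n > 0" and \<nu>: "\<nu> > 0" and n: "n \<le> N"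
  shows "norm_law b n (beta1_family b N \<nu>) =
    beta_law (real b * real n / 2) (real b * (\<nu> + real N - real n) / 2)"
proof -
  let ?a = "real b * real n / 2" and ?q = "real b * (\<nu> + real N - real n) / 2" and ?c = "real b * (\<nu> + real N) / 2"
  have q: "?q > 0" using bn \<nu> n by simp
  have aq: "?a + ?q = ?c" by (simp add: field_simps)
  have c: "?c > 0" using bn \<nu> by simp
  have G: "Gamma ?a > 0" "Gamma ?q > 0" "Gamma ?c > 0"
    using bn q c by (intro Gamma_real_pos; simp)+
  have "ennreal (sq_norm_density (b * n) t) * beta1_family b N \<nu> n t =
     ennreal (if 0 < t \<and> t < 1 then t powr (?a - 1) * (1 - t) powr (?q - 1) / Beta ?a ?q else 0)" for t
  proof -
    have "pi powr ?a * pi powr - ?a = 1" by (simp add: powr_minus)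
    hence "pi powr ?a / Gamma ?a * t powr (?a - 1) * (pi powr - ?a * (Gamma ?c / Gamma ?q) * (1 - t) powr (?q - 1)) =
       t powr (?a - 1) * (1 - t) powr (?q - 1) / (Gamma ?a * Gamma ?q / Gamma ?c)"
      using G by (simp add: mult_ac)
    note eq = this
    have s: "sq_norm_density (b * n) t = (if 0 < t then pi powr ?a / Gamma ?a * t powr (?a - 1) else 0)"
      by (simp add: sq_norm_density_def)
    have "sq_norm_density (b * n) t * (if t < 1 then pi powr - ?a * (Gamma ?c / Gamma ?q) * (1 - t) powr (?q - 1) else 0) =
       (if 0 < t \<and> t < 1 then t powr (?a - 1) * (1 - t) powr (?q - 1) / Beta ?a ?q else 0)"
      by (cases "0 < t"; cases "t < 1")
         (simp_all only: s Beta_def aq eq if_True if_False simp_thms mult_zero_left mult_zero_right)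
    thus ?thesis
      unfolding beta1_family_def rpoch_beta1 using sq_norm_density_nonneg[of "b * n" t]
      by (simp only: ennreal_mult'[symmetric])
  qed
  thus ?thesis by (simp only: norm_law_density[OF bn beta1_family_measurable] beta_law_def)
qed

section \<open>The beta type II weight\<close>

text \<open>\<open>c\<close> does not change with n: like the degrees of freedom of a multivariate t
  distribution, it is kept by marginals.\<close>

definition beta2_family :: "nat \<Rightarrow> real \<Rightarrow> nat \<Rightarrow> real \<Rightarrow> ennreal" where
  "beta2_family b c n t = ennreal (pi powr (- (real b * real n / 2)) * rpoch (c / 2) (real b * real n / 2)
     * (1 + t) powr (- ((real b * real n + c) / 2)))"

lemma beta2_family_measurable [measurable]: "beta2_family b c n \<in> borel_measurable borel"
  unfolding beta2_family_def[abs_def] by measurable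

text \<open>This is \<open>Beta_prime_nn\<close> with shift 1 + t; subtracting b/2 from the exponent
  (b (n + 1) + c) / 2 leaves the exponent for n.\<close>

lemma radial_family_beta2:
  assumes b: "b > 0" and c: "c > 0"
  shows "radial_family b N (beta2_family b c)"
  unfolding radial_family_def
proof (intro conjI allI impI)
  let ?a = "real b / 2"
  have G: "Gamma ?a > 0" "Gamma (c / 2) > 0" using b c by simp_all
  show "beta2_family b c n \<in> borel_measurable borel" for n by measurable
  show "beta2_family b c 0 0 = 1" using G(2) by (simp add: beta2_family_def rpoch_def)
  fix n and t :: real assume t: "0 \<le> t"
  let ?p = "(real b * real (Suc n) + c) / 2" and ?p' = "(real b * real n + c) / 2"
  have p: "?p > 0" "?p' > 0" using b c by (simp_all add: add_nonneg_pos)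
  have Gp: "Gamma ?p > 0" "Gamma ?p' > 0" using p by (intro Gamma_real_pos; simp)+
  have pa: "?p - ?a = ?p'" by (simp add: field_simps)
  have r: "rpoch (c / 2) (real b * real m / 2) = Gamma ((real b * real m + c) / 2) / Gamma (c / 2)" for m
    by (simp add: rpoch_def add_divide_distrib add.commute)
  define C where "C = pi powr ?a / Gamma ?a * (pi powr (- (real b * real (Suc n) / 2)) * (Gamma ?p / Gamma (c / 2)))"
  have C: "C \<ge> 0" using G Gp by (simp add: C_def)
  have "(\<integral>\<^sup>+u. ennreal (sq_norm_density b u) * beta2_family b c (Suc n) (t + u) \<partial>lborel) =
     (\<integral>\<^sup>+u. ennreal C * ennreal (if 0 < u then u powr (?a - 1) * ((1 + t) + u) powr - ?p else 0) \<partial>lborel)"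
  proof (intro nn_integral_cong)
    fix u :: real
    have "sq_norm_density b u * (pi powr (- (real b * real (Suc n) / 2)) * (Gamma ?p / Gamma (c / 2))
         * (1 + (t + u)) powr - ?p) =
       C * (if 0 < u then u powr (?a - 1) * ((1 + t) + u) powr - ?p else 0)"
      by (auto simp: sq_norm_density_def C_def add.assoc)
    thus "ennreal (sq_norm_density b u) * beta2_family b c (Suc n) (t + u) =
       ennreal C * ennreal (if 0 < u then u powr (?a - 1) * ((1 + t) + u) powr - ?p else 0)"
      unfolding beta2_family_def r using C sq_norm_density_nonneg[of b u]
      by (simp only: ennreal_mult'[symmetric])
  qed
  also have "\<dots> = ennreal C * (\<integral>\<^sup>+u. ennreal (if 0 < u then u powr (?a - 1) * ((1 + t) + u) powr - ?p else 0) \<partial>lborel)"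
    by (rule nn_integral_cmult) measurable
  also have "(\<integral>\<^sup>+u. ennreal (if 0 < u then u powr (?a - 1) * ((1 + t) + u) powr - ?p else 0) \<partial>lborel) =
      ennreal ((1 + t) powr (?a - ?p) / Gamma ?p) * (Gamma_nn ?a * Gamma_nn (?p - ?a))"
    using p t by (intro Beta_prime_nn) auto
  also have "\<dots> = ennreal ((1 + t) powr (?a - ?p) / Gamma ?p) * (ennreal (Gamma ?a) * ennreal (Gamma ?p'))"
    unfolding pa using b p by (subst (1 2) Gamma_nn_pos) auto
  also have "ennreal C * \<dots> = ennreal (C * ((1 + t) powr (?a - ?p) / Gamma ?p * (Gamma ?a * Gamma ?p')))"
    using C G Gp by (simp only: ennreal_mult[symmetric] divide_nonneg_pos powr_ge_zero mult_nonneg_nonneg less_imp_le)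
  also have "?a - ?p = - ?p'" using pa by linarith
  also have "C * ((1 + t) powr - ?p' / Gamma ?p * (Gamma ?a * Gamma ?p')) =
      (pi powr ?a * pi powr (- (real b * real (Suc n) / 2))) * (Gamma ?p' / Gamma (c / 2)) * (1 + t) powr - ?p'"
    unfolding C_def using G Gp by simp
  also have "pi powr ?a * pi powr (- (real b * real (Suc n) / 2)) = pi powr (- (real b * real n / 2))"
    unfolding powr_add[symmetric] by (simp add: field_simps)
  finally show "(\<integral>\<^sup>+u. ennreal (sq_norm_density b u) * beta2_family b c (Suc n) (t + u) \<partial>lborel) =
    beta2_family b c n t" by (simp only: beta2_family_def r)
qed

lemma norm_law_beta2:
  assumes bn: "b > 0" "n > 0" and c: "c > 0"
  shows "norm_law b n (beta2_family b c) = beta_prime_law (real b * real n / 2) (c / 2)"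
proof -
  let ?a = "real b * real n / 2" and ?p = "(real b * real n + c) / 2"
  have ap: "?a + c / 2 = ?p" by (simp add: field_simps)
  have p: "?p > 0" using bn c by (simp add: add_nonneg_pos)
  have G: "Gamma ?a > 0" "Gamma ?p > 0" "Gamma (c / 2) > 0"
    using bn c p by (intro Gamma_real_pos; simp)+
  have r: "rpoch (c / 2) ?a = Gamma ?p / Gamma (c / 2)"
    by (simp add: rpoch_def add_divide_distrib add.commute)
  have "ennreal (sq_norm_density (b * n) t) * beta2_family b c n t =
     ennreal (if 0 < t then t powr (?a - 1) / (1 + t) powr (?a + c / 2) / Beta ?a (c / 2) else 0)" for t
  proof -
    have "pi powr ?a * pi powr - ?a = 1" by (simp add: powr_minus)
    hence "pi powr ?a / Gamma ?a * t powr (?a - 1) * (pi powr - ?a * (Gamma ?p / Gamma (c / 2)) * (1 / (1 + t) powr ?p)) =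
       t powr (?a - 1) / (1 + t) powr ?p / (Gamma ?a * Gamma (c / 2) / Gamma ?p)"
      using G by (simp add: mult_ac)
    hence "sq_norm_density (b * n) t * (pi powr - ?a * (Gamma ?p / Gamma (c / 2)) * (1 + t) powr - ?p) =
       (if 0 < t then t powr (?a - 1) / (1 + t) powr (?a + c / 2) / Beta ?a (c / 2) else 0)"
      unfolding powr_minus_divide[of _ ?p] by (simp add: sq_norm_density_def Beta_def ap)
    thus ?thesis
      unfolding beta2_family_def r using sq_norm_density_nonneg[of "b * n" t]
      by (simp only: ennreal_mult'[symmetric])
  qed
  thus ?thesis by (simp only: norm_law_density[OF bn beta2_family_measurable] beta_prime_law_def)
qed

section \<open>The laws and moments for the three weights\<close>

lemma product_law_cong:
  assumes "\<And>l. l \<in> L \<Longrightarrow> K l = K' l"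
  shows "product_law L K = product_law L K'"
  unfolding product_law_def
  by (intro arg_cong2[where f = "\<lambda>A. distr A borel"] PiM_cong refl assms)

text \<open>The second conclusion pairs row l with dimension N + 1 - l, as the moments and both Beta
  laws require; the third pairs it with dimension l, as the chi-squared law with b l degrees of
  freedom requires.\<close>

lemma abs_det_sq_law:
  fixes x :: "nat \<Rightarrow> 'w \<Rightarrow> nat \<times> nat \<Rightarrow> real" and m :: "real \<Rightarrow> nat \<Rightarrow> real"
  assumes M: "prob_space M" and b: "b \<in> {1, 2, 4}" and N: "N \<ge> 1"
    and indep: "prob_space.indep_vars M (\<lambda>_. row_space b N) x {1..N}"
    and P: "\<And>l. l \<in> {1..N} \<Longrightarrow> radial_family b N (P l)"
    and dist: "\<And>l. l \<in> {1..N} \<Longrightarrow> distributed M (row_space b N) (x l) (\<lambda>v. P l N (row_norm_sq b N v))"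
    and K: "\<And>l. l \<in> {1..N} \<Longrightarrow> norm_law b (Suc N - l) (P l) = K l"
    and moment: "\<And>l \<alpha>. l \<in> {1..N} \<Longrightarrow> (\<integral>\<^sup>+y. ennreal (y powr \<alpha>) \<partial>K l) = ennreal (m \<alpha> l) \<or>
        (\<integral>\<^sup>+y. ennreal (y powr \<alpha>) \<partial>K l) = \<infinity>"
      "\<And>l \<alpha>. l \<in> {1..N} \<Longrightarrow> (\<integral>\<^sup>+y. ennreal (y powr \<alpha>) \<partial>K l) \<noteq> 0"
  defines "D \<equiv> \<lambda>w. abs_det_sq b N (\<lambda>l. x l w)"
  shows "integrable M (\<lambda>w. D w powr \<alpha>) \<Longrightarrow> prob_space.expectation M (\<lambda>w. D w powr \<alpha>) = (\<Prod>l=1..N. m \<alpha> l)"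
    "distr M borel D = product_law {1..N} K"
    "distr M borel D = product_law {1..N} (\<lambda>l. norm_law b l (P l))"
proof -
  note random = distr_abs_det_sq_random[where P = P, OF M b N indep dist, folded D_def]
  have b0: "b > 0" using b by auto
  show "distr M borel D = product_law {1..N} (\<lambda>l. norm_law b l (P l))"
    using random(2) distr_abs_det_sq_row_laws[OF b P] by simp
  have "distr M borel D = product_law {1..N} (\<lambda>l. norm_law b (Suc N - l) (P l))"
    using random(2) distr_abs_det_sq_row_laws_reversed[OF b P] by simp
  also have "\<dots> = product_law {1..N} K" by (rule product_law_cong) (rule K)
  finally show law: "distr M borel D = product_law {1..N} K" .
  have prob: "prob_space (K l)" "sets (K l) = sets borel" if "l \<in> {1..N}" for l
    using prob_space_norm_law[OF b0 P[OF that], of "Suc N - l"] that by (auto simp: K[OF that, symmetric])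
  show "prob_space.expectation M (\<lambda>w. D w powr \<alpha>) = (\<Prod>l=1..N. m \<alpha> l)"
    if "integrable M (\<lambda>w. D w powr \<alpha>)"
    by (rule expectation_powr_product_law[OF M random(1) law _ prob moment(1) moment(2) that]) auto
qed

text \<open>A type II row with density parameter c has squared norms with second BetaP parameter c /
  2, by \<open>norm_law_beta2\<close>. The parameter \<beta> \<omega>_l / 2 in the moments and in
  the law therefore belongs to c = \<beta> \<omega>_l, the value at which the density is taken here;
  for \<beta> = 1 this is \<omega>_l.\<close>

theorem proposition2:
  fixes M :: "'w measure"
    and \<beta> N :: nat
    and x :: "nat \<Rightarrow> 'w \<Rightarrow> nat \<times> nat \<Rightarrow> real"
  assumes "prob_space M"
    and "\<beta> \<in> {1, 2, 4}"
    and "N \<ge> 1"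
    and "prob_space.indep_vars M (\<lambda>_. row_space \<beta> N) x {1..N}"
  defines "D \<equiv> \<lambda>w. abs_det_sq \<beta> N (\<lambda>l. x l w)"
  shows
    "(\<forall>\<sigma> :: nat \<Rightarrow> real.
        (\<forall>l\<in>{1..N}. \<sigma> l > 0 \<and>
           distributed M (row_space \<beta> N) (x l) (\<lambda>v. ennreal (gauss_row_density \<beta> N (\<sigma> l) v))) \<longrightarrow>
        (\<forall>\<alpha> :: real. integrable M (\<lambda>w. D w powr \<alpha>) \<longrightarrow>
           prob_space.expectation M (\<lambda>w. D w powr \<alpha>) =
             (\<Prod>l=1..N. (2 * (\<sigma> l)\<^sup>2) powr \<alpha> * rpoch (real \<beta> * (real N - real l + 1) / 2) \<alpha>)) \<and>
        distr M borel D =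
          product_law {1..N} (\<lambda>l. distr (chi_squared (\<beta> * l)) borel (\<lambda>t. (\<sigma> l)\<^sup>2 * t)))
   \<and> (\<forall>\<nu> :: nat \<Rightarrow> real.
        (\<forall>l\<in>{1..N}. \<nu> l > 0 \<and>
           distributed M (row_space \<beta> N) (x l) (\<lambda>v. ennreal (beta1_row_density \<beta> N (\<nu> l) v))) \<longrightarrow>
        (\<forall>\<alpha> :: real. integrable M (\<lambda>w. D w powr \<alpha>) \<longrightarrow>
           prob_space.expectation M (\<lambda>w. D w powr \<alpha>) =
             (\<Prod>l=1..N. rpoch (real \<beta> * (real N - real l + 1) / 2) \<alpha>
                         / rpoch (real \<beta> * (real N + \<nu> l) / 2) \<alpha>)) \<and>
        distr M borel D =
          product_law {1..N} (\<lambda>l. beta_law (real \<beta> * (real N - real l + 1) / 2)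
                                           (real \<beta> * (\<nu> l + real l - 1) / 2)))
   \<and> (\<forall>\<omega> :: nat \<Rightarrow> real.
        (\<forall>l\<in>{1..N}. \<omega> l > 0 \<and>
           distributed M (row_space \<beta> N) (x l)
             (\<lambda>v. ennreal (beta2_row_density \<beta> N (real \<beta> * \<omega> l) v))) \<longrightarrow>
        (\<forall>\<alpha> :: real. integrable M (\<lambda>w. D w powr \<alpha>) \<longrightarrow>
           prob_space.expectation M (\<lambda>w. D w powr \<alpha>) =
             (\<Prod>l=1..N. rpoch (real \<beta> * (real N - real l + 1) / 2) \<alpha>
                         * rpoch (real \<beta> * \<omega> l / 2) (- \<alpha>))) \<and>
        distr M borel D =
          product_law {1..N} (\<lambda>l. beta_prime_law (real \<beta> * (real N - real l + 1) / 2)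
                                                 (real \<beta> * \<omega> l / 2)))"
  (is "?gauss \<and> ?beta1 \<and> ?beta2")
proof (intro conjI)
  note law = abs_det_sq_law[OF assms(1-4)]
  have \<beta>: "\<beta> > 0" using assms(2) by auto
  let ?a = "\<lambda>l. real \<beta> * (real N - real l + 1) / 2"
  have n: "real (Suc N - l) = real N - real l + 1" "Suc N - l > 0" "Suc N - l \<le> N" "?a l > 0" if "l \<in> {1..N}" for l
    using that \<beta> by (auto simp: of_nat_diff)
  show ?gauss
  proof (intro allI impI)
    fix \<sigma> :: "nat \<Rightarrow> real"
    assume H: "\<forall>l\<in>{1..N}. \<sigma> l > 0 \<and>
      distributed M (row_space \<beta> N) (x l) (\<lambda>v. ennreal (gauss_row_density \<beta> N (\<sigma> l) v))"
    let ?P = "\<lambda>l. gauss_family \<beta> (\<sigma> l)"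
    have \<sigma>: "\<sigma> l > 0" if "l \<in> {1..N}" for l using H that by blast
    have dist: "distributed M (row_space \<beta> N) (x l) (\<lambda>v. ?P l N (row_norm_sq \<beta> N v))" if "l \<in> {1..N}" for l
      using H that by (simp only: gauss_family_def gauss_row_density_def)
    have K: "norm_law \<beta> (Suc N - l) (?P l) = gamma_law (?a l) (2 * (\<sigma> l)\<^sup>2)" if "l \<in> {1..N}" for l
    proof -
      have "norm_law \<beta> (Suc N - l) (?P l) = gamma_law (real (\<beta> * (Suc N - l)) / 2) (2 * (\<sigma> l)\<^sup>2)"
        using \<beta> n(2)[OF that] \<sigma>[OF that] by (rule norm_law_gauss)
      thus ?thesis by (simp only: of_nat_mult n(1)[OF that])
    qed
    have pos: "2 * (\<sigma> l)\<^sup>2 > 0" if "l \<in> {1..N}" for l using \<sigma>[OF that] by simp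
    note gauss = law[of ?P "\<lambda>l. gamma_law (?a l) (2 * (\<sigma> l)\<^sup>2)"
        "\<lambda>\<alpha> l. (2 * (\<sigma> l)\<^sup>2) powr \<alpha> * rpoch (?a l) \<alpha>",
        OF radial_family_gauss[OF \<beta> \<sigma>] dist K gamma_law_moment_cases[OF n(4) pos]]
    \<comment> \<open>The law is taken in the direct order of dimensions, whereas the moment formula
      below comes from the reversed one.\<close>
    have "distr M borel D = product_law {1..N} (\<lambda>l. norm_law \<beta> l (?P l))"
      unfolding D_def by (rule gauss(3))
    also have "\<dots> = product_law {1..N} (\<lambda>l. distr (chi_squared (\<beta> * l)) borel (\<lambda>t. (\<sigma> l)\<^sup>2 * t))"
      using H \<beta> by (intro product_law_cong) (simp add: norm_law_gauss scaled_chi_squared)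
    finally have *: "distr M borel D =
        product_law {1..N} (\<lambda>l. distr (chi_squared (\<beta> * l)) borel (\<lambda>t. (\<sigma> l)\<^sup>2 * t))" .
    show "(\<forall>\<alpha> :: real. integrable M (\<lambda>w. D w powr \<alpha>) \<longrightarrow>
           prob_space.expectation M (\<lambda>w. D w powr \<alpha>) =
             (\<Prod>l=1..N. (2 * (\<sigma> l)\<^sup>2) powr \<alpha> * rpoch (real \<beta> * (real N - real l + 1) / 2) \<alpha>)) \<and>
        distr M borel D =
          product_law {1..N} (\<lambda>l. distr (chi_squared (\<beta> * l)) borel (\<lambda>t. (\<sigma> l)\<^sup>2 * t))"
      unfolding D_def by (intro conjI allI impI) ((rule gauss(1); assumption), rule *[unfolded D_def])
  qed
  show ?beta1
  proof (intro allI impI)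
    fix \<nu> :: "nat \<Rightarrow> real"
    assume H: "\<forall>l\<in>{1..N}. \<nu> l > 0 \<and>
      distributed M (row_space \<beta> N) (x l) (\<lambda>v. ennreal (beta1_row_density \<beta> N (\<nu> l) v))"
    let ?P = "\<lambda>l. beta1_family \<beta> N (\<nu> l)" and ?q = "\<lambda>l. real \<beta> * (\<nu> l + real l - 1) / 2"
    have \<nu>: "\<nu> l > 0" if "l \<in> {1..N}" for l using H that by blast
    \<comment> \<open>At n = N the shifted parameter \<nu> + N - n is \<nu> itself, so the top
      member of the family is the given row density.\<close>
    have "?P l N t = ennreal (if t < 1 then pi powr (- (real \<beta> * real N / 2)) *
        rpoch (real \<beta> * \<nu> l / 2) (real \<beta> * real N / 2) * (1 - t) powr (real \<beta> * \<nu> l / 2 - 1) else 0)" for l t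
      by (simp add: beta1_family_def)
    hence dist: "distributed M (row_space \<beta> N) (x l) (\<lambda>v. ?P l N (row_norm_sq \<beta> N v))" if "l \<in> {1..N}" for l
      using H that by (simp only: beta1_row_density_def)
    have K: "norm_law \<beta> (Suc N - l) (?P l) = beta_law (?a l) (?q l)" if l: "l \<in> {1..N}" for l
    proof -
      have "norm_law \<beta> (Suc N - l) (?P l) =
          beta_law (real \<beta> * real (Suc N - l) / 2) (real \<beta> * (\<nu> l + real N - real (Suc N - l)) / 2)"
        using H l \<beta> n[OF l] by (intro norm_law_beta1) auto
      thus ?thesis unfolding n(1)[OF l] by (simp add: algebra_simps)
    qed
    have q: "?q l > 0" if "l \<in> {1..N}" for l
      using H that \<beta> by (auto intro!: mult_pos_pos simp: add_pos_nonneg add_diff_eq[symmetric])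
    have aq: "?a l + ?q l = real \<beta> * (real N + \<nu> l) / 2" for l by (simp add: field_simps)
    note beta1 = law[of ?P "\<lambda>l. beta_law (?a l) (?q l)" "\<lambda>\<alpha> l. rpoch (?a l) \<alpha> / rpoch (?a l + ?q l) \<alpha>",
        OF radial_family_beta1[OF \<beta> \<nu>] dist K beta_law_moment_cases[OF n(4) q], unfolded aq]
    show "(\<forall>\<alpha> :: real. integrable M (\<lambda>w. D w powr \<alpha>) \<longrightarrow>
           prob_space.expectation M (\<lambda>w. D w powr \<alpha>) =
             (\<Prod>l=1..N. rpoch (real \<beta> * (real N - real l + 1) / 2) \<alpha>
                         / rpoch (real \<beta> * (real N + \<nu> l) / 2) \<alpha>)) \<and>
        distr M borel D =
          product_law {1..N} (\<lambda>l. beta_law (real \<beta> * (real N - real l + 1) / 2)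
                                           (real \<beta> * (\<nu> l + real l - 1) / 2))"
      unfolding D_def by (intro conjI allI impI) ((rule beta1(1); assumption), (rule beta1(2); assumption))
  qed
  show ?beta2
  proof (intro allI impI)
    fix \<omega> :: "nat \<Rightarrow> real"
    assume H: "\<forall>l\<in>{1..N}. \<omega> l > 0 \<and> distributed M (row_space \<beta> N) (x l)
             (\<lambda>v. ennreal (beta2_row_density \<beta> N (real \<beta> * \<omega> l) v))"
    let ?P = "\<lambda>l. beta2_family \<beta> (real \<beta> * \<omega> l)"
    have dist: "distributed M (row_space \<beta> N) (x l) (\<lambda>v. ?P l N (row_norm_sq \<beta> N v))" if "l \<in> {1..N}" for l
      using H that by (simp only: beta2_family_def beta2_row_density_def)
    have q: "real \<beta> * \<omega> l > 0" if "l \<in> {1..N}" for l using H that \<beta> by simp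
    have K: "norm_law \<beta> (Suc N - l) (?P l) = beta_prime_law (?a l) (real \<beta> * \<omega> l / 2)" if l: "l \<in> {1..N}" for l
      unfolding n(1)[OF l, symmetric] using \<beta> n[OF l] q[OF l] by (intro norm_law_beta2) auto
    note beta2 = law[of ?P "\<lambda>l. beta_prime_law (?a l) (real \<beta> * \<omega> l / 2)"
        "\<lambda>\<alpha> l. rpoch (?a l) \<alpha> * rpoch (real \<beta> * \<omega> l / 2) (- \<alpha>)",
        OF radial_family_beta2[OF \<beta> q] dist K beta_prime_law_moment_cases[OF n(4) half_gt_zero[OF q]]]
    show "(\<forall>\<alpha> :: real. integrable M (\<lambda>w. D w powr \<alpha>) \<longrightarrow>
           prob_space.expectation M (\<lambda>w. D w powr \<alpha>) =
             (\<Prod>l=1..N. rpoch (real \<beta> * (real N - real l + 1) / 2) \<alpha>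
                         * rpoch (real \<beta> * \<omega> l / 2) (- \<alpha>))) \<and>
        distr M borel D =
          product_law {1..N} (\<lambda>l. beta_prime_law (real \<beta> * (real N - real l + 1) / 2)
                                                 (real \<beta> * \<omega> l / 2))"
      unfolding D_def by (intro conjI allI impI) ((rule beta2(1); assumption), (rule beta2(2); assumption))
  qed
qed

end
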